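(* Let $P$ be a polynomial of degree $\lambda\ge 1$ with $\mathrm{Re}\,P(ix)=0$ for all $x\in\mathbb{R}$, and let $0<\varepsilon\le 1$. Fix $0\le\sigma\le 1$ and $r\ge 0$ such that $r+1+3\lambda-2\sigma>1/2$, and assume that the exact solution $u$ of the equation $$\partial_t u+\mathcal{L}_{\varepsilon,\lambda}u+\varepsilon\mathcal{L}_\varepsilon(u^2)=0\quad\text{on }\mathbb{T}$$ satisfies $u\in\mathcal{C}([0,T],H^{r+1+3\lambda-2\sigma}(\mathbb{T}))$. Then there exists $\tau_0>0$ such that for $\tau\le\tau_0$ and $t_n=n\tau\le T$, the third order splitting approximation $u^{n+1}=\tilde\Psi^\tau(u^n)$, $u^0=u(0)$, with $$\tilde\Psi^\tau=\Psi_2^{d_3\tau}\circ\tilde\Psi_1^{c_3\tau}\circ\Psi_2^{d_2\tau}\circ\tilde\Psi_1^{c_2\tau}\circ\Psi_2^{d_1\tau}\circ\tilde\Psi_1^{c_1\tau}$$ (the flows $\Psi_2^t,\tilde\Psi_1^t$ and the weights $c_i,d_i$ being given in the context), satisfies the global error estimate $$\|u(t_n)-u^n\|_r\le \varepsilon^{1-\sigma}\tau^3 K,$$ for a constant $K=K\big(\sup_{t\in[0,T]}\|u(t)\|_{r+1+3\lambda-2\sigma}\big)>0$ (uniform in $\varepsilon$).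
   Context: $\mathbb{T}=[-\pi,\pi]$ with periodic boundary conditions. For $s\in\mathbb{R}$, $\|\cdot\|_s$ is the standard $H^s(\mathbb{T})$ norm, $\|f\|_s^2=\sum_{k\in\mathbb{Z}}(1+|k|)^{2s}|\hat f_k|^2$. The operators are the Fourier multipliers $\mathcal{L}_\varepsilon=\frac{\partial_x}{1-\varepsilon\partial_x^2}$ with symbol $\frac{ik}{1+\varepsilon k^2}$, $\mathcal{L}_{\varepsilon,\lambda}=\frac{P(\partial_x)}{1-\varepsilon\partial_x^2}$ with symbol $\frac{P(ik)}{1+\varepsilon k^2}$, and $e^{t\mathcal{L}_{\varepsilon,\lambda}}$ with symbol $e^{tP(ik)/(1+\varepsilon k^2)}$, $k\in\mathbb{Z}$. The equation is the (generalised) Benjamin--Bona--Mahony equation; its exact solution satisfies $u(t_n+\tau)=e^{-\tau\mathcal{L}_{\varepsilon,\lambda}}u(t_n)-\varepsilon\mathcal{L}_\varepsilon\int_0^\tau e^{-(\tau-s)\mathcal{L}_{\varepsilon,\lambda}}u^2(t_n+s)\,ds$. Weights: $c_1=\frac{7}{24}$, $c_2=\frac34$, $c_3=-\frac1{24}$, $d_1=\frac23$, $d_2=-\frac23$, $d_3=1$. Flows, for $t\in\mathbb{R}$: $\Psi_2^t(v)=e^{-t\mathcal{L}_{\varepsilon,\lambda}}v$ (exact flow of the linear subproblem $\partial_t v=-\mathcal{L}_{\varepsilon,\lambda}v$), and the numerical flow for the nonlinear subproblem $\partial_t w=-\varepsilon\mathcal{L}_\varepsilon w^2$ is defined as $$\tilde\Psi_1^t(w)=w-t\varepsilon\mathcal{L}_\varepsilon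 w+t^2\varepsilon^2\mathcal{L}_\varepsilon\big(w\,\mathcal{L}_\varepsilon(w^2)\big)-\tfrac{t^3}{6}\varepsilon^3\mathcal{L}_\varepsilon\big((\mathcal{L}_\varepsilon(w^2))^2\big)-\tfrac23t^3\varepsilon^3\mathcal{L}_\varepsilon\Big(w\,\mathcal{L}_\varepsilon\big(w\,\mathcal{L}_\varepsilon(w^2)\big)\Big).$$
   Formalization: Two misprints in the numerical flow for the nonlinear subproblem are corrected: its linear term is tεL_ε(w²) instead of tεL_ε w, and the coefficient of t³ε³L_ε((L_ε(w²))²) is 1/3 instead of 1/6; with the displayed formula the splitting is not of third order. *)

theory Defs
  imports "HOL-Analysis.Analysis" "HOL-Computational_Algebra.Polynomial"
begin

text \<open>Functions on the torus are \<open>2 * pi\<close>-periodic functions \<open>real \<Rightarrow> complex\<close>.\<close>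

definition fourier_coeff :: "(real \<Rightarrow> complex) \<Rightarrow> int \<Rightarrow> complex" where
  "fourier_coeff f k =
     (LINT x:{-pi..pi}|lborel. f x * cis (- (of_int k * x))) / of_real (2 * pi)"

text \<open>\<open>sobolev s\<close> is the space \<open>H\<^sup>s\<close> of the torus for \<open>s \<ge> 0\<close>, realised inside the (Borel
  representatives of) square-integrable periodic functions. The value of \<open>sobolev_norm s f\<close> is
  meaningful only for \<open>f \<in> sobolev s\<close>, since \<open>infsum\<close> is \<open>0\<close> on families that are not summable.\<close>

definition sobolev :: "real \<Rightarrow> (real \<Rightarrow> complex) set" where
  "sobolev s = {f. f \<in> borel_measurable borel \<and> (\<forall>x. f (x + 2 * pi) = f x) \<and>
     set_integrable lborel {-pi..pi} (\<lambda>x. (norm (f x))\<^sup>2) \<and>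
     (\<lambda>k::int. (1 + \<bar>of_int k\<bar>) powr (2 * s) * (norm (fourier_coeff f k))\<^sup>2) summable_on UNIV}"

definition sobolev_norm :: "real \<Rightarrow> (real \<Rightarrow> complex) \<Rightarrow> real" where
  "sobolev_norm s f =
     sqrt (\<Sum>\<^sub>\<infinity>k::int. (1 + \<bar>of_int k\<bar>) powr (2 * s) * (norm (fourier_coeff f k))\<^sup>2)"

definition continuous_into_sobolev ::
  "real \<Rightarrow> real \<Rightarrow> (real \<Rightarrow> real \<Rightarrow> complex) \<Rightarrow> bool" where
  "continuous_into_sobolev T s u \<longleftrightarrow>
     (\<forall>t\<in>{0..T}. u t \<in> sobolev s \<and>
        ((\<lambda>t'. sobolev_norm s (\<lambda>x. u t' x - u t x)) \<longlongrightarrow> 0) (at t within {0..T}))"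

text \<open>A multiplier is applied through its Fourier series, evaluated pointwise; this is the usual
  operator whenever that series converges absolutely, in particular whenever the result lies in
  \<open>H\<^sup>s\<close> for some \<open>s > 1/2\<close>.\<close>

definition fourier_mult :: "(int \<Rightarrow> complex) \<Rightarrow> (real \<Rightarrow> complex) \<Rightarrow> real \<Rightarrow> complex" where
  "fourier_mult m f x = (\<Sum>\<^sub>\<infinity>k. m k * fourier_coeff f k * cis (of_int k * x))"

definition L_eps :: "real \<Rightarrow> (real \<Rightarrow> complex) \<Rightarrow> real \<Rightarrow> complex" where
  "L_eps \<epsilon> = fourier_mult (\<lambda>k. \<i> * of_int k / (1 + of_real \<epsilon> * (of_int k)\<^sup>2))"

definition L_symbol :: "complex poly \<Rightarrow> real \<Rightarrow> int \<Rightarrow> complex" where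
  "L_symbol P \<epsilon> k = poly P (\<i> * of_int k) / (1 + of_real \<epsilon> * (of_int k)\<^sup>2)"

definition L_eps_lam :: "complex poly \<Rightarrow> real \<Rightarrow> (real \<Rightarrow> complex) \<Rightarrow> real \<Rightarrow> complex" where
  "L_eps_lam P \<epsilon> = fourier_mult (L_symbol P \<epsilon>)"

definition exp_L :: "complex poly \<Rightarrow> real \<Rightarrow> real \<Rightarrow> (real \<Rightarrow> complex) \<Rightarrow> real \<Rightarrow> complex" where
  "exp_L P \<epsilon> t = fourier_mult (\<lambda>k. exp (of_real t * L_symbol P \<epsilon> k))"

definition bbm_solution ::
  "complex poly \<Rightarrow> real \<Rightarrow> real \<Rightarrow> (real \<Rightarrow> real \<Rightarrow> complex) \<Rightarrow> bool" where
  "bbm_solution P \<epsilon> T u \<longleftrightarrow>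
     (\<forall>t\<in>{0..T}. \<forall>x. ((\<lambda>s. u s x) has_vector_derivative
        - L_eps_lam P \<epsilon> (u t) x - of_real \<epsilon> * L_eps \<epsilon> (\<lambda>y. (u t y)\<^sup>2) x) (at t within {0..T}))"

definition flow2 :: "complex poly \<Rightarrow> real \<Rightarrow> real \<Rightarrow> (real \<Rightarrow> complex) \<Rightarrow> real \<Rightarrow> complex" where
  "flow2 P \<epsilon> t = exp_L P \<epsilon> (- t)"

text \<open>The third-order Taylor polynomial in \<open>t\<close> of the flow of \<open>w' = - A (w\<^sup>2)\<close>, \<open>A = \<epsilon> L_eps \<epsilon>\<close>:
  \<open>w'' = 2 A (w A (w\<^sup>2))\<close> and \<open>w''' = - 2 A ((A (w\<^sup>2))\<^sup>2) - 4 A (w A (w A (w\<^sup>2)))\<close>.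
  The scheme is sometimes displayed with \<open>w\<close> for \<open>w\<^sup>2\<close> in the linear term and \<open>1/6\<close> for \<open>1/3\<close> in
  the first cubic term; these are misprints, with which the splitting is not of third order.\<close>

definition num_flow1 :: "real \<Rightarrow> real \<Rightarrow> (real \<Rightarrow> complex) \<Rightarrow> real \<Rightarrow> complex" where
  "num_flow1 \<epsilon> t w x =
     (let L = L_eps \<epsilon>; Lw2 = L (\<lambda>y. (w y)\<^sup>2) in
        w x
        - of_real (t * \<epsilon>) * Lw2 x
        + of_real (t^2 * \<epsilon>^2) * L (\<lambda>y. w y * Lw2 y) x
        - of_real (t^3 / 3 * \<epsilon>^3) * L (\<lambda>y. (Lw2 y)\<^sup>2) x
        - of_real (2 / 3 * t^3 * \<epsilon>^3) * L (\<lambda>y. w y * L (\<lambda>z. w z * Lw2 z) y) x)"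

definition splitting_step ::
  "complex poly \<Rightarrow> real \<Rightarrow> real \<Rightarrow> (real \<Rightarrow> complex) \<Rightarrow> real \<Rightarrow> complex" where
  "splitting_step P \<epsilon> \<tau> =
     flow2 P \<epsilon> \<tau> \<circ> num_flow1 \<epsilon> (- 1 / 24 * \<tau>) \<circ>
     flow2 P \<epsilon> (- 2 / 3 * \<tau>) \<circ> num_flow1 \<epsilon> (3 / 4 * \<tau>) \<circ>
     flow2 P \<epsilon> (2 / 3 * \<tau>) \<circ> num_flow1 \<epsilon> (7 / 24 * \<tau>)"

end

theory Submission
  imports Defs
begin

text \<open>
  In the twisted Fourier coefficients \<open>v(t) = exp (t L) u(t\<^sub>n + t)\<close> the equation becomes
  \<open>v' = - B\<^sub>t(v, v)\<close>, where \<open>B\<^sub>t\<close> is bilinear with kernel \<open>m\<^sub>k exp (t \<theta>)\<close>, \<open>\<theta>\<close> being the imaginary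
  resonance phase of the linear symbol and \<open>m\<^sub>k\<close> the symbol of \<open>\<epsilon> L\<^sub>\<epsilon>\<close>, and one splitting step becomes
  a composition of three Taylor flows of \<open>B\<close> frozen at times \<open>0\<close>, \<open>2\<tau>/3\<close>, \<open>0\<close>. Because \<open>\<bar>m\<^sub>k\<bar> \<le> 1/\<bar>k\<bar>\<close>, the
  Cauchy-Schwarz inequality makes \<open>B\<^sub>t\<close> bounded on every \<open>H\<^sup>\<rho>\<close> with \<open>\<rho> \<ge> 0\<close>, uniformly in \<open>\<epsilon>\<close>; this gives
  stability in \<open>H\<^sup>r\<close> without any algebra property. Because \<open>\<bar>m\<^sub>k\<bar> \<le> \<epsilon>\<^sup>1\<^sup>-\<^sup>\<sigma> \<bar>k\<bar>\<^sup>1\<^sup>-\<^sup>2\<^sup>\<sigma>\<close>, the outermost \<open>B\<close> of each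
  error term supplies the factor \<open>\<epsilon>\<^sup>1\<^sup>-\<^sup>\<sigma>\<close>. Every time derivative of \<open>B\<^sub>t\<close> costs a factor
  \<open>\<theta> = O(\<bar>k\<bar>\<^sup>\<lambda>)\<close>, and in the local error of order \<open>\<tau>\<^sup>4\<close> at most three of them occur, whence the
  loss of \<open>1 + 3\<lambda> - 2\<sigma>\<close> derivatives. The terms of order at most \<open>\<tau>\<^sup>3\<close> cancel by the
  order conditions satisfied by the weights.
\<close>

section \<open>Weighted square-summable sequences\<close>

text \<open>Conjugation by the unitary linear group turns the weights d into frozen times: their
  partial sums before the three nonlinear stages are 0, 2/3, 0, and the negative weight is harmless
  because the group runs isometrically both ways. The weights c put mass 1/4 at time 0 and 3/4 at
  time 2/3, which is the two-point Radau rule, exact for quadratic integrands; this settles the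
  terms with a single bilinear form. Products of two forms need c_2 (2 c_1 + c_2) = 1 and c_2 (c_2 +
  2 c_3) = 1/2, triple products only c_1 + c_2 + c_3 = 1. The obstacle is that a time derivative of
  the form is unbounded, so a term may be expanded in time only as far as its order in the step size
  demands. Hence the stages are expanded multilinearly with their times kept frozen, which loses no
  derivatives, and phases are expanded afterwards. Uniformity in \<epsilon> and in the trajectory is
  carried by Landau-type bounds over index sets that contain both.\<close>

no_notation Infinite_Set_Sum.abs_summable_on (infix "abs'_summable'_on" 50)

definition weight :: "int \<Rightarrow> real" where "weight k = 1 + \<bar>of_int k\<bar>"

lemma weight_ge1 [simp]: "1 \<le> weight k" and weight_pos [simp]: "0 < weight k" and weight_nonneg [simp]: "0 \<le> weight k"
  and weight_neq0 [simp]: "weight k \<noteq> 0" and weight_minus [simp]: "weight (- k) = weight k"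
  by (auto simp: weight_def)

lemma weight_le_mult: "weight (j + l) \<le> weight j * weight l"
proof -
  have "(0::real) \<le> \<bar>of_int j\<bar> * \<bar>of_int l\<bar>" by simp
  moreover have "\<bar>of_int (j + l)\<bar> \<le> \<bar>of_int j\<bar> + (\<bar>of_int l\<bar> :: real)" by simp
  ultimately show ?thesis unfolding weight_def distrib_left distrib_right mult_1_left mult_1_right by linarith
qed

lemma weight_split: "weight k \<le> weight j * weight (k - j)" and weight_split': "weight j \<le> weight k * weight (k - j)"
proof -
  show "weight k \<le> weight j * weight (k - j)" using weight_le_mult[of j "k - j"] by simp
  have "weight (j - k) = weight (k - j)" by (simp add: weight_def abs_minus_commute)
  then show "weight j \<le> weight k * weight (k - j)" using weight_le_mult[of k "j - k"] by simp
qed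

lemma weight_triangle: "weight k \<le> weight j + weight (k - j)"
  by (simp add: weight_def)

text \<open>Bounding all finite partial sums avoids a summability side condition, lets M be any
  upper bound instead of the norm itself, and makes the inequalities for \<open>L2_set\<close>
  directly applicable.\<close>

definition wl2_le :: "real \<Rightarrow> real \<Rightarrow> (int \<Rightarrow> complex) \<Rightarrow> bool" where
  "wl2_le s M a \<longleftrightarrow> (\<forall>F. finite F \<longrightarrow> L2_set (\<lambda>k. weight k powr s * norm (a k)) F \<le> M)"

lemma wl2_leI: "(\<And>F. finite F \<Longrightarrow> L2_set (\<lambda>k. weight k powr s * norm (a k)) F \<le> M) \<Longrightarrow> wl2_le s M a"
  by (simp add: wl2_le_def)

lemma wl2_leD: "wl2_le s M a \<Longrightarrow> finite F \<Longrightarrow> L2_set (\<lambda>k. weight k powr s * norm (a k)) F \<le> M"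
  by (simp add: wl2_le_def)

lemma wl2_le_nonneg: "wl2_le s M a \<Longrightarrow> 0 \<le> M"
  using wl2_leD[of s M a "{}"] by simp

lemma wl2_le_mono:
  assumes "wl2_le s M a" "s' \<le> s" "M \<le> M'" shows "wl2_le s' M' a"
proof (rule wl2_leI)
  fix F :: "int set" assume F: "finite F"
  have "L2_set (\<lambda>k. weight k powr s' * norm (a k)) F \<le> L2_set (\<lambda>k. weight k powr s * norm (a k)) F"
    using assms(2) by (intro L2_set_mono mult_right_mono powr_mono) auto
  with wl2_leD[OF assms(1) F] assms(3) show "L2_set (\<lambda>k. weight k powr s' * norm (a k)) F \<le> M'" by simp
qed

lemma wl2_le_dominated:
  assumes "wl2_le s M a" "\<And>k. norm (b k) \<le> norm (a k)" shows "wl2_le s M b"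
proof (rule wl2_leI)
  fix F :: "int set" assume F: "finite F"
  have "L2_set (\<lambda>k. weight k powr s * norm (b k)) F \<le> L2_set (\<lambda>k. weight k powr s * norm (a k)) F"
    using assms(2) by (intro L2_set_mono mult_left_mono) auto
  with wl2_leD[OF assms(1) F] show "L2_set (\<lambda>k. weight k powr s * norm (b k)) F \<le> M" by simp
qed

lemma wl2_le_zero: "0 \<le> M \<Longrightarrow> wl2_le s M (\<lambda>k. 0)"
  by (rule wl2_leI) (simp add: L2_set_def)

lemma wl2_le_add:
  assumes "wl2_le s M a" "wl2_le s N b" shows "wl2_le s (M + N) (\<lambda>k. a k + b k)"
proof (rule wl2_leI)
  fix F :: "int set" assume F: "finite F"
  have "L2_set (\<lambda>k. weight k powr s * norm (a k + b k)) F
      \<le> L2_set (\<lambda>k. weight k powr s * norm (a k) + weight k powr s * norm (b k)) F"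
    by (intro L2_set_mono) (auto simp: norm_triangle_ineq simp flip: distrib_left)
  also have "\<dots> \<le> L2_set (\<lambda>k. weight k powr s * norm (a k)) F + L2_set (\<lambda>k. weight k powr s * norm (b k)) F"
    by (rule L2_set_triangle_ineq)
  also have "\<dots> \<le> M + N" using wl2_leD[OF assms(1) F] wl2_leD[OF assms(2) F] by simp
  finally show "L2_set (\<lambda>k. weight k powr s * norm (a k + b k)) F \<le> M + N" .
qed

lemma wl2_le_scale:
  assumes "wl2_le s M a" shows "wl2_le s (norm c * M) (\<lambda>k. c * a k)"
proof (rule wl2_leI)
  fix F :: "int set" assume F: "finite F"
  have "L2_set (\<lambda>k. weight k powr s * norm (c * a k)) F = norm c * L2_set (\<lambda>k. weight k powr s * norm (a k)) F"
    by (subst L2_set_right_distrib) (auto simp: norm_mult mult_ac)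
  with wl2_leD[OF assms F] show "L2_set (\<lambda>k. weight k powr s * norm (c * a k)) F \<le> norm c * M"
    by (simp add: mult_left_mono)
qed

lemma sum_inverse_squares_le: "finite F \<Longrightarrow> (\<Sum>k\<in>F. (weight k powr -1)\<^sup>2) \<le> 4"
proof -
  assume F: "finite F"
  \<comment> \<open>The bound telescopes: the two new summands are at most
    \<open>2 / (N + 1) - 2 / (N + 2)\<close>, and at N = 0 there is equality.\<close>
  have *: "(\<Sum>k\<in>{- int N..int N}. (weight k powr -1)\<^sup>2) \<le> 3 - 2 / (real N + 1)" for N
  proof (induction N)
    case 0 show ?case by (simp add: weight_def)
  next
    case (Suc N)
    have "{- int (Suc N)..int (Suc N)} = insert (- int (Suc N)) (insert (int (Suc N)) {- int N..int N})" by auto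
    then have "(\<Sum>k\<in>{- int (Suc N)..int (Suc N)}. (weight k powr -1)\<^sup>2)
        = 2 * (1 / (real N + 2))\<^sup>2 + (\<Sum>k\<in>{- int N..int N}. (weight k powr -1)\<^sup>2)"
      by (simp add: weight_def powr_minus_divide add.commute)
    also have "\<dots> \<le> 2 * (1 / (real N + 2))\<^sup>2 + (3 - 2 / (real N + 1))" using Suc by simp
    also have "\<dots> \<le> 3 - 2 / (real (Suc N) + 1)"
      by (simp add: divide_simps power2_eq_square) (simp add: algebra_simps)
    finally show ?case .
  qed
  obtain N where N: "F \<subseteq> {- int N..int N}"
  proof
    show "F \<subseteq> {- int (nat (Max (insert 0 (abs ` F))))..int (nat (Max (insert 0 (abs ` F))))}"
    proof
      fix x assume "x \<in> F"
      then have "\<bar>x\<bar> \<le> Max (insert 0 (abs ` F))" using F by (intro Max_ge) auto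
      then show "x \<in> {- int (nat (Max (insert 0 (abs ` F))))..int (nat (Max (insert 0 (abs ` F))))}" by auto
    qed
  qed
  have "(\<Sum>k\<in>F. (weight k powr -1)\<^sup>2) \<le> (\<Sum>k\<in>{- int N..int N}. (weight k powr -1)\<^sup>2)"
    using N by (intro sum_mono2) auto
  also have "\<dots> \<le> 4" using *[of N] by (smt (verit) divide_nonneg_nonneg of_nat_0_le_iff)
  finally show ?thesis .
qed

lemma L2_weight_le: "finite F \<Longrightarrow> L2_set (\<lambda>k. weight k powr -1) F \<le> 2"
  unfolding L2_set_def using sum_inverse_squares_le[of F]
  by (metis real_sqrt_four real_sqrt_le_iff)

lemma L2_set_reflect: "L2_set (\<lambda>j. f (k - j)) G = L2_set f ((\<lambda>j. k - j) ` (G :: int set))"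
  unfolding L2_set_def by (subst sum.reindex) (auto simp: inj_on_def)

text \<open>Cauchy-Schwarz against \<open>weight k powr -1\<close>, whose square-sum norm is at most
  2: one full derivative buys absolute summability.\<close>

lemma wl2_le_imp_l1:
  assumes "wl2_le (s + 1) M a" "finite F" shows "(\<Sum>k\<in>F. weight k powr s * norm (a k)) \<le> 2 * M"
proof -
  have "(\<Sum>k\<in>F. weight k powr s * norm (a k)) = (\<Sum>k\<in>F. \<bar>weight k powr -1\<bar> * \<bar>weight k powr (s + 1) * norm (a k)\<bar>)"
    by (intro sum.cong) (auto simp: powr_add powr_minus)
  also have "\<dots> \<le> L2_set (\<lambda>k. weight k powr -1) F * L2_set (\<lambda>k. weight k powr (s + 1) * norm (a k)) F"
    by (rule L2_set_mult_ineq)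
  also have "\<dots> \<le> 2 * M"
    using L2_weight_le[OF assms(2)] wl2_leD[OF assms] by (intro mult_mono) auto
  finally show ?thesis .
qed

lemma wl2_le_abs_summable: "wl2_le 1 M a \<Longrightarrow> a abs_summable_on UNIV"
  using wl2_le_imp_l1[of 0 M a] by (auto intro!: nonneg_bdd_above_summable_on bdd_aboveI2)

section \<open>Bilinear Fourier operators with a general kernel\<close>

definition kernel_sum :: "(int \<Rightarrow> int \<Rightarrow> complex) \<Rightarrow> (int \<Rightarrow> complex) \<Rightarrow> (int \<Rightarrow> complex) \<Rightarrow> int \<Rightarrow> complex" where
  "kernel_sum p a b k = (\<Sum>\<^sub>\<infinity>j. p k j * a j * b (k - j))"

lemma norm_infsum_le_finite_sums:
  fixes f :: "'a \<Rightarrow> complex"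
  assumes "\<And>F. finite F \<Longrightarrow> (\<Sum>x\<in>F. norm (f x)) \<le> C"
  shows "f abs_summable_on UNIV" "norm (infsum f UNIV) \<le> C"
proof -
  show *: "f abs_summable_on UNIV"
    using assms by (auto intro!: nonneg_bdd_above_summable_on bdd_aboveI2)
  have "norm (infsum f UNIV) \<le> (\<Sum>\<^sub>\<infinity>x. norm (f x))" by (rule norm_infsum_bound[OF *])
  also have "\<dots> \<le> C" using * assms by (intro infsum_le_finite_sums) auto
  finally show "norm (infsum f UNIV) \<le> C" .
qed

lemma kernel_sum_wl2_le_inner_sum:
  assumes p: "\<And>j. norm (p k j) \<le> c * (weight j powr \<alpha> * weight (k - j) powr \<beta>)"
    and a: "wl2_le \<alpha> M a" and b: "wl2_le \<beta> N b" and c: "0 \<le> c"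
  shows "(\<lambda>j. p k j * a j * b (k - j)) abs_summable_on UNIV" "norm (kernel_sum p a b k) \<le> c * (M * N)"
proof -
  have "(\<Sum>j\<in>G. norm (p k j * a j * b (k - j))) \<le> c * (M * N)" if G: "finite G" for G
  proof -
    have "(\<Sum>j\<in>G. norm (p k j * a j * b (k - j)))
       \<le> (\<Sum>j\<in>G. c * (\<bar>weight j powr \<alpha> * norm (a j)\<bar> * \<bar>weight (k - j) powr \<beta> * norm (b (k - j))\<bar>))"
    proof (rule sum_mono)
      fix j
      have "norm (p k j * a j * b (k - j)) \<le> (c * (weight j powr \<alpha> * weight (k - j) powr \<beta>)) * (norm (a j) * norm (b (k - j)))"
        using mult_right_mono[OF p[of j], of "norm (a j) * norm (b (k - j))"] by (simp add: norm_mult mult.assoc)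
      then show "norm (p k j * a j * b (k - j)) \<le> c * (\<bar>weight j powr \<alpha> * norm (a j)\<bar> * \<bar>weight (k - j) powr \<beta> * norm (b (k - j))\<bar>)"
        by (simp add: abs_mult mult_ac)
    qed
    also have "\<dots> = c * (\<Sum>j\<in>G. \<bar>weight j powr \<alpha> * norm (a j)\<bar> * \<bar>weight (k - j) powr \<beta> * norm (b (k - j))\<bar>)"
      by (simp add: sum_distrib_left)
    also have "\<dots> \<le> c * (L2_set (\<lambda>j. weight j powr \<alpha> * norm (a j)) G * L2_set (\<lambda>j. weight (k - j) powr \<beta> * norm (b (k - j))) G)"
      by (intro mult_left_mono L2_set_mult_ineq c)
    also have "\<dots> \<le> c * (M * N)"
      using wl2_leD[OF a G] wl2_leD[OF b, of "(\<lambda>j. k - j) ` G"] G c wl2_le_nonneg[OF a]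
      by (intro mult_left_mono mult_mono) (auto simp: L2_set_reflect[of "\<lambda>l. weight l powr \<beta> * norm (b l)"])
    finally show ?thesis .
  qed
  from norm_infsum_le_finite_sums[OF this]
  show "(\<lambda>j. p k j * a j * b (k - j)) abs_summable_on UNIV" "norm (kernel_sum p a b k) \<le> c * (M * N)"
    by (auto simp: kernel_sum_def)
qed

text \<open>At each fixed k, Cauchy-Schwarz in j bounds the inner sum by a constant times
  \<open>weight k powr (-1 - \<rho>)\<close>. Square summability in k then comes from
  \<open>weight k powr -1\<close> alone, and 2 is the bound of its norm.\<close>

lemma kernel_sum_wl2_le:
  assumes p: "\<And>k j. norm (p k j) * weight k powr \<rho> \<le> c * (weight k powr -1 * (weight j powr \<alpha> * weight (k - j) powr \<beta>))"
    and a: "wl2_le \<alpha> M a" and b: "wl2_le \<beta> N b" and c: "0 \<le> c"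
  shows "(\<lambda>j. p k j * a j * b (k - j)) abs_summable_on UNIV" "wl2_le \<rho> (2 * c * (M * N)) (kernel_sum p a b)"
proof -
  have p': "norm (p k j) \<le> (c * weight k powr -1 * weight k powr - \<rho>) * (weight j powr \<alpha> * weight (k - j) powr \<beta>)" for k j
    using p[of k j] by (simp add: powr_minus field_simps)
  show "(\<lambda>j. p k j * a j * b (k - j)) abs_summable_on UNIV"
    by (rule kernel_sum_wl2_le_inner_sum(1)[OF p' a b]) (use c in simp)
  have kb: "norm (kernel_sum p a b k) \<le> c * weight k powr -1 * weight k powr - \<rho> * (M * N)" for k
    by (rule kernel_sum_wl2_le_inner_sum(2)[OF p' a b]) (use c in simp)
  have *: "weight k powr \<rho> * norm (kernel_sum p a b k) \<le> c * (M * N) * weight k powr -1" for k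
    using mult_left_mono[OF kb[of k], of "weight k powr \<rho>"] by (simp add: powr_minus field_simps)
  have MN: "0 \<le> M * N" using wl2_le_nonneg[OF a] wl2_le_nonneg[OF b] by simp
  show "wl2_le \<rho> (2 * c * (M * N)) (kernel_sum p a b)"
  proof (rule wl2_leI)
    fix F :: "int set" assume F: "finite F"
    have "L2_set (\<lambda>k. weight k powr \<rho> * norm (kernel_sum p a b k)) F \<le> L2_set (\<lambda>k. c * (M * N) * weight k powr -1) F"
      using * by (intro L2_set_mono) auto
    also have "\<dots> = c * (M * N) * L2_set (\<lambda>k. weight k powr -1) F"
      by (subst L2_set_right_distrib) (use c MN in auto)
    also have "\<dots> \<le> c * (M * N) * 2" using L2_weight_le[OF F] c MN by (intro mult_left_mono) auto
    finally show "L2_set (\<lambda>k. weight k powr \<rho> * norm (kernel_sum p a b k)) F \<le> 2 * c * (M * N)" by (simp add: mult_ac)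
  qed
qed

lemma infsum_finite_sum:
  fixes f :: "'a \<Rightarrow> 'b \<Rightarrow> real"
  assumes "finite F" "\<And>k. k \<in> F \<Longrightarrow> f k summable_on A"
  shows "(\<lambda>j. \<Sum>k\<in>F. f k j) summable_on A" "(\<Sum>\<^sub>\<infinity>j\<in>A. \<Sum>k\<in>F. f k j) = (\<Sum>k\<in>F. infsum (f k) A)"
  using assms
proof (induction F rule: finite_induct)
  case (insert x F)
  { case 1 then show ?case using insert by (auto intro!: summable_on_add) }
  { case 2 then show ?case using insert by (auto simp: infsum_add) }
qed auto

text \<open>A weighted Young inequality. The kernel offers no decay in k here, so the extra
  derivative of \<open>b\<close> pays instead: Cauchy-Schwarz in j against
  \<open>weight (k - j) powr -1\<close> leaves the square root of a convolution of squares.\<close>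

lemma kernel_sum_wl2_le_l1:
  assumes p: "\<And>k j. norm (p k j) * weight k powr \<rho> \<le> c * (weight j powr \<alpha> * weight (k - j) powr \<beta>)"
    and a: "wl2_le \<alpha> M a" and b: "wl2_le (\<beta> + 1) N b" and c: "0 \<le> c"
  shows "(\<lambda>j. p k j * a j * b (k - j)) abs_summable_on UNIV" "wl2_le \<rho> (2 * c * (M * N)) (kernel_sum p a b)"
proof -
  define f where "f j = (weight j powr \<alpha> * norm (a j))\<^sup>2" for j
  define g where "g l = (weight l powr (\<beta> + 1) * norm (b l))\<^sup>2" for l
  have fpos: "0 \<le> f j" and gpos: "0 \<le> g j" for j by (auto simp: f_def g_def)
  have M0: "0 \<le> M" "0 \<le> N" using wl2_le_nonneg[OF a] wl2_le_nonneg[OF b] by auto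
  have fsum: "sum f G \<le> M\<^sup>2" if "finite G" for G
    using wl2_leD[OF a that] M0 unfolding L2_set_def f_def by (metis real_sqrt_le_iff real_sqrt_unique)
  have gsum: "sum g G \<le> N\<^sup>2" if "finite G" for G
    using wl2_leD[OF b that] M0 unfolding L2_set_def g_def by (metis real_sqrt_le_iff real_sqrt_unique)
  have fg: "(\<lambda>j. f j * g (k - j)) summable_on UNIV" for k
  proof (rule nonneg_bdd_above_summable_on)
    show "bdd_above (sum (\<lambda>j. f j * g (k - j)) ` {F. F \<subseteq> UNIV \<and> finite F})"
    proof (rule bdd_aboveI2)
      fix G :: "int set" assume "G \<in> {F. F \<subseteq> UNIV \<and> finite F}"
      then have G: "finite G" by simp
      have "(\<Sum>j\<in>G. f j * g (k - j)) \<le> (\<Sum>j\<in>G. f j * N\<^sup>2)"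
        using gsum[of "{k - j}" for j] fpos by (intro sum_mono mult_left_mono) auto
      also have "\<dots> \<le> M\<^sup>2 * N\<^sup>2" using fsum[OF G] by (simp add: mult_right_mono flip: sum_distrib_right)
      finally show "(\<Sum>j\<in>G. f j * g (k - j)) \<le> M\<^sup>2 * N\<^sup>2" .
    qed
  qed (simp add: fpos gpos)
  define S where "S k = (\<Sum>\<^sub>\<infinity>j. f j * g (k - j))" for k
  have S0: "0 \<le> S k" for k unfolding S_def by (intro infsum_nonneg) (simp add: fpos gpos)
  have bound: "(\<Sum>j\<in>G. norm (p k j * a j * b (k - j))) \<le> 2 * c * weight k powr - \<rho> * sqrt (S k)" if G: "finite G" for G k
  proof -
    have "(\<Sum>j\<in>G. norm (p k j * a j * b (k - j)))
      \<le> (\<Sum>j\<in>G. c * weight k powr - \<rho> * (\<bar>weight (k - j) powr -1\<bar> * \<bar>(weight j powr \<alpha> * norm (a j)) * (weight (k - j) powr (\<beta> + 1) * norm (b (k - j)))\<bar>))"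
    proof (rule sum_mono)
      fix j
      have "norm (p k j) \<le> (c * weight k powr - \<rho>) * (weight j powr \<alpha> * weight (k - j) powr \<beta>)"
        using p[of k j] by (simp add: powr_minus field_simps)
      from mult_right_mono[OF this, of "norm (a j) * norm (b (k - j))"]
      have "norm (p k j * a j * b (k - j)) \<le> (c * weight k powr - \<rho>) * (weight j powr \<alpha> * weight (k - j) powr \<beta>) * (norm (a j) * norm (b (k - j)))"
        by (simp add: norm_mult mult_ac)
      also have "weight (k - j) powr \<beta> = weight (k - j) powr (-1 + (\<beta> + 1))" by simp
      also have "weight (k - j) powr (-1 + (\<beta> + 1)) = weight (k - j) powr -1 * weight (k - j) powr (\<beta> + 1)"
        by (rule powr_add)
      finally show "norm (p k j * a j * b (k - j)) \<le> c * weight k powr - \<rho> * (\<bar>weight (k - j) powr -1\<bar> * \<bar>(weight j powr \<alpha> * norm (a j)) * (weight (k - j) powr (\<beta> + 1) * norm (b (k - j)))\<bar>)"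
        by (simp add: abs_mult mult_ac)
    qed
    also have "\<dots> = c * weight k powr - \<rho> * (\<Sum>j\<in>G. \<bar>weight (k - j) powr -1\<bar> * \<bar>(weight j powr \<alpha> * norm (a j)) * (weight (k - j) powr (\<beta> + 1) * norm (b (k - j)))\<bar>)"
      by (simp only: sum_distrib_left)
    also have "\<dots> \<le> c * weight k powr - \<rho> * (L2_set (\<lambda>j. weight (k - j) powr -1) G * L2_set (\<lambda>j. (weight j powr \<alpha> * norm (a j)) * (weight (k - j) powr (\<beta> + 1) * norm (b (k - j)))) G)"
      using c by (intro mult_left_mono L2_set_mult_ineq) auto
    also have "\<dots> \<le> c * weight k powr - \<rho> * (2 * sqrt (S k))"
    proof (intro mult_left_mono mult_mono)
      show "L2_set (\<lambda>j. weight (k - j) powr -1) G \<le> 2"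
        using L2_weight_le[of "(\<lambda>j. k - j) ` G"] G by (simp only: L2_set_reflect[of "\<lambda>l. weight l powr -1"] finite_imageI)
      have "(\<Sum>j\<in>G. f j * g (k - j)) \<le> S k"
        unfolding S_def using fg G fpos gpos by (intro finite_sum_le_infsum) auto
      then show "L2_set (\<lambda>j. (weight j powr \<alpha> * norm (a j)) * (weight (k - j) powr (\<beta> + 1) * norm (b (k - j)))) G \<le> sqrt (S k)"
        unfolding L2_set_def by (simp add: f_def g_def power_mult_distrib)
    qed (use c in auto)
    finally show ?thesis by (simp add: mult_ac)
  qed
  show "(\<lambda>j. p k j * a j * b (k - j)) abs_summable_on UNIV"
    by (rule norm_infsum_le_finite_sums(1)[OF bound])
  have kb: "norm (kernel_sum p a b k) \<le> 2 * c * weight k powr - \<rho> * sqrt (S k)" for k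
    unfolding kernel_sum_def by (rule norm_infsum_le_finite_sums(2)[OF bound])
  have *: "weight k powr \<rho> * norm (kernel_sum p a b k) \<le> 2 * c * sqrt (S k)" for k
    using mult_left_mono[OF kb[of k], of "weight k powr \<rho>"] by (simp add: powr_minus field_simps)
  show "wl2_le \<rho> (2 * c * (M * N)) (kernel_sum p a b)"
  proof (rule wl2_leI)
    fix F :: "int set" assume F: "finite F"
    have "L2_set (\<lambda>k. weight k powr \<rho> * norm (kernel_sum p a b k)) F \<le> L2_set (\<lambda>k. 2 * c * sqrt (S k)) F"
      using * by (intro L2_set_mono) auto
    also have "\<dots> = 2 * c * L2_set (\<lambda>k. sqrt (S k)) F"
      by (subst L2_set_right_distrib) (use c in auto)
    also have "L2_set (\<lambda>k. sqrt (S k)) F = sqrt (\<Sum>k\<in>F. S k)"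
      unfolding L2_set_def using S0 by simp
    \<comment> \<open>Exchanging the sums, the sum over k of the shifted \<open>g\<close> is at most
      \<open>N\<^sup>2\<close> for every j, so no decay in k is required.\<close>
    also have "(\<Sum>k\<in>F. S k) = (\<Sum>\<^sub>\<infinity>j. \<Sum>k\<in>F. f j * g (k - j))"
      unfolding S_def using F fg by (intro infsum_finite_sum(2)[symmetric]) auto
    also have "\<dots> \<le> M\<^sup>2 * N\<^sup>2"
    proof (rule infsum_le_finite_sums)
      show "(\<lambda>j. \<Sum>k\<in>F. f j * g (k - j)) summable_on UNIV" using F fg by (intro infsum_finite_sum(1)) auto
      fix G :: "int set" assume G: "finite G"
      have "(\<Sum>j\<in>G. \<Sum>k\<in>F. f j * g (k - j)) = (\<Sum>j\<in>G. f j * (\<Sum>l\<in>(\<lambda>k. k - j) ` F. g l))"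
        by (simp add: sum_distrib_left sum.reindex inj_on_def)
      also have "\<dots> \<le> (\<Sum>j\<in>G. f j * N\<^sup>2)"
        using F fpos gsum by (intro sum_mono mult_left_mono) auto
      also have "\<dots> \<le> M\<^sup>2 * N\<^sup>2" using fsum[OF G] by (simp add: mult_right_mono flip: sum_distrib_right)
      finally show "(\<Sum>j\<in>G. \<Sum>k\<in>F. f j * g (k - j)) \<le> M\<^sup>2 * N\<^sup>2" .
    qed
    finally have "L2_set (\<lambda>k. weight k powr \<rho> * norm (kernel_sum p a b k)) F \<le> 2 * c * sqrt (M\<^sup>2 * N\<^sup>2)"
      using c by (simp add: mult_left_mono)
    then show "L2_set (\<lambda>k. weight k powr \<rho> * norm (kernel_sum p a b k)) F \<le> 2 * c * (M * N)"
      using M0 by (simp add: real_sqrt_mult)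
  qed
qed

lemma kernel_sum_flip: "kernel_sum p a b = kernel_sum (\<lambda>k j. p k (k - j)) b a"
proof
  fix k
  have "kernel_sum p a b k = (\<Sum>\<^sub>\<infinity>j. p k (k - j) * a (k - j) * b (k - (k - j)))"
    unfolding kernel_sum_def
    by (rule infsum_reindex_bij_witness[of _ "\<lambda>j. k - j" "\<lambda>j. k - j"]) auto
  then show "kernel_sum p a b k = kernel_sum (\<lambda>k j. p k (k - j)) b a k"
    by (simp add: kernel_sum_def mult_ac)
qed

lemma kernel_sum_flip_summable:
  fixes a b :: "int \<Rightarrow> complex"
  shows
  "(\<lambda>j. p k (k - j) * b j * a (k - j)) abs_summable_on UNIV \<longleftrightarrow> (\<lambda>j. p k j * a j * b (k - j)) abs_summable_on (UNIV :: int set)"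
  by (subst summable_on_reindex_bij_witness[of UNIV "\<lambda>j. k - j" "\<lambda>j. k - j" UNIV]) (auto simp: norm_mult mult_ac mult.commute)

lemma weight_max_pow:
  fixes a :: real assumes "0 \<le> a"
  shows "weight k powr a \<le> 2 powr a * (max (weight j) (weight (k - j))) powr a"
proof -
  have "weight k \<le> 2 * max (weight j) (weight (k - j))" using weight_triangle[of k j] by linarith
  then have "weight k powr a \<le> (2 * max (weight j) (weight (k - j))) powr a" using assms by (intro powr_mono2) auto
  then show ?thesis by (simp add: powr_mult)
qed

section \<open>Fourier series on the torus\<close>

text \<open>A finite measure space of its own, so that dominated convergence and integrability of
  bounded functions apply without carrying indicator functions.\<close>

definition torus :: "real measure" where "torus = restrict_space lborel {-pi..pi}"

lemma space_torus [simp]: "space torus = {-pi..pi}" by (simp add: torus_def space_restrict_space)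

lemma finite_measure_torus: "finite_measure torus"
  unfolding torus_def by (intro finite_measureI) (simp add: emeasure_restrict_space space_restrict_space)

lemma measurable_torus [measurable (raw)]: "f \<in> borel_measurable borel \<Longrightarrow> f \<in> borel_measurable torus"
  unfolding torus_def by (intro measurable_restrict_space1) simp

lemma AE_torus: "(AE x in torus. Q x) \<longleftrightarrow> (AE x in lborel. x \<in> {-pi..pi} \<longrightarrow> Q x)"
  unfolding torus_def by (rule AE_restrict_space_iff) simp

lemma set_integrable_torus:
  fixes f :: "real \<Rightarrow> 'a::{banach, second_countable_topology}"
  shows "set_integrable lborel {-pi..pi} f \<longleftrightarrow> integrable torus f"
  unfolding torus_def set_integrable_def by (subst integrable_restrict_space) auto

lemma fourier_coeff_torus:
  "fourier_coeff f k = (\<integral>x. f x * cis (- (of_int k * x)) \<partial>torus) / of_real (2 * pi)"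
  unfolding fourier_coeff_def set_lebesgue_integral_def torus_def by (subst integral_restrict_space) auto

lemma cis_measurable [measurable]: "(\<lambda>x. cis (c * x)) \<in> borel_measurable borel"
  by (intro borel_measurable_continuous_onI continuous_intros)

lemma integrable_torus_bounded:
  fixes f :: "real \<Rightarrow> complex"
  assumes "f \<in> borel_measurable torus" "\<And>x. norm (f x) \<le> C" shows "integrable torus f"
proof -
  interpret finite_measure torus by (rule finite_measure_torus)
  show ?thesis by (rule integrable_const_bound[of _ C]) (use assms in auto)
qed

lemma integrable_torus_mult:
  fixes f g :: "real \<Rightarrow> complex"
  assumes "integrable torus f" "g \<in> borel_measurable torus" "\<And>x. norm (g x) \<le> C"
  shows "integrable torus (\<lambda>x. f x * g x)"
proof (rule Bochner_Integration.integrable_bound)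
  show "integrable torus (\<lambda>x. of_real C * f x)" using assms(1) by simp
  have [measurable]: "f \<in> borel_measurable torus" using assms(1) by auto
  show "(\<lambda>x. f x * g x) \<in> borel_measurable torus" using assms(2) by measurable
  have "norm (f x * g x) \<le> norm (of_real C * f x)" for x
  proof -
    have "norm (f x) * norm (g x) \<le> norm (f x) * C" using assms(3) by (intro mult_left_mono) auto
    moreover have "0 \<le> C" using assms(3)[of 0] norm_ge_zero order_trans by blast
    ultimately show ?thesis by (simp add: norm_mult mult.commute)
  qed
  then show "AE x in torus. norm (f x * g x) \<le> norm (of_real C * f x)" by simp
qed

lemma integrable_torus_cis: "integrable torus f \<Longrightarrow> integrable torus (\<lambda>x. f x * cis (c * x))"
  by (rule integrable_torus_mult[where C = 1]) auto

lemma integrable_torus_cis': "integrable torus f \<Longrightarrow> integrable torus (\<lambda>x. f x * cis (- (c * x)))"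
  using integrable_torus_cis[of f "- c"] by simp

lemma integral_cis: "(\<integral>x. cis (of_int m * x) \<partial>torus) = (if m = 0 then of_real (2 * pi) else 0)"
proof -
  have "(\<integral>x. cis (of_int m * x) \<partial>torus) = (\<integral>x. indicator {-pi..pi} x *\<^sub>R cis (of_int m * x) \<partial>lborel)"
    unfolding torus_def by (subst integral_restrict_space) auto
  also have "\<dots> = (if m = 0 then of_real (2 * pi) else 0)"
  proof (cases "m = 0")
    case True
    have "(\<integral>x. indicator {-pi..pi} x *\<^sub>R (1 :: complex) \<partial>lborel) = of_real pi - of_real (- pi)"
      by (rule integral_FTC_Icc[where F = of_real]) (auto intro!: derivative_eq_intros simp: has_vector_derivative_of_real)
    then show ?thesis using True by simp
  next
    case False
    have "((\<lambda>x. cis (of_int m * x) / (\<i> * of_int m)) has_vector_derivative cis (of_int m * x)) (at x within {-pi..pi})" for x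
    proof -
      have 1: "((\<lambda>x. of_int m * x) has_real_derivative of_int m) (at x within {-pi..pi})"
        by (auto intro!: derivative_eq_intros)
      have "((\<lambda>x. of_real (of_int m * x) * \<i> :: complex) has_vector_derivative of_real (of_int m) * \<i>) (at x within {-pi..pi})"
        using 1 by (intro has_vector_derivative_mult_left has_vector_derivative_of_real)
      from field_vector_diff_chain_within[OF this has_field_derivative_at_within[OF DERIV_exp]]
      have "((\<lambda>x. exp (of_real (of_int m * x) * \<i>)) has_vector_derivative of_real (of_int m) * \<i> * exp (of_real (of_int m * x) * \<i>)) (at x within {-pi..pi})"
        by (simp add: o_def)
      from has_vector_derivative_divide[OF this, of "\<i> * of_int m"]
      show ?thesis using False by (simp add: cis_conv_exp mult_ac)
    qed
    then have "(\<integral>x. indicator {-pi..pi} x *\<^sub>R cis (of_int m * x) \<partial>lborel) = cis (of_int m * pi) / (\<i> * of_int m) - cis (of_int m * - pi) / (\<i> * of_int m)"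
      by (intro integral_FTC_Icc continuous_intros) auto
    moreover have "cis (of_int m * pi) = cis (of_int m * - pi)"
      by (auto simp: complex_eq_iff sin_zero_iff_int2)
    ultimately show ?thesis using False by simp
  qed
  finally show ?thesis .
qed

definition fourier_series :: "(int \<Rightarrow> complex) \<Rightarrow> real \<Rightarrow> complex" where
  "fourier_series a x = (\<Sum>\<^sub>\<infinity>k. a k * cis (of_int k * x))"

lemma abs_summable_cis: "a abs_summable_on UNIV \<Longrightarrow> (\<lambda>k. a k * cis (of_int k * x)) abs_summable_on UNIV"
  by (simp add: norm_mult)

text \<open>Enumerating the integers turns the unordered sum into an ordinary series, for which
  measurability of the limit and termwise integration are available.\<close>

lemma fourier_series_sums:
  assumes "a abs_summable_on UNIV"
  shows "fourier_series a x = (\<Sum>n. a (int_decode n) * cis (of_int (int_decode n) * x))"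
    and "summable (\<lambda>n. norm (a (int_decode n)))"
proof -
  have bij: "bij_betw int_decode UNIV UNIV" by (rule bij_int_decode)
  have "(\<lambda>n. norm (a (int_decode n))) summable_on UNIV"
    using assms summable_on_reindex_bij_betw[OF bij, of "\<lambda>k. norm (a k)"] by simp
  then show "summable (\<lambda>n. norm (a (int_decode n)))" by (rule summable_on_imp_summable)
  have "((\<lambda>k. a k * cis (of_int k * x)) has_sum fourier_series a x) UNIV"
    unfolding fourier_series_def by (intro has_sum_infsum abs_summable_summable[OF abs_summable_cis[OF assms]])
  then have "((\<lambda>n. a (int_decode n) * cis (of_int (int_decode n) * x)) has_sum fourier_series a x) UNIV"
    using has_sum_reindex_bij_betw[OF bij, of "\<lambda>k. a k * cis (of_int k * x)"] by simp
  from sums_unique[OF has_sum_imp_sums[OF this]] show "fourier_series a x = (\<Sum>n. a (int_decode n) * cis (of_int (int_decode n) * x))" .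
qed

lemma fourier_series_measurable [measurable]: "a abs_summable_on UNIV \<Longrightarrow> fourier_series a \<in> borel_measurable borel"
proof -
  assume "a abs_summable_on UNIV"
  then have "fourier_series a = (\<lambda>x. \<Sum>n. a (int_decode n) * cis (of_int (int_decode n) * x))"
    using fourier_series_sums(1) by blast
  then show ?thesis by simp
qed

lemma fourier_series_periodic: "fourier_series a (x + 2 * pi) = fourier_series a x"
proof -
  have "cis (of_int k * (x + 2 * pi)) = cis (of_int k * x)" for k
  proof -
    have "cis (of_int k * (x + 2 * pi)) = cis (of_int k * x) * cis (2 * pi * of_int k)"
      by (simp add: cis_mult algebra_simps)
    then show ?thesis by simp
  qed
  then show ?thesis by (simp add: fourier_series_def)
qed

lemma fourier_series_bound: "a abs_summable_on UNIV \<Longrightarrow> norm (fourier_series a x) \<le> (\<Sum>\<^sub>\<infinity>k. norm (a k))"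
  unfolding fourier_series_def using norm_infsum_bound[OF abs_summable_cis] by (simp add: norm_mult)

lemma fourier_coeff_fourier_series:
  assumes a: "a abs_summable_on UNIV" shows "fourier_coeff (fourier_series a) k = a k"
proof -
  define b where "b n = a (int_decode n)" for n
  have sb: "summable (\<lambda>n. norm (b n))" unfolding b_def by (rule fourier_series_sums(2)[OF a])
  define f where "f n x = b n * cis (of_int (int_decode n - k) * x)" for n x
  have I: "integrable torus (f n)" for n unfolding f_def by (rule integrable_torus_bounded[of _ "norm (b n)"]) (auto simp: norm_mult)
  have int_f: "(\<integral>x. f n x \<partial>torus) = b n * (if int_decode n = k then of_real (2 * pi) else 0)" for n
    unfolding f_def using integral_cis[of "int_decode n - k"] by simp
  have "fourier_series a x * cis (- (of_int k * x)) = (\<Sum>n. f n x)" for x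
  proof -
    have "summable (\<lambda>n. b n * cis (of_int (int_decode n) * x))"
      by (rule summable_norm_cancel) (use sb in \<open>simp add: norm_mult\<close>)
    then have "fourier_series a x * cis (- (of_int k * x)) = (\<Sum>n. b n * cis (of_int (int_decode n) * x) * cis (- (of_int k * x)))"
      using fourier_series_sums(1)[OF a, of x] by (simp add: suminf_mult2 b_def)
    then show ?thesis by (simp add: f_def cis_mult mult.assoc algebra_simps)
  qed
  then have "(\<integral>x. fourier_series a x * cis (- (of_int k * x)) \<partial>torus) = (\<integral>x. (\<Sum>n. f n x) \<partial>torus)" by simp
  also have "\<dots> = (\<Sum>n. \<integral>x. f n x \<partial>torus)"
  proof (rule integral_suminf[OF I])
    show "AE x in torus. summable (\<lambda>n. norm (f n x))" using sb by (simp add: f_def norm_mult)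
    have "summable (\<lambda>n. (2 * pi) * norm (b n))" using sb by (rule summable_mult)
    moreover have "(\<integral>x. norm (f n x) \<partial>torus) = (2 * pi) * norm (b n)" for n
    proof -
      have "measure torus (space torus) = 2 * pi"
        unfolding torus_def by (subst measure_restrict_space) (auto simp: space_restrict_space)
      then show ?thesis by (simp add: f_def norm_mult)
    qed
    ultimately show "summable (\<lambda>n. \<integral>x. norm (f n x) \<partial>torus)" by simp
  qed
  also have "\<dots> = (\<Sum>n. if n = int_encode k then b n * of_real (2 * pi) else 0)"
    unfolding int_f by (rule suminf_cong) auto
  also have "\<dots> = a k * of_real (2 * pi)"
    using sums_unique[OF sums_single[of "int_encode k" "\<lambda>n. b n * of_real (2 * pi)"]] by (simp add: b_def)
  finally show ?thesis unfolding fourier_coeff_torus by simp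
qed

lemma fourier_coeff_cong_AE:
  assumes "f \<in> borel_measurable borel" "g \<in> borel_measurable borel" "AE x in torus. f x = g x"
  shows "fourier_coeff f k = fourier_coeff g k"
proof -
  have [measurable]: "f \<in> borel_measurable torus" "g \<in> borel_measurable torus" using assms by auto
  have [measurable]: "(\<lambda>x. cis (- (of_int k * x))) \<in> borel_measurable torus"
    using cis_measurable[of "- of_int k"] by (intro measurable_torus) simp
  have "(\<integral>x. f x * cis (- (of_int k * x)) \<partial>torus) = (\<integral>x. g x * cis (- (of_int k * x)) \<partial>torus)"
    by (rule integral_cong_AE) (use assms(3) in auto)
  then show ?thesis by (simp add: fourier_coeff_torus)
qed

text \<open>Equality with the series holds only almost everywhere, since members of
  \<open>sobolev\<close> are arbitrary Borel representatives. Absolute summability of the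
  coefficients makes the relation compatible with pointwise products, and measurability and
  periodicity are kept because membership in \<open>sobolev\<close> asks for them.\<close>

definition represents :: "(real \<Rightarrow> complex) \<Rightarrow> (int \<Rightarrow> complex) \<Rightarrow> bool" where
  "represents f a \<longleftrightarrow> f \<in> borel_measurable borel \<and> (\<forall>x. f (x + 2 * pi) = f x) \<and> a abs_summable_on UNIV \<and> (AE x in torus. f x = fourier_series a x)"

lemma represents_fourier_series: "a abs_summable_on UNIV \<Longrightarrow> represents (fourier_series a) a"
  by (auto simp: represents_def fourier_series_periodic)

lemma represents_coeff: "represents f a \<Longrightarrow> fourier_coeff f = a"
  using fourier_coeff_cong_AE[of f "fourier_series a"] fourier_coeff_fourier_series[of a] by (auto simp: represents_def)

lemma fourier_series_add:
  assumes "a abs_summable_on UNIV" "b abs_summable_on UNIV" shows "fourier_series (\<lambda>k. a k + b k) x = fourier_series a x + fourier_series b x"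
proof -
  have "fourier_series (\<lambda>k. a k + b k) x = (\<Sum>\<^sub>\<infinity>k. a k * cis (of_int k * x) + b k * cis (of_int k * x))"
    unfolding fourier_series_def by (simp add: distrib_right)
  also have "\<dots> = fourier_series a x + fourier_series b x" unfolding fourier_series_def
    by (rule infsum_add[OF abs_summable_summable[OF abs_summable_cis[OF assms(1)]] abs_summable_summable[OF abs_summable_cis[OF assms(2)]]])
  finally show ?thesis .
qed

lemma fourier_series_scale: "fourier_series (\<lambda>k. c * a k) x = c * fourier_series a x"
  unfolding fourier_series_def by (simp add: mult.assoc infsum_cmult_right')

lemma abs_summable_add: 
  fixes a b :: "int \<Rightarrow> complex"
  assumes "a abs_summable_on UNIV" "b abs_summable_on UNIV" shows "(\<lambda>k. a k + b k) abs_summable_on UNIV"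
  by (rule Infinite_Sum.abs_summable_on_comparison_test'[OF summable_on_add[OF assms]]) (rule norm_triangle_ineq)

lemma abs_summable_scale: 
  fixes a :: "int \<Rightarrow> complex"
  assumes "a abs_summable_on UNIV" shows "(\<lambda>k. c * a k) abs_summable_on UNIV"
  using summable_on_cmult_right[OF assms, of "norm c"] by (simp add: norm_mult)

lemma represents_add: "represents f a \<Longrightarrow> represents g b \<Longrightarrow> represents (\<lambda>x. f x + g x) (\<lambda>k. a k + b k)"
  by (auto simp: represents_def fourier_series_add intro: abs_summable_add)

lemma represents_scale: "represents f a \<Longrightarrow> represents (\<lambda>x. c * f x) (\<lambda>k. c * a k)"
  by (auto simp: represents_def fourier_series_scale intro: abs_summable_scale)

lemma represents_diff: "represents f a \<Longrightarrow> represents g b \<Longrightarrow> represents (\<lambda>x. f x - g x) (\<lambda>k. a k - b k)"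
  using represents_add[of f a "\<lambda>x. -1 * g x" "\<lambda>k. -1 * b k"] represents_scale[of g b "-1"] by simp

definition conv :: "(int \<Rightarrow> complex) \<Rightarrow> (int \<Rightarrow> complex) \<Rightarrow> int \<Rightarrow> complex" where
  "conv a b k = (\<Sum>\<^sub>\<infinity>j. a j * b (k - j))"

lemma conv_abs_summable:
  fixes a b :: "int \<Rightarrow> complex"
  assumes a: "a abs_summable_on UNIV" and b: "b abs_summable_on UNIV"
  shows "(\<lambda>(k, j). a j * b (k - j)) abs_summable_on UNIV \<times> UNIV"
    and "(\<lambda>(j, l). a j * b l) abs_summable_on UNIV \<times> UNIV"
    and "conv a b abs_summable_on UNIV"
proof -
  show *: "(\<lambda>(j, l). a j * b l) abs_summable_on UNIV \<times> UNIV"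
    unfolding Infinite_Sum.abs_summable_on_Sigma_iff
    using a b by (auto simp: norm_mult infsum_cmult_right' abs_mult infsum_nonneg intro!: summable_on_cmult_right summable_on_cmult_left)
  show **: "(\<lambda>(k, j). a j * b (k - j)) abs_summable_on UNIV \<times> UNIV"
    using * summable_on_reindex_bij_witness[of "UNIV \<times> UNIV" "\<lambda>(j, l). (j + l, j)" "\<lambda>(k, j). (j, k - j)" "UNIV \<times> UNIV"
        "\<lambda>x. norm (case x of (j, l) \<Rightarrow> a j * b l)" "\<lambda>x. norm (case x of (k, j) \<Rightarrow> a j * b (k - j))"]
    by auto
  then have "(\<lambda>k. \<Sum>\<^sub>\<infinity>j. norm (a j * b (k - j))) abs_summable_on UNIV"
    unfolding Infinite_Sum.abs_summable_on_Sigma_iff by simp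
  moreover have "norm (conv a b k) \<le> norm (\<Sum>\<^sub>\<infinity>j. norm (a j * b (k - j)))" for k
  proof -
    have "(\<lambda>j. a j * b (k - j)) abs_summable_on UNIV"
      using ** unfolding Infinite_Sum.abs_summable_on_Sigma_iff by simp
    from norm_infsum_bound[OF this] show ?thesis by (simp add: conv_def)
  qed
  ultimately show "conv a b abs_summable_on UNIV"
    by (rule Infinite_Sum.abs_summable_on_comparison_test)
qed

text \<open>The Cauchy product: absolute summability over pairs permits the change of indices from
  (j, l) to (j + l, j).\<close>

lemma fourier_series_mult:
  assumes a: "a abs_summable_on UNIV" and b: "b abs_summable_on UNIV"
  shows "fourier_series a x * fourier_series b x = fourier_series (conv a b) x"
proof -
  define A where "A k = a k * cis (of_int k * x)" for k
  define B where "B k = b k * cis (of_int k * x)" for k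
  have AB: "A abs_summable_on UNIV" "B abs_summable_on UNIV" unfolding A_def B_def by (intro abs_summable_cis a b)+
  note s = conv_abs_summable[OF AB]
  have "fourier_series a x * fourier_series b x = (\<Sum>\<^sub>\<infinity>j. \<Sum>\<^sub>\<infinity>l. A j * B l)"
    unfolding fourier_series_def by (simp add: infsum_cmult_left' infsum_cmult_right' flip: A_def B_def)
  also have "\<dots> = infsum (\<lambda>(j, l). A j * B l) (UNIV \<times> UNIV)"
    by (rule infsum_Sigma'_banach[OF abs_summable_summable[OF s(2)]])
  also have "\<dots> = infsum (\<lambda>(k, j). A j * B (k - j)) (UNIV \<times> UNIV)"
    by (rule infsum_reindex_bij_witness[of _ "\<lambda>(k, j). (j, k - j)" "\<lambda>(j, l). (j + l, j)"]) auto
  also have "\<dots> = (\<Sum>\<^sub>\<infinity>k. \<Sum>\<^sub>\<infinity>j. A j * B (k - j))"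
    by (rule infsum_Sigma'_banach[OF abs_summable_summable[OF s(1)], symmetric])
  also have "\<dots> = (\<Sum>\<^sub>\<infinity>k. conv a b k * cis (of_int k * x))"
  proof (rule infsum_cong)
    fix k
    have "A j * B (k - j) = a j * b (k - j) * cis (of_int k * x)" for j
    proof -
      have "cis (of_int j * x) * cis (of_int (k - j) * x) = cis (of_int k * x)" by (simp add: cis_mult algebra_simps)
      then show ?thesis unfolding A_def B_def by (metis (no_types, lifting) mult.assoc mult.left_commute)
    qed
    then show "(\<Sum>\<^sub>\<infinity>j. A j * B (k - j)) = conv a b k * cis (of_int k * x)"
      by (simp add: conv_def infsum_cmult_left')
  qed
  finally show ?thesis by (simp add: fourier_series_def)
qed

lemma represents_mult: "represents f a \<Longrightarrow> represents g b \<Longrightarrow> represents (\<lambda>x. f x * g x) (conv a b)"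
  by (auto simp: represents_def fourier_series_mult intro: conv_abs_summable)

lemma represents_fourier_mult:
  assumes "represents f a" "(\<lambda>k. m k * a k) abs_summable_on UNIV" shows "represents (fourier_mult m f) (\<lambda>k. m k * a k)"
proof -
  have "fourier_mult m f = fourier_series (\<lambda>k. m k * a k)"
    by (simp add: fourier_mult_def fourier_series_def fun_eq_iff represents_coeff[OF assms(1)])
  then show ?thesis using represents_fourier_series[OF assms(2)] by simp
qed

lemma fourier_coeff_diff:
  assumes "integrable torus f" "integrable torus g" shows "fourier_coeff (\<lambda>x. f x - g x) k = fourier_coeff f k - fourier_coeff g k"
  using integrable_torus_cis'[OF assms(1), of "of_int k"] integrable_torus_cis'[OF assms(2), of "of_int k"]
  by (simp add: fourier_coeff_torus left_diff_distrib diff_divide_distrib)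

section \<open>Completeness of the trigonometric system\<close>

definition no_modes :: "(real \<Rightarrow> complex) \<Rightarrow> bool" where
  "no_modes f \<longleftrightarrow> integrable torus f \<and> (\<forall>k::int. (\<integral>x. f x * cis (of_int k * x) \<partial>torus) = 0)"

lemma no_modes_add: "no_modes f \<Longrightarrow> no_modes g \<Longrightarrow> no_modes (\<lambda>x. f x + g x)"
  by (simp add: no_modes_def distrib_right integrable_torus_cis)

lemma no_modes_scale: "no_modes f \<Longrightarrow> no_modes (\<lambda>x. c * f x)"
  by (simp add: no_modes_def mult.assoc integrable_torus_cis)

lemma no_modes_cis: assumes "no_modes f" shows "no_modes (\<lambda>x. f x * cis (of_int m * x))"
  unfolding no_modes_def
proof (intro conjI allI)
  show "integrable torus (\<lambda>x. f x * cis (of_int m * x))" using assms by (auto simp: no_modes_def intro: integrable_torus_cis)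
  fix k :: int
  have "(\<lambda>x. f x * cis (of_int m * x) * cis (of_int k * x)) = (\<lambda>x. f x * cis (of_int (m + k) * x))"
    by (simp add: fun_eq_iff cis_mult mult.assoc algebra_simps)
  moreover have "(\<integral>x. f x * cis (of_int (m + k) * x) \<partial>torus) = 0" using assms by (simp only: no_modes_def)
  ultimately show "(\<integral>x. f x * cis (of_int m * x) * cis (of_int k * x) \<partial>torus) = 0" by (simp only:)
qed

text \<open>Stone-Weierstrass supplies real polynomials in the point \<open>cis x\<close> of the
  plane, not trigonometric polynomials. A linear functional of \<open>cis x\<close> is a combination
  of \<open>cis x\<close> and \<open>cis (- x)\<close>, so multiplication by it merely shifts modes.
  The induction generalises \<open>f\<close> because a product is absorbed one factor at a
  time.\<close>

lemma no_modes_polynomial: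
  fixes g :: "complex \<Rightarrow> real"
  assumes "real_polynomial_function g" "no_modes f"
  shows "no_modes (\<lambda>x. f x * of_real (g (cis x)))"
  using assms
proof (induction g arbitrary: f rule: real_polynomial_function.induct)
  case (linear g)
  note nm = \<open>no_modes f\<close>
  interpret bounded_linear g by fact
  have "g (cis x) = cos x * g 1 + sin x * g \<i>" for x
  proof -
    have "cis x = cos x *\<^sub>R 1 + sin x *\<^sub>R \<i>" by (simp add: complex_eq_iff)
    then have "g (cis x) = g (cos x *\<^sub>R 1 + sin x *\<^sub>R \<i>)" by simp
    then show ?thesis by (simp only: add scaleR) simp
  qed
  then have "f x * of_real (g (cis x)) = (of_real (g 1) / 2 - \<i> * of_real (g \<i>) / 2) * (f x * cis (of_int 1 * x))
      + (of_real (g 1) / 2 + \<i> * of_real (g \<i>) / 2) * (f x * cis (of_int (- 1) * x))" for x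
    by (simp add: complex_eq_iff field_simps)
  moreover have "no_modes (\<lambda>x. (of_real (g 1) / 2 - \<i> * of_real (g \<i>) / 2) * (f x * cis (of_int 1 * x))
      + (of_real (g 1) / 2 + \<i> * of_real (g \<i>) / 2) * (f x * cis (of_int (- 1) * x)))"
    by (intro no_modes_add no_modes_scale no_modes_cis nm)
  ultimately show ?case by simp
next
  case (const c)
  then show ?case using no_modes_scale[of f "of_real c"] by (simp add: mult.commute)
next
  case (add g h)
  then show ?case using no_modes_add by (simp add: distrib_left)
next
  case (mult g h)
  then show ?case by (simp add: mult.assoc[symmetric])
qed

lemma no_modes_continuous:
  fixes h :: "complex \<Rightarrow> real"
  assumes f: "no_modes f" and h: "continuous_on (sphere 0 1) h"
  shows "(\<integral>x. f x * of_real (h (cis x)) \<partial>torus) = 0"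
proof -
  have fi: "integrable torus f" using f by (simp add: no_modes_def)
  have c: "continuous_on UNIV (\<lambda>x. h (cis x))"
    by (rule continuous_on_compose2[OF h]) (auto intro!: continuous_intros)
  have hm: "(\<lambda>x. complex_of_real (h (cis x))) \<in> borel_measurable torus"
    by (intro measurable_torus borel_measurable_continuous_onI continuous_on_of_real c)
  have "compact (h ` sphere 0 1)" using h by (rule compact_continuous_image) simp
  then obtain C where "\<forall>y\<in>h ` sphere 0 1. norm y \<le> C" using compact_imp_bounded bounded_iff by metis
  then have C: "norm (complex_of_real (h (cis x))) \<le> C" for x by simp
  have fh: "integrable torus (\<lambda>x. f x * of_real (h (cis x)))" by (rule integrable_torus_mult[OF fi hm C])
  have "norm (\<integral>x. f x * of_real (h (cis x)) \<partial>torus) \<le> e * (\<integral>x. norm (f x) \<partial>torus)" if e: "0 < e" for e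
  proof -
    obtain g where g: "real_polynomial_function g" "\<And>z. z \<in> sphere 0 1 \<Longrightarrow> \<bar>h z - g z\<bar> < e"
      using Stone_Weierstrass_real_polynomial_function[OF compact_sphere h e] by blast
    have ng: "no_modes (\<lambda>x. f x * of_real (g (cis x)))" by (rule no_modes_polynomial[OF g(1) f])
    then have gi: "integrable torus (\<lambda>x. f x * of_real (g (cis x)))" and g0: "(\<integral>x. f x * of_real (g (cis x)) \<partial>torus) = 0"
      unfolding no_modes_def by (auto dest: spec[of _ 0])
    have "(\<integral>x. f x * of_real (h (cis x)) \<partial>torus) = (\<integral>x. f x * of_real (h (cis x)) - f x * of_real (g (cis x)) \<partial>torus)"
      using fh gi g0 by simp
    also have "norm \<dots> \<le> (\<integral>x. norm (f x * of_real (h (cis x)) - f x * of_real (g (cis x))) \<partial>torus)"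
      by (rule integral_norm_bound)
    also have "\<dots> \<le> (\<integral>x. e * norm (f x) \<partial>torus)"
    proof (rule integral_mono)
      fix x
      have "norm (complex_of_real (h (cis x)) - of_real (g (cis x))) \<le> e"
        using g(2)[of "cis x"] by (simp flip: of_real_diff)
      then show "norm (f x * of_real (h (cis x)) - f x * of_real (g (cis x))) \<le> e * norm (f x)"
        by (simp add: norm_mult mult.commute[of e] mult_left_mono flip: right_diff_distrib)
    qed (use fh gi fi in auto)
    finally show ?thesis by simp
  qed
  note * = this
  define J where "J = (\<integral>x. norm (f x) \<partial>torus)"
  have J: "0 \<le> J" unfolding J_def by (rule integral_nonneg_AE) simp
  have "norm (\<integral>x. f x * of_real (h (cis x)) \<partial>torus) \<le> 0 + e" if "0 < e" for e
  proof -
    \<comment> \<open>Dividing by \<open>J + 1\<close> instead of \<open>J\<close> covers the case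
      that \<open>f\<close> has zero integral norm.\<close>
    have "norm (\<integral>x. f x * of_real (h (cis x)) \<partial>torus) \<le> e / (J + 1) * J"
    proof -
      have "0 < e / (J + 1)" using that J by simp
      from *[OF this] show ?thesis by (simp add: J_def)
    qed
    also have "\<dots> \<le> e" using that J by (simp add: field_simps)
    finally show ?thesis by simp
  qed
  then have "norm (\<integral>x. f x * of_real (h (cis x)) \<partial>torus) \<le> 0" by (rule field_le_epsilon)
  then show ?thesis by simp
qed

text \<open>On the closed interval \<open>cis\<close> identifies only the two endpoints. Interior
  points are recovered by \<open>Arg\<close>, and \<open>y = - pi\<close> is the one value outside
  the range of \<open>Arg\<close>.\<close>

lemma cis_image_iff:
  assumes "- pi < x" "x < pi" "A \<subseteq> {-pi..pi}"
  shows "cis x \<in> cis ` A \<longleftrightarrow> x \<in> A"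
proof
  assume "cis x \<in> cis ` A"
  then obtain y where y: "y \<in> A" "cis x = cis y" by auto
  have ax: "Arg (cis x) = x" using assms by (intro Arg_cis) auto
  show "x \<in> A"
  proof (cases "y = - pi")
    case True
    then have "cis y = cis pi" by (simp add: complex_eq_iff)
    then have "Arg (cis x) = pi" using y(2) Arg_cis[of pi] by simp
    then show ?thesis using ax assms by simp
  next
    case False
    then have "Arg (cis y) = y" using y assms(3) by (intro Arg_cis) force
    then show ?thesis using ax y by simp
  qed
qed auto

text \<open>The indicator is a pointwise limit of continuous cut-offs on the circle. Transporting
  the closed set to the circle changes it at most at the endpoints \<open>- pi\<close> and
  \<open>pi\<close>, which form a null set.\<close>

lemma no_modes_closed:
  assumes f: "no_modes f" and A: "closed A"
  shows "(\<integral>x. indicator A x *\<^sub>R f x \<partial>torus) = 0"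
\<comment> \<open>The empty case is split off because \<open>infdist\<close> to the empty set is 0,
  so the cut-offs below would not tend to 0.\<close>
proof (cases "A \<inter> {-pi..pi} = {}")
  case True
  then have "(\<integral>x. indicator A x *\<^sub>R f x \<partial>torus) = (\<integral>x. 0 \<partial>torus)"
    by (intro Bochner_Integration.integral_cong) (auto simp: indicator_def)
  then show ?thesis by simp
next
  case False
  define Kc where "Kc = cis ` (A \<inter> {-pi..pi})"
  have fi: "integrable torus f" using f by (simp add: no_modes_def)
  have [measurable]: "f \<in> borel_measurable torus" using fi by auto
  have "compact Kc" unfolding Kc_def
    using A by (intro compact_continuous_image continuous_intros) (simp add: compact_Int_closed Int_commute closed_Int_compact)
  then have Kc: "closed Kc" "Kc \<noteq> {}" using False by (auto simp: compact_imp_closed Kc_def)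
  define h where "h n z = max 0 (1 - real n * infdist z Kc)" for n z
  have hc: "continuous_on S (h n)" for n S
    unfolding h_def by (intro continuous_intros)
  have h1: "\<bar>h n z\<bar> \<le> 1" for n z by (auto simp: h_def infdist_nonneg)
  have lim: "(\<lambda>n. h n z) \<longlonglongrightarrow> indicator Kc z" for z
  proof (cases "z \<in> Kc")
    case True
    then show ?thesis by (simp add: h_def)
  next
    case False
    then have d: "0 < infdist z Kc" using Kc infdist_pos_not_in_closed by blast
    obtain N where N: "1 < real N * infdist z Kc" using ex_less_of_nat_mult[OF d] by blast
    have "\<forall>\<^sub>F n in sequentially. h n z = 0"
      using eventually_ge_at_top[of N]
    proof eventually_elim
      case (elim n)
      have "1 < real n * infdist z Kc" using N elim d by (meson less_le_trans mult_right_mono of_nat_mono order_less_imp_le)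
      then show ?case by (simp add: h_def)
    qed
    then show ?thesis using False by (simp add: tendsto_eventually)
  qed
  have hm: "(\<lambda>x. h n (cis x)) \<in> borel_measurable torus" for n
    by (intro measurable_torus borel_measurable_continuous_onI continuous_on_compose2[OF hc[of UNIV]] continuous_intros) auto
  have "(\<lambda>n. \<integral>x. f x * of_real (h n (cis x)) \<partial>torus) \<longlonglongrightarrow> (\<integral>x. f x * of_real (indicator Kc (cis x)) \<partial>torus)"
  proof (rule integral_dominated_convergence[where w = "\<lambda>x. norm (f x)"])
    show "(\<lambda>x. f x * complex_of_real (indicator Kc (cis x))) \<in> borel_measurable torus"
    proof (rule borel_measurable_LIMSEQ_metric)
      show "(\<lambda>x. f x * of_real (h n (cis x))) \<in> borel_measurable torus" for n using hm by measurable
      show "(\<lambda>n. f x * of_real (h n (cis x))) \<longlonglongrightarrow> f x * complex_of_real (indicator Kc (cis x))" for x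
        by (intro tendsto_intros lim)
    qed
    show "(\<lambda>x. f x * of_real (h n (cis x))) \<in> borel_measurable torus" for n using hm by measurable
    show "integrable torus (\<lambda>x. norm (f x))" using fi by simp
    show "AE x in torus. (\<lambda>n. f x * of_real (h n (cis x))) \<longlonglongrightarrow> f x * complex_of_real (indicator Kc (cis x))"
      by (intro AE_I2 tendsto_intros lim)
    show "AE x in torus. norm (f x * of_real (h n (cis x))) \<le> norm (f x)" for n
      using h1 by (auto simp: norm_mult mult_left_le)
  qed
  then have 0: "(\<integral>x. f x * of_real (indicator Kc (cis x)) \<partial>torus) = 0"
    using no_modes_continuous[OF f hc] by (simp add: LIMSEQ_const_iff)
  have "(\<integral>x. indicator A x *\<^sub>R f x \<partial>torus) = (\<integral>x. f x * of_real (indicator Kc (cis x)) \<partial>torus)"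
  proof (rule integral_cong_AE)
    show "(\<lambda>x. indicator A x *\<^sub>R f x) \<in> borel_measurable torus"
    proof (intro borel_measurable_scaleR)
      show "indicat_real A \<in> borel_measurable torus" using A by (intro measurable_torus) simp
    qed simp
    have "cis \<in> borel_measurable borel" using cis_measurable[of 1] by simp
    moreover have "indicat_real Kc \<in> borel_measurable borel" using Kc by simp
    ultimately have "(\<lambda>x. indicat_real Kc (cis x)) \<in> borel_measurable borel" by (rule measurable_compose)
    then have "(\<lambda>x. complex_of_real (indicator Kc (cis x))) \<in> borel_measurable torus"
      by (intro measurable_torus measurable_compose[OF _ borel_measurable_continuous_onI[of complex_of_real]])
        (auto intro: continuous_intros)
    then show "(\<lambda>x. f x * complex_of_real (indicator Kc (cis x))) \<in> borel_measurable torus" by simp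
    have "AE x in lborel. x \<noteq> pi \<and> x \<noteq> - pi" by (intro AE_conjI AE_lborel_singleton)
    then show "AE x in torus. indicat_real A x *\<^sub>R f x = f x * complex_of_real (indicator Kc (cis x))"
      unfolding AE_torus
    proof eventually_elim
      case (elim x)
      show ?case
      proof
        assume x: "x \<in> {-pi..pi}"
        then have "cis x \<in> Kc \<longleftrightarrow> x \<in> A \<inter> {-pi..pi}" unfolding Kc_def using elim by (intro cis_image_iff) auto
        then show "indicat_real A x *\<^sub>R f x = f x * complex_of_real (indicator Kc (cis x))"
          using x by (auto simp: indicator_def)
      qed
    qed
  qed
  then show ?thesis using 0 by simp
qed

text \<open>Completeness of the trigonometric system: Stone-Weierstrass on the unit circle shows that the
  integral of \<open>f\<close> over closed sets vanishes, and closed sets are an intersection-stable generator.\<close>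
lemma no_modes_AE_0:
  assumes f: "no_modes f" shows "AE x in torus. f x = 0"
proof -
  interpret finite_measure torus by (rule finite_measure_torus)
  have fi: "integrable torus f" using f by (simp add: no_modes_def)
  have sub: "B \<inter> {-pi..pi} \<in> sets torus" if "B \<in> sets borel" for B :: "real set"
    using that by (auto simp: torus_def sets_restrict_space_iff)
  have ind: "(\<integral>x. indicator B x *\<^sub>R f x \<partial>torus) = (LINT x:(B \<inter> {-pi..pi})|torus. f x)" for B
    unfolding set_lebesgue_integral_def by (rule Bochner_Integration.integral_cong) (auto simp: indicator_def)
  have si: "set_integrable torus C f" if "C \<in> sets torus" for C
    unfolding set_integrable_def by (rule integrable_mult_indicator[OF that fi])
  have "(\<integral>x. indicator B x *\<^sub>R f x \<partial>torus) = 0" if "B \<in> sets borel" for B :: "real set"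
  proof -
    have "Int_stable (Collect closed :: real set set)" by (auto simp: Int_stable_def)
    moreover have "Collect closed \<subseteq> Pow (UNIV :: real set)" by simp
    moreover have "B \<in> sigma_sets UNIV (Collect closed)" using that by (simp add: borel_eq_closed)
    ultimately show ?thesis
    proof (induction rule: sigma_sets_induct_disjoint)
      case (basic A)
      then show ?case using no_modes_closed[OF f] by simp
    next
      case empty
      show ?case by simp
    next
      case (compl A)
      have A: "A \<in> sets borel" using compl by (simp add: borel_eq_closed)
      have U: "(\<integral>x. f x \<partial>torus) = 0" using no_modes_closed[OF f closed_UNIV] by simp
      have iA: "integrable torus (\<lambda>x. indicat_real A x *\<^sub>R f x)"
      proof -
        have "integrable torus (\<lambda>x. indicat_real (A \<inter> {-pi..pi}) x *\<^sub>R f x)" using si[OF sub[OF A]] by (simp add: set_integrable_def)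
        then show ?thesis by (rule Bochner_Integration.integrable_cong[THEN iffD1, rotated -1]) (auto simp: indicator_def)
      qed
      have "(\<integral>x. indicat_real (UNIV - A) x *\<^sub>R f x \<partial>torus) = (\<integral>x. f x - indicat_real A x *\<^sub>R f x \<partial>torus)"
        by (rule Bochner_Integration.integral_cong) (auto simp: indicator_def)
      also have "\<dots> = 0" using fi iA U compl by simp
      finally show ?case .
    next
      case (union A)
      have A: "A i \<in> sets borel" for i using union(2) by (auto simp: borel_eq_closed)
      have "(\<integral>x. indicat_real (\<Union>i. A i) x *\<^sub>R f x \<partial>torus) = (LINT x:(\<Union>i. A i \<inter> {-pi..pi})|torus. f x)"
        unfolding ind by simp
      also have "\<dots> = (\<Sum>i. (LINT x:(A i \<inter> {-pi..pi})|torus. f x))"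
      proof (rule lebesgue_integral_countable_add)
        show "A i \<inter> {-pi..pi} \<in> sets torus" for i by (rule sub[OF A])
        show "A i \<inter> {-pi..pi} \<inter> (A j \<inter> {-pi..pi}) = {}" if "i \<noteq> j" for i j
          using union(1) that by (auto simp: disjoint_family_on_def)
        show "set_integrable torus (\<Union>i. A i \<inter> {-pi..pi}) f" by (intro si sets.countable_UN) (auto intro: sub A)
      qed
      also have "\<dots> = 0" using union(3) by (simp add: ind)
      finally show ?case .
    qed
  qed
  note Z = this
  show ?thesis
  proof (rule density_zero[OF fi])
    fix C assume C: "C \<in> sets torus"
    then obtain B where B: "B \<in> sets borel" "C = B \<inter> {-pi..pi}" by (auto simp: torus_def sets_restrict_space)
    show "set_lebesgue_integral torus C f = 0" using Z[OF B(1)] B(2) by (simp add: ind)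
  qed
qed

text \<open>The difference of \<open>f\<close> and its Fourier series is integrable and has no
  modes, so completeness makes it a null function. This is what ties an arbitrary Borel
  representative to a pointwise convergent series.\<close>

lemma represents_fourier_coeff:
  assumes f: "f \<in> borel_measurable borel" "\<And>x. f (x + 2 * pi) = f x" "integrable torus f"
    and a: "fourier_coeff f abs_summable_on UNIV"
  shows "represents f (fourier_coeff f)"
proof -
  define g where "g x = f x - fourier_series (fourier_coeff f) x" for x
  have i: "integrable torus (fourier_series (fourier_coeff f))"
    by (rule integrable_torus_bounded[OF measurable_torus[OF fourier_series_measurable[OF a]] fourier_series_bound[OF a]])
  have gi: "integrable torus g" unfolding g_def using f(3) i by simp
  have "fourier_coeff g k = 0" for k
    unfolding g_def using fourier_coeff_diff[OF f(3) i] fourier_coeff_fourier_series[OF a] by simp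
  then have "(\<integral>x. g x * cis (- (of_int k * x)) \<partial>torus) = 0" for k
    by (simp add: fourier_coeff_torus)
  from this[of "- k" for k] have "no_modes g" using gi by (simp add: no_modes_def)
  from no_modes_AE_0[OF this] have "AE x in torus. f x = fourier_series (fourier_coeff f) x" by (simp add: g_def)
  then show ?thesis using f a by (simp add: represents_def)
qed

section \<open>Sobolev membership and weighted coefficient bounds\<close>

lemma sobolev_integrable:
  assumes "f \<in> sobolev s" shows "integrable torus f"
proof -
  interpret finite_measure torus by (rule finite_measure_torus)
  have m: "f \<in> borel_measurable torus" using assms by (auto simp: sobolev_def)
  have "integrable torus (\<lambda>x. (norm (f x))\<^sup>2)" using assms by (simp add: sobolev_def set_integrable_torus)
  then have "integrable torus (\<lambda>x. 1 + (norm (f x))\<^sup>2)" by simp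
  then show ?thesis
  proof (rule Bochner_Integration.integrable_bound[OF _ m])
    have "norm (f x) \<le> 1 + (norm (f x))\<^sup>2" for x
    proof -
      have "2 * norm (f x) * 1 \<le> (norm (f x))\<^sup>2 + 1\<^sup>2" by (rule sum_squares_bound)
      then have "2 * norm (f x) \<le> (norm (f x))\<^sup>2 + 1" by simp
      then show ?thesis using norm_ge_zero[of "f x"] by linarith
    qed
    then show "AE x in torus. norm (f x) \<le> norm (1 + (norm (f x))\<^sup>2)"
      unfolding real_norm_def by (intro AE_I2 order_trans[OF _ abs_ge_self])
  qed
qed

lemma sobolev_summand: "(1 + \<bar>of_int k\<bar>) powr (2 * s) * (norm (c :: complex))\<^sup>2 = (weight k powr s * norm c)\<^sup>2"
  by (simp add: weight_def power_mult_distrib powr_power mult.commute)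

lemma sobolev_wl2_le:
  assumes "f \<in> sobolev s" shows "wl2_le s (sobolev_norm s f) (fourier_coeff f)"
proof (rule wl2_leI)
  fix F :: "int set" assume F: "finite F"
  have "(\<Sum>k\<in>F. (weight k powr s * norm (fourier_coeff f k))\<^sup>2) \<le> (\<Sum>\<^sub>\<infinity>k. (weight k powr s * norm (fourier_coeff f k))\<^sup>2)"
    using assms F by (intro finite_sum_le_infsum) (auto simp: sobolev_def sobolev_summand)
  then show "L2_set (\<lambda>k. weight k powr s * norm (fourier_coeff f k)) F \<le> sobolev_norm s f"
    by (simp add: L2_set_def sobolev_norm_def sobolev_summand)
qed

lemma wl2_le_sum_le:
  assumes "wl2_le s M a" "finite F" shows "(\<Sum>k\<in>F. (weight k powr s * norm (a k))\<^sup>2) \<le> M\<^sup>2"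
  using wl2_leD[OF assms] wl2_le_nonneg[OF assms(1)] unfolding L2_set_def by (metis real_sqrt_le_iff real_sqrt_unique)

lemma wl2_le_sobolev_norm_le:
  assumes "wl2_le s M (fourier_coeff f)" shows "sobolev_norm s f \<le> M"
    and "(\<lambda>k::int. (1 + \<bar>of_int k\<bar>) powr (2 * s) * (norm (fourier_coeff f k))\<^sup>2) summable_on UNIV"
proof -
  show S: "(\<lambda>k::int. (1 + \<bar>of_int k\<bar>) powr (2 * s) * (norm (fourier_coeff f k))\<^sup>2) summable_on UNIV"
    unfolding sobolev_summand using wl2_le_sum_le[OF assms]
    by (intro nonneg_bdd_above_summable_on bdd_aboveI2[where M = "M\<^sup>2"]) auto
  have "(\<Sum>\<^sub>\<infinity>k. (weight k powr s * norm (fourier_coeff f k))\<^sup>2) \<le> M\<^sup>2"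
    using S wl2_le_sum_le[OF assms] unfolding sobolev_summand by (intro infsum_le_finite_sums) auto
  then show "sobolev_norm s f \<le> M"
    unfolding sobolev_norm_def sobolev_summand using wl2_le_nonneg[OF assms] by (simp add: real_le_lsqrt infsum_nonneg)
qed

text \<open>Square integrability is read off the supremum bound of the absolutely convergent series.
  The final estimate returns from coefficients to functions through this lemma.\<close>

lemma represents_sobolev:
  assumes "represents f a" "wl2_le s M a" shows "f \<in> sobolev s" "sobolev_norm s f \<le> M"
proof -
  have c: "fourier_coeff f = a" by (rule represents_coeff[OF assms(1)])
  show "sobolev_norm s f \<le> M" using wl2_le_sobolev_norm_le(1)[of s M f] assms(2) c by simp
  have m: "f \<in> borel_measurable borel" using assms(1) by (simp add: represents_def)
  have as: "a abs_summable_on UNIV" using assms(1) by (simp add: represents_def)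
  interpret finite_measure torus by (rule finite_measure_torus)
  have "integrable torus (\<lambda>x. (norm (f x))\<^sup>2)"
  proof (rule integrable_const_bound[of _ "(\<Sum>\<^sub>\<infinity>k. norm (a k))\<^sup>2"])
    show "(\<lambda>x. (norm (f x))\<^sup>2) \<in> borel_measurable torus" using m by (intro measurable_torus) simp
    have "AE x in torus. f x = fourier_series a x" using assms(1) by (simp add: represents_def)
    then show "AE x in torus. norm ((norm (f x))\<^sup>2) \<le> (\<Sum>\<^sub>\<infinity>k. norm (a k))\<^sup>2"
      by eventually_elim (use fourier_series_bound[OF as] in \<open>auto intro: power_mono\<close>)
  qed
  then show "f \<in> sobolev s"
    using assms(1) wl2_le_sobolev_norm_le(2)[of s M f] assms(2) c by (simp add: sobolev_def set_integrable_torus represents_def)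
qed

lemma sobolev_represents:
  assumes "f \<in> sobolev s" "1 \<le> s" shows "represents f (fourier_coeff f)"
proof (rule represents_fourier_coeff)
  show "fourier_coeff f abs_summable_on UNIV"
    by (rule wl2_le_abs_summable[OF wl2_le_mono[OF sobolev_wl2_le[OF assms(1)] assms(2) order_refl]])
  show "integrable torus f" by (rule sobolev_integrable[OF assms(1)])
qed (use assms in \<open>auto simp: sobolev_def\<close>)

lemma sobolev_norm_triangle:
  assumes "f \<in> sobolev s" "g \<in> sobolev s"
  shows "sobolev_norm s f \<le> sobolev_norm s g + sobolev_norm s (\<lambda>x. f x - g x)"
proof -
  have d: "fourier_coeff (\<lambda>x. f x - g x) = (\<lambda>k. fourier_coeff f k - fourier_coeff g k)"
    using fourier_coeff_diff[OF sobolev_integrable[OF assms(1)] sobolev_integrable[OF assms(2)]] by auto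
  have "wl2_le s (sobolev_norm s f + norm (-1 :: complex) * sobolev_norm s g) (\<lambda>k. fourier_coeff f k + -1 * fourier_coeff g k)"
    by (intro wl2_le_add wl2_le_scale sobolev_wl2_le assms)
  then have "wl2_le s (sobolev_norm s f + sobolev_norm s g) (fourier_coeff (\<lambda>x. f x - g x))" by (simp add: d)
  note S = wl2_le_sobolev_norm_le(2)[OF this]
  have h: "wl2_le s (sobolev_norm s (\<lambda>x. f x - g x)) (fourier_coeff (\<lambda>x. f x - g x))"
  proof (rule wl2_leI)
    fix F :: "int set" assume F: "finite F"
    have "(\<Sum>k\<in>F. (weight k powr s * norm (fourier_coeff (\<lambda>x. f x - g x) k))\<^sup>2) \<le> (\<Sum>\<^sub>\<infinity>k. (weight k powr s * norm (fourier_coeff (\<lambda>x. f x - g x) k))\<^sup>2)"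
      using S F by (intro finite_sum_le_infsum) (auto simp: sobolev_summand)
    then show "L2_set (\<lambda>k. weight k powr s * norm (fourier_coeff (\<lambda>x. f x - g x) k)) F \<le> sobolev_norm s (\<lambda>x. f x - g x)"
      by (simp add: L2_set_def sobolev_norm_def sobolev_summand)
  qed
  from wl2_le_add[OF sobolev_wl2_le[OF assms(2)] h] have "wl2_le s (sobolev_norm s g + sobolev_norm s (\<lambda>x. f x - g x)) (fourier_coeff f)"
    by (simp add: d)
  then show ?thesis by (rule wl2_le_sobolev_norm_le(1))
qed

text \<open>A real supremum says nothing about an unbounded set; this makes the \<open>SUP\<close>
  in the final estimate an actual bound of the solution.\<close>

lemma continuous_into_sobolev_bdd:
  assumes "continuous_into_sobolev T s u"
  shows "bdd_above ((\<lambda>t. sobolev_norm s (u t)) ` {0..T})"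
proof -
  have u: "u t \<in> sobolev s" if "t \<in> {0..T}" for t using assms that by (simp add: continuous_into_sobolev_def)
  have neg: "sobolev_norm s (\<lambda>x. f x - g x) = sobolev_norm s (\<lambda>x. g x - f x)" if "f \<in> sobolev s" "g \<in> sobolev s" for f g
    unfolding sobolev_norm_def using fourier_coeff_diff sobolev_integrable that by (simp add: norm_minus_commute)
  have "continuous_on {0..T} (\<lambda>t. sobolev_norm s (u t))"
    unfolding continuous_on_def
  proof
    fix t assume t: "t \<in> {0..T}"
    have "((\<lambda>t'. sobolev_norm s (\<lambda>x. u t' x - u t x)) \<longlongrightarrow> 0) (at t within {0..T})"
      using assms t by (simp add: continuous_into_sobolev_def)
    then have "((\<lambda>t'. sobolev_norm s (u t') - sobolev_norm s (u t)) \<longlongrightarrow> 0) (at t within {0..T})"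
    proof (rule tendsto_0_le[where K = 1])
      have "\<bar>sobolev_norm s (u t') - sobolev_norm s (u t)\<bar> \<le> sobolev_norm s (\<lambda>x. u t' x - u t x)" if "t' \<in> {0..T}" for t'
        using sobolev_norm_triangle[OF u[OF that] u[OF t]] sobolev_norm_triangle[OF u[OF t] u[OF that]] neg[OF u[OF that] u[OF t]] by simp
      then show "\<forall>\<^sub>F t' in at t within {0..T}. norm (sobolev_norm s (u t') - sobolev_norm s (u t)) \<le> norm (sobolev_norm s (\<lambda>x. u t' x - u t x)) * 1"
        unfolding eventually_at_filter by (intro always_eventually) (auto intro: order_trans[OF _ abs_ge_self])
    qed
    then show "((\<lambda>t. sobolev_norm s (u t)) \<longlongrightarrow> sobolev_norm s (u t)) (at t within {0..T})"
      by (rule LIM_zero_cancel)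
  qed
  then have "compact ((\<lambda>t. sobolev_norm s (u t)) ` {0..T})" by (intro compact_continuous_image) auto
  then show ?thesis by (intro bounded_imp_bdd_above compact_imp_bounded)
qed

text \<open>The equation is given pointwise in x, with no uniformity of the difference quotients.
  The mean value inequality bounds the normalised remainder \<open>q\<close> by
  \<open>2 * C\<close>, so its limit may be taken under the integral by dominated
  convergence.\<close>

lemma fourier_coeff_derivative:
  fixes u R :: "real \<Rightarrow> real \<Rightarrow> complex"
  assumes der: "\<And>t x. t \<in> S \<Longrightarrow> ((\<lambda>s. u s x) has_vector_derivative R t x) (at t within S)"
    and S: "convex S" and bound: "\<And>t x. t \<in> S \<Longrightarrow> norm (R t x) \<le> C"
    and u: "\<And>t. t \<in> S \<Longrightarrow> integrable torus (u t)" and R: "\<And>t. t \<in> S \<Longrightarrow> R t \<in> borel_measurable torus"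
    and t: "t \<in> S"
  shows "((\<lambda>s. fourier_coeff (u s) k) has_vector_derivative fourier_coeff (R t) k) (at t within S)"
proof -
  have C0: "0 \<le> C" using bound[OF t, of 0] norm_ge_zero order_trans by blast
  have Ri: "integrable torus (R t)" by (rule integrable_torus_mult[of "\<lambda>_. 1" "R t" C, simplified]) (use R bound t finite_measure_torus in \<open>auto simp: finite_measure.integrable_const\<close>)
  define q where "q y x = (1 / norm (y - t)) *\<^sub>R (u y x - (u t x + (y - t) *\<^sub>R R t x))" for y x
  have lip: "norm (u y x - u t x) \<le> C * norm (y - t)" if "y \<in> S" for y x
  proof (rule differentiable_bound[OF S, of "\<lambda>s. u s x" "\<lambda>s h. h *\<^sub>R R s x"])
    fix s assume s: "s \<in> S"
    show "((\<lambda>s. u s x) has_derivative (\<lambda>h. h *\<^sub>R R s x)) (at s within S)"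
      using der[OF s] by (simp add: has_vector_derivative_def)
    show "onorm (\<lambda>h. h *\<^sub>R R s x) \<le> C"
      using bound[OF s, of x] by (intro onorm_le) (auto simp: mult.commute[of _ "norm (R s x)"] intro: mult_right_mono)
  qed (use that t in auto)
  have qb: "norm (q y x) \<le> 2 * C" if y: "y \<in> S" "y \<noteq> t" for y x
  proof -
    have "norm (u y x - (u t x + (y - t) *\<^sub>R R t x)) \<le> norm (u y x - u t x) + norm ((y - t) *\<^sub>R R t x)"
      using norm_triangle_ineq4[of "u y x - u t x" "(y - t) *\<^sub>R R t x"] by (simp add: algebra_simps)
    also have "\<dots> \<le> C * norm (y - t) + norm (y - t) * C"
      using lip[OF y(1)] bound[OF t] by (intro add_mono) (auto intro: mult_left_mono)
    finally have *: "norm (u y x - (u t x + (y - t) *\<^sub>R R t x)) \<le> 2 * C * norm (y - t)" by simp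
    have "norm (q y x) = norm (u y x - (u t x + (y - t) *\<^sub>R R t x)) / norm (y - t)"
      unfolding q_def norm_scaleR by simp
    also have "\<dots> \<le> 2 * C" using * y(2) by (subst pos_divide_le_eq) auto
    finally show ?thesis .
  qed
  have q0: "((\<lambda>y. q y x) \<longlongrightarrow> 0) (at t within S)" for x
    using der[OF t, of x] unfolding has_vector_derivative_def has_derivative_within q_def by simp
  have um: "u y \<in> borel_measurable torus" if "y \<in> S" for y using u[OF that] by auto
  have cm: "(\<lambda>x. cis (- (of_int k * x))) \<in> borel_measurable torus"
    using cis_measurable[of "- of_int k"] by (intro measurable_torus) simp
  have qm: "(\<lambda>x. q y x * cis (- (of_int k * x))) \<in> borel_measurable torus" if "y \<in> S" for y
    unfolding q_def using um[OF that] um[OF t] R[OF t] cm by measurable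
  have "((\<lambda>y. \<integral>x. q y x * cis (- (of_int k * x)) \<partial>torus) \<longlongrightarrow> 0) (at t within S)"
    unfolding tendsto_at_iff_sequentially
  proof (intro allI impI)
    fix X :: "nat \<Rightarrow> real" assume X: "\<forall>i. X i \<in> S - {t}" "X \<longlonglongrightarrow> t"
    interpret finite_measure torus by (rule finite_measure_torus)
    have "(\<lambda>i. \<integral>x. q (X i) x * cis (- (of_int k * x)) \<partial>torus) \<longlonglongrightarrow> (\<integral>x. 0 \<partial>torus)"
    proof (rule integral_dominated_convergence[where w = "\<lambda>_. 2 * C"])
      show "(\<lambda>x. q (X i) x * cis (- (of_int k * x))) \<in> borel_measurable torus" for i using X(1) by (intro qm) auto
      have "(\<lambda>i. q (X i) x) \<longlonglongrightarrow> 0" for x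
        using q0[of x] X unfolding tendsto_at_iff_sequentially o_def by blast
      then show "AE x in torus. (\<lambda>i. q (X i) x * cis (- (of_int k * x))) \<longlonglongrightarrow> 0"
        by (intro AE_I2 tendsto_mult_left_zero)
      show "AE x in torus. norm (q (X i) x * cis (- (of_int k * x))) \<le> 2 * C" for i
        using qb[of "X i"] X(1) by (simp add: norm_mult)
    qed auto
    then show "((\<lambda>y. \<integral>x. q y x * cis (- (of_int k * x)) \<partial>torus) \<circ> X) \<longlonglongrightarrow> 0" by (simp add: o_def)
  qed
  then have "((\<lambda>y. (\<integral>x. q y x * cis (- (of_int k * x)) \<partial>torus) / of_real (2 * pi)) \<longlongrightarrow> 0) (at t within S)"
    by (rule tendsto_divide_zero)
  moreover have "\<forall>\<^sub>F y in at t within S. (\<integral>x. q y x * cis (- (of_int k * x)) \<partial>torus) / of_real (2 * pi)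
     = (1 / norm (y - t)) *\<^sub>R (fourier_coeff (u y) k - (fourier_coeff (u t) k + (y - t) *\<^sub>R fourier_coeff (R t) k))"
    unfolding eventually_at_filter
  proof (intro always_eventually allI impI)
    fix y assume "y \<in> S"
    note i = integrable_torus_cis'[OF u[OF this], of "of_int k"] integrable_torus_cis'[OF u[OF t], of "of_int k"] integrable_torus_cis'[OF Ri, of "of_int k"]
    have "(\<integral>x. q y x * cis (- (of_int k * x)) \<partial>torus) = (\<integral>x. (1 / norm (y - t)) *\<^sub>R (u y x * cis (- (of_int k * x))
      - (u t x * cis (- (of_int k * x)) + (y - t) *\<^sub>R (R t x * cis (- (of_int k * x))))) \<partial>torus)"
      by (intro Bochner_Integration.integral_cong) (auto simp: q_def scaleR_conv_of_real algebra_simps)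
    also have "\<dots> = (1 / norm (y - t)) *\<^sub>R ((\<integral>x. u y x * cis (- (of_int k * x)) \<partial>torus)
      - ((\<integral>x. u t x * cis (- (of_int k * x)) \<partial>torus) + (y - t) *\<^sub>R (\<integral>x. R t x * cis (- (of_int k * x)) \<partial>torus)))"
      using i by simp
    finally have *: "(\<integral>x. q y x * cis (- (of_int k * x)) \<partial>torus) = (1 / norm (y - t)) *\<^sub>R ((\<integral>x. u y x * cis (- (of_int k * x)) \<partial>torus)
      - ((\<integral>x. u t x * cis (- (of_int k * x)) \<partial>torus) + (y - t) *\<^sub>R (\<integral>x. R t x * cis (- (of_int k * x)) \<partial>torus)))" .
    have alg: "(n *\<^sub>R (a - (b + w *\<^sub>R d))) / c = n *\<^sub>R (a / c - (b / c + w *\<^sub>R (d / c)))" for a b c d :: complex and n w :: real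
      by (simp add: scaleR_conv_of_real diff_divide_distrib[symmetric] add_divide_distrib[symmetric])
    show "(\<integral>x. q y x * cis (- (of_int k * x)) \<partial>torus) / of_real (2 * pi)
     = (1 / norm (y - t)) *\<^sub>R (fourier_coeff (u y) k - (fourier_coeff (u t) k + (y - t) *\<^sub>R fourier_coeff (R t) k))"
      unfolding * fourier_coeff_torus alg ..
  qed
  ultimately have "((\<lambda>y. (1 / norm (y - t)) *\<^sub>R (fourier_coeff (u y) k - (fourier_coeff (u t) k + (y - t) *\<^sub>R fourier_coeff (R t) k))) \<longlongrightarrow> 0) (at t within S)"
    by (rule Lim_transform_eventually)
  then show ?thesis unfolding has_vector_derivative_def has_derivative_within by (simp add: bounded_linear_scaleR_left)
qed

section \<open>The space of square-summable sequences\<close>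

typedef l2 = "{a :: int \<Rightarrow> complex. \<exists>M. wl2_le 0 M a}" morphisms coord Abs_l2
  by (auto intro: wl2_le_zero)

setup_lifting type_definition_l2

lemma l2_eqI: "(\<And>k. coord x k = coord y k) \<Longrightarrow> x = y"
  by (metis coord_inject ext)

instantiation l2 :: real_vector
begin
lift_definition zero_l2 :: l2 is "\<lambda>k. 0" by (auto intro: wl2_le_zero)
lift_definition plus_l2 :: "l2 \<Rightarrow> l2 \<Rightarrow> l2" is "\<lambda>a b k. a k + b k" by (auto dest: wl2_le_add)
lift_definition uminus_l2 :: "l2 \<Rightarrow> l2" is "\<lambda>a k. - a k" using wl2_le_scale[of 0 _ _ "-1"] by auto
lift_definition minus_l2 :: "l2 \<Rightarrow> l2 \<Rightarrow> l2" is "\<lambda>a b k. a k - b k"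
proof -
  fix a b :: "int \<Rightarrow> complex" assume "\<exists>M. wl2_le 0 M a" "\<exists>M. wl2_le 0 M b"
  then obtain M N where "wl2_le 0 M a" "wl2_le 0 N b" by blast
  with wl2_le_scale[of 0 N b "-1"] have "wl2_le 0 (M + N) (\<lambda>k. a k + -1 * b k)" by (intro wl2_le_add) auto
  then show "\<exists>M. wl2_le 0 M (\<lambda>k. a k - b k)" by auto
qed
lift_definition scaleR_l2 :: "real \<Rightarrow> l2 \<Rightarrow> l2" is "\<lambda>c a k. of_real c * a k"
  using wl2_le_scale by blast
instance
  by standard (transfer; auto simp: fun_eq_iff algebra_simps; fail)+
end

lemma coord_simps [simp]:
  "coord 0 k = 0" "coord (x + y) k = coord x k + coord y k" "coord (x - y) k = coord x k - coord y k"
  "coord (- x) k = - coord x k" "coord (c *\<^sub>R x) k = of_real c * coord x k"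
  by (transfer; simp)+

lemma coord_fun:
  "coord 0 = (\<lambda>k. 0)" "coord (x + y) = (\<lambda>k. coord x k + coord y k)" "coord (c *\<^sub>R x) = (\<lambda>k. of_real c * coord x k)"
  by (simp_all add: fun_eq_iff)

definition Hs_le :: "real \<Rightarrow> real \<Rightarrow> l2 \<Rightarrow> bool" where "Hs_le s M x \<longleftrightarrow> wl2_le s M (coord x)"

lemma Hs_le_exists: "\<exists>M. Hs_le 0 M x" using coord[of x] by (auto simp: Hs_le_def)

lemma coord_Abs: "wl2_le s M a \<Longrightarrow> 0 \<le> s \<Longrightarrow> coord (Abs_l2 a) = a"
  by (rule Abs_l2_inverse) (auto intro: wl2_le_mono)

lemma Hs_le_nonneg: "Hs_le s M x \<Longrightarrow> 0 \<le> M" by (auto simp: Hs_le_def wl2_le_nonneg)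
lemma Hs_le_mono: "Hs_le s M x \<Longrightarrow> s' \<le> s \<Longrightarrow> M \<le> M' \<Longrightarrow> Hs_le s' M' x" by (auto simp: Hs_le_def intro: wl2_le_mono)
lemma Hs_le_zero: "0 \<le> M \<Longrightarrow> Hs_le s M 0" by (simp add: Hs_le_def coord_fun wl2_le_zero)
lemma Hs_le_add: "Hs_le s M x \<Longrightarrow> Hs_le s N y \<Longrightarrow> Hs_le s (M + N) (x + y)"
  unfolding Hs_le_def using wl2_le_add[of s M "coord x" N "coord y"] by (simp add: coord_fun)
lemma Hs_le_scaleR: "Hs_le s M x \<Longrightarrow> Hs_le s (\<bar>c\<bar> * M) (c *\<^sub>R x)"
  unfolding Hs_le_def using wl2_le_scale[of s M "coord x" "of_real c"] by (simp add: coord_fun)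
lemma Hs_le_minus: "Hs_le s M x \<Longrightarrow> Hs_le s M (- x)"
  using Hs_le_scaleR[of s M x "-1"] by simp
definition Bil :: "(int \<Rightarrow> int \<Rightarrow> complex) \<Rightarrow> l2 \<Rightarrow> l2 \<Rightarrow> l2" where
  "Bil p x y = Abs_l2 (kernel_sum p (coord x) (coord y))"

text \<open>Kernels with which \<open>Bil\<close> maps \<open>H\<^sup>\<alpha>\<close> to \<open>H\<^sup>0\<close>; otherwise \<open>Bil\<close> may be junk.\<close>
definition admissible :: "real \<Rightarrow> (int \<Rightarrow> int \<Rightarrow> complex) \<Rightarrow> bool" where
  "admissible \<alpha> p \<longleftrightarrow> (\<exists>c\<ge>0. \<forall>k j. norm (p k j) \<le> c * (weight k powr -1 * (weight j powr \<alpha> * weight (k - j) powr \<alpha>)))"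

lemma admissible_Bil:
  assumes "admissible \<alpha> p" "Hs_le \<alpha> M x" "Hs_le \<alpha> N y"
  shows "(\<lambda>j. p k j * coord x j * coord y (k - j)) abs_summable_on UNIV"
    and "(\<lambda>j. p k j * coord x j * coord y (k - j)) summable_on UNIV"
    and "coord (Bil p x y) = kernel_sum p (coord x) (coord y)"
proof -
  obtain c where c: "c \<ge> 0" "\<And>k j. norm (p k j) \<le> c * (weight k powr -1 * (weight j powr \<alpha> * weight (k - j) powr \<alpha>))"
    using assms(1) unfolding admissible_def by blast
  have *: "norm (p k j) * weight k powr 0 \<le> c * (weight k powr -1 * (weight j powr \<alpha> * weight (k - j) powr \<alpha>))" for k j
    using c(2)[of k j] by simp
  note ** = kernel_sum_wl2_le[of p 0, OF * assms(2,3)[unfolded Hs_le_def] c(1)]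
  show "(\<lambda>j. p k j * coord x j * coord y (k - j)) abs_summable_on UNIV" by (rule **(1))
  then show "(\<lambda>j. p k j * coord x j * coord y (k - j)) summable_on UNIV" by (rule abs_summable_summable)
  show "coord (Bil p x y) = kernel_sum p (coord x) (coord y)"
    unfolding Bil_def by (rule coord_Abs[OF **(2)]) simp
qed

lemma Hs_le_Bil:
  assumes "\<And>k j. norm (p k j) * weight k powr \<rho> \<le> c * (weight k powr -1 * (weight j powr \<alpha> * weight (k - j) powr \<alpha>))"
    and "Hs_le \<alpha> M x" "Hs_le \<alpha> N y" "0 \<le> c" "0 \<le> \<rho>"
  shows "Hs_le \<rho> (2 * c * (M * N)) (Bil p x y)"
  using kernel_sum_wl2_le(2)[OF assms(1) assms(2,3)[unfolded Hs_le_def] assms(4)] assms(5)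
  by (simp add: Hs_le_def Bil_def coord_Abs)

lemma admissible_add: "admissible \<alpha> p \<Longrightarrow> admissible \<alpha> q \<Longrightarrow> admissible \<alpha> (\<lambda>k j. p k j + q k j)"
  unfolding admissible_def
proof (elim exE conjE)
  fix c d assume c: "0 \<le> c" "\<forall>k j. norm (p k j) \<le> c * (weight k powr -1 * (weight j powr \<alpha> * weight (k - j) powr \<alpha>))"
    and d: "0 \<le> d" "\<forall>k j. norm (q k j) \<le> d * (weight k powr -1 * (weight j powr \<alpha> * weight (k - j) powr \<alpha>))"
  show "\<exists>c\<ge>0. \<forall>k j. norm (p k j + q k j) \<le> c * (weight k powr -1 * (weight j powr \<alpha> * weight (k - j) powr \<alpha>))"
  proof (intro exI[of _ "c + d"] conjI allI)
    fix k j
    show "norm (p k j + q k j) \<le> (c + d) * (weight k powr -1 * (weight j powr \<alpha> * weight (k - j) powr \<alpha>))"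
      using norm_triangle_ineq[of "p k j" "q k j"] c(2)[rule_format, of k j] d(2)[rule_format, of k j]
      unfolding distrib_right[of c d] by linarith
  qed (use c d in simp)
qed

lemma admissible_scale: "admissible \<alpha> p \<Longrightarrow> admissible \<alpha> (\<lambda>k j. c * p k j)"
  unfolding admissible_def
proof (elim exE conjE)
  fix d assume d: "0 \<le> d" "\<forall>k j. norm (p k j) \<le> d * (weight k powr -1 * (weight j powr \<alpha> * weight (k - j) powr \<alpha>))"
  then show "\<exists>e\<ge>0. \<forall>k j. norm (c * p k j) \<le> e * (weight k powr -1 * (weight j powr \<alpha> * weight (k - j) powr \<alpha>))"
    by (intro exI[of _ "norm c * d"] conjI allI) (auto simp only: norm_mult mult.assoc intro!: mult_left_mono mult_nonneg_nonneg norm_ge_zero)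
qed

lemma Bil_add_kernel:
  assumes "admissible \<alpha> p" "admissible \<alpha> q" "Hs_le \<alpha> M x" "Hs_le \<alpha> N y"
  shows "Bil (\<lambda>k j. p k j + q k j) x y = Bil p x y + Bil q x y"
proof (rule l2_eqI)
  fix k show "coord (Bil (\<lambda>k j. p k j + q k j) x y) k = coord (Bil p x y + Bil q x y) k"
    using admissible_Bil(3)[OF admissible_add[OF assms(1,2)] assms(3,4)] admissible_Bil(2,3)[OF assms(1,3,4)] admissible_Bil(2,3)[OF assms(2,3,4)]
    by (simp add: kernel_sum_def infsum_add[symmetric] algebra_simps)
qed

lemma Bil_scale_kernel:
  assumes "admissible \<alpha> p" "Hs_le \<alpha> M x" "Hs_le \<alpha> N y"
  shows "Bil (\<lambda>k j. of_real c * p k j) x y = c *\<^sub>R Bil p x y"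
proof (rule l2_eqI)
  fix k show "coord (Bil (\<lambda>k j. of_real c * p k j) x y) k = coord (c *\<^sub>R Bil p x y) k"
    using admissible_Bil(3)[OF admissible_scale[OF assms(1)] assms(2,3), of "of_real c"] admissible_Bil(2,3)[OF assms]
    by (simp add: kernel_sum_def infsum_cmult_right[symmetric] mult.assoc)
qed

lemma Bil_add_left:
  assumes p: "admissible 0 p" shows "Bil p (x + y) z = Bil p x z + Bil p y z"
proof (rule l2_eqI)
  fix k
  obtain A B C D where Hs_le: "Hs_le 0 A x" "Hs_le 0 B y" "Hs_le 0 C z" "Hs_le 0 D (x + y)" using Hs_le_exists by meson
  show "coord (Bil p (x + y) z) k = coord (Bil p x z + Bil p y z) k"
    using admissible_Bil(3)[OF p Hs_le(4,3)] admissible_Bil(2,3)[OF p Hs_le(1,3)] admissible_Bil(2,3)[OF p Hs_le(2,3)]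
    by (simp add: kernel_sum_def infsum_add[symmetric] algebra_simps)
qed

lemma Bil_scaleR_left:
  assumes p: "admissible 0 p" shows "Bil p (c *\<^sub>R x) z = c *\<^sub>R Bil p x z"
proof (rule l2_eqI)
  fix k
  obtain A C D where Hs_le: "Hs_le 0 A x" "Hs_le 0 C z" "Hs_le 0 D (c *\<^sub>R x)" using Hs_le_exists by meson
  show "coord (Bil p (c *\<^sub>R x) z) k = coord (c *\<^sub>R Bil p x z) k"
    using admissible_Bil(3)[OF p Hs_le(3,2)] admissible_Bil(2,3)[OF p Hs_le(1,2)]
    by (simp add: kernel_sum_def infsum_cmult_right[symmetric] mult_ac)
qed

lemma Bil_sym:
  assumes "\<And>k j. p k (k - j) = p k j" shows "Bil p x y = Bil p y x"
  unfolding Bil_def using kernel_sum_flip[of p "coord x" "coord y"] assms by (simp add: kernel_sum_def)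

section \<open>The twisted bilinear form\<close>

lemma Bil_axpy_kernel:
  assumes "admissible \<alpha> p" "admissible \<alpha> q" "Hs_le \<alpha> M x" "Hs_le \<alpha> N y"
  shows "Bil (\<lambda>k j. p k j + of_real c * q k j) x y = Bil p x y + c *\<^sub>R Bil q x y"
  using Bil_add_kernel[OF assms(1) admissible_scale[OF assms(2)] assms(3,4), of "of_real c"]
    Bil_scale_kernel[OF assms(2-4), of c] by simp

section \<open>Size of the symbols\<close>

definition eL_symbol :: "real \<Rightarrow> int \<Rightarrow> complex" where
  "eL_symbol \<epsilon> k = of_real \<epsilon> * (\<i> * of_int k / (1 + of_real \<epsilon> * (of_int k)\<^sup>2))"

lemma norm_eL_symbol: "0 < \<epsilon> \<Longrightarrow> norm (eL_symbol \<epsilon> k) = \<epsilon> * \<bar>of_int k\<bar> / (1 + \<epsilon> * (of_int k)\<^sup>2)"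
proof -
  assume e: "0 < \<epsilon>"
  have "(1 + of_real \<epsilon> * (of_int k)\<^sup>2 :: complex) = of_real (1 + \<epsilon> * (of_int k)\<^sup>2)" by simp
  moreover have "0 < 1 + \<epsilon> * (of_int k)\<^sup>2" using e by (simp add: add_pos_nonneg)
  ultimately show ?thesis using e unfolding eL_symbol_def by (simp add: norm_mult norm_divide del: of_real_add of_real_mult)
qed

lemma int_abs_ge1: "k \<noteq> 0 \<Longrightarrow> 1 \<le> \<bar>of_int k :: real\<bar>"
  by (metis of_int_1_le_iff of_int_abs int_one_le_iff_zero_less zero_less_abs_iff)

text \<open>A nonzero integer satisfies \<bar>k\<bar> \<le> k^2, hence \<epsilon> \<bar>k\<bar> (1 +
  \<bar>k\<bar>) \<le> 2 (1 + \<epsilon> k^2); the constant 2 does not see \<epsilon>.\<close>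

lemma eL_symbol_bound: assumes e: "0 < \<epsilon>" shows "norm (eL_symbol \<epsilon> k) \<le> 2 * weight k powr -1"
proof (cases "k = 0")
  case False
  define a where "a = \<bar>of_int k :: real\<bar>"
  have a: "1 \<le> a" using int_abs_ge1[OF False] by (simp add: a_def)
  have "a \<le> a\<^sup>2" using a by (simp add: power2_eq_square)
  then have "\<epsilon> * a \<le> \<epsilon> * a\<^sup>2" using e by simp
  then have "\<epsilon> * a * (1 + a) \<le> 2 * (1 + \<epsilon> * a\<^sup>2)" by (simp add: algebra_simps power2_eq_square)
  moreover have "0 < 1 + \<epsilon> * a\<^sup>2" using e by (simp add: add_pos_nonneg)
  ultimately have "\<epsilon> * a / (1 + \<epsilon> * a\<^sup>2) \<le> 2 / (1 + a)" using a by (simp add: field_simps)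
  then show ?thesis using norm_eL_symbol[OF e, of k] by (simp add: a_def weight_def powr_minus divide_inverse)
qed (simp add: eL_symbol_def)

text \<open>Interpolation in the denominator: \<open>(\<epsilon> * a\<^sup>2) powr \<sigma>\<close>
  is at most \<open>1 + \<epsilon> * a\<^sup>2\<close> for \<sigma> between 0 and 1. The factor 2
  comes from replacing \<bar>k\<bar> by the weight.\<close>

lemma eL_symbol_bound_smoothing:
  assumes e: "0 < \<epsilon>" and s: "0 \<le> \<sigma>" "\<sigma> \<le> 1"
  shows "norm (eL_symbol \<epsilon> k) \<le> 2 * \<epsilon> powr (1 - \<sigma>) * weight k powr (1 - 2 * \<sigma>)"
proof (cases "k = 0")
  case False
  define a where "a = \<bar>of_int k :: real\<bar>"
  have a: "1 \<le> a" using int_abs_ge1[OF False] by (simp add: a_def)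
  have ea: "0 < \<epsilon> * a\<^sup>2" using e a by (simp add: zero_less_mult_iff)
  have "(\<epsilon> * a\<^sup>2) powr \<sigma> \<le> (1 + \<epsilon> * a\<^sup>2) powr \<sigma>" using ea s by (intro powr_mono2) auto
  also have "\<dots> \<le> (1 + \<epsilon> * a\<^sup>2) powr 1" using ea s by (intro powr_mono) auto
  finally have "(\<epsilon> * a\<^sup>2) powr \<sigma> \<le> 1 + \<epsilon> * a\<^sup>2" using ea by simp
  then have "\<epsilon> * a / (1 + \<epsilon> * a\<^sup>2) \<le> \<epsilon> * a / (\<epsilon> * a\<^sup>2) powr \<sigma>"
    using ea e a by (intro divide_left_mono) (auto simp: add_pos_pos mult_pos_pos)
  also have "(\<epsilon> * a\<^sup>2) powr \<sigma> = \<epsilon> powr \<sigma> * a powr (2 * \<sigma>)"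
    using e a by (simp add: powr_mult powr_powr flip: powr_numeral)
  also have "\<epsilon> * a / (\<epsilon> powr \<sigma> * a powr (2 * \<sigma>)) = \<epsilon> powr (1 - \<sigma>) * a powr (1 - 2 * \<sigma>)"
    using e a by (simp add: powr_diff)
  also have "a powr (1 - 2 * \<sigma>) \<le> 2 * (1 + a) powr (1 - 2 * \<sigma>)"
  proof (cases "0 \<le> 1 - 2 * \<sigma>")
    case True
    then have "a powr (1 - 2 * \<sigma>) \<le> (1 + a) powr (1 - 2 * \<sigma>)" using a by (intro powr_mono2) auto
    moreover have "0 \<le> (1 + a) powr (1 - 2 * \<sigma>)" by simp
    ultimately show ?thesis by linarith
  next
    case False
    \<comment> \<open>For a negative exponent a lower bound of \<open>a\<close> is needed, and
      \<open>a \<ge> 1\<close> gives \<open>a \<ge> (1 + a) / 2\<close>.\<close>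
    have "a powr (1 - 2 * \<sigma>) \<le> ((1 + a) / 2) powr (1 - 2 * \<sigma>)"
      using False a by (intro powr_mono2') auto
    also have "\<dots> = (1 + a) powr (1 - 2 * \<sigma>) * 2 powr (2 * \<sigma> - 1)"
      using a powr_minus_divide[of 2 "1 - 2 * \<sigma>"] by (simp add: powr_divide)
    also have "\<dots> \<le> (1 + a) powr (1 - 2 * \<sigma>) * 2 powr 1" using s by (intro mult_left_mono powr_mono) auto
    finally show ?thesis by simp
  qed
  finally have "\<epsilon> * a / (1 + \<epsilon> * a\<^sup>2) \<le> \<epsilon> powr (1 - \<sigma>) * (2 * (1 + a) powr (1 - 2 * \<sigma>))"
    by (simp add: mult_left_mono)
  then show ?thesis using norm_eL_symbol[OF e, of k] by (simp add: a_def weight_def mult_ac)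
qed (simp add: eL_symbol_def)

text \<open>On the imaginary axis the exponential has modulus 1, so the Taylor remainder is bounded
  by a pure power. This matters because time times phase is unbounded over the frequencies.\<close>

lemma norm_exp_remainder:
  assumes "Re z = 0" shows "norm (exp z - (\<Sum>i<n. z ^ i / fact i)) \<le> norm z ^ n"
proof (cases n)
  case 0 then show ?thesis using assms by simp
next
  case (Suc m)
  have "norm (exp z - (\<Sum>i\<le>m. z ^ i / fact i)) \<le> norm z ^ Suc m / fact m"
    using Taylor_exp[of z m] assms by simp
  also have "\<dots> \<le> norm z ^ Suc m / 1" by (intro divide_left_mono) (auto simp: fact_ge_1)
  finally show ?thesis using Suc by (simp add: lessThan_Suc_atMost)
qed

definition phase :: "complex poly \<Rightarrow> real \<Rightarrow> int \<Rightarrow> int \<Rightarrow> complex" where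
  "phase P \<epsilon> k j = L_symbol P \<epsilon> k - L_symbol P \<epsilon> j - L_symbol P \<epsilon> (k - j)"

text \<open>The remainder after n terms of the Taylor series in t of the kernel of the twisted form;
  n = 0 gives the form itself, so a single family of estimates covers the form and all its
  remainders.\<close>

definition phase_kernel :: "complex poly \<Rightarrow> nat \<Rightarrow> real \<Rightarrow> real \<Rightarrow> int \<Rightarrow> int \<Rightarrow> complex" where
  "phase_kernel P n \<epsilon> t k j = eL_symbol \<epsilon> k * (exp (of_real t * phase P \<epsilon> k j) - (\<Sum>i<n. (of_real t * phase P \<epsilon> k j) ^ i / fact i))"

text \<open>The kernel of the n-th time derivative of the twisted form at time 0.\<close>

definition phase_power_kernel :: "complex poly \<Rightarrow> nat \<Rightarrow> real \<Rightarrow> int \<Rightarrow> int \<Rightarrow> complex" where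
  "phase_power_kernel P n \<epsilon> k j = eL_symbol \<epsilon> k * phase P \<epsilon> k j ^ n"

locale bbm =
  fixes P :: "complex poly" and lam :: nat and \<sigma> r :: real
  assumes deg: "degree P = lam" and lam1: "1 \<le> lam"
    and imag: "\<And>x::real. Re (poly P (\<i> * of_real x)) = 0"
    and sig0: "0 \<le> \<sigma>" and sig1: "\<sigma> \<le> 1" and r0: "0 \<le> r"
begin

definition s where "s = r + 1 + 3 * real lam - 2 * \<sigma>"
definition eps_gain where "eps_gain \<epsilon> = \<epsilon> powr (1 - \<sigma>)"

lemma eps_gain_nonneg [simp]: "0 \<le> eps_gain \<epsilon>" by (simp add: eps_gain_def)

lemma eps_gain_le1: "0 < \<epsilon> \<Longrightarrow> \<epsilon> \<le> 1 \<Longrightarrow> eps_gain \<epsilon> \<le> 1"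
  using sig1 powr_mono2[of "1 - \<sigma>" \<epsilon> 1] by (simp add: eps_gain_def)

lemma lam1': "1 \<le> real lam" using lam1 by simp

lemma L_symbol_eq: "L_symbol P \<epsilon> k = poly P (\<i> * of_int k) / of_real (1 + \<epsilon> * (of_int k)\<^sup>2)"
  by (simp add: L_symbol_def)

lemma Re_L_symbol [simp]: "Re (L_symbol P \<epsilon> k) = 0"
  unfolding L_symbol_eq Re_divide_of_real using imag[of "of_int k"] by simp

lemma Re_phase [simp]: "Re (phase P \<epsilon> k j) = 0" by (simp add: phase_def)

lemma L_symbol_bound: "\<exists>C\<ge>0. \<forall>\<epsilon> k. 0 < \<epsilon> \<longrightarrow> norm (L_symbol P \<epsilon> k) \<le> C * weight k powr real lam"
proof (intro exI[of _ "\<Sum>i\<le>lam. norm (coeff P i)"] conjI allI impI)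
  fix \<epsilon> :: real and k :: int assume e: "0 < \<epsilon>"
  have "norm (L_symbol P \<epsilon> k) \<le> norm (poly P (\<i> * of_int k))"
  proof -
    have 1: "1 \<le> 1 + \<epsilon> * (of_int k)\<^sup>2" using e by simp
    have "norm (L_symbol P \<epsilon> k) = norm (poly P (\<i> * of_int k)) / (1 + \<epsilon> * (of_int k)\<^sup>2)"
      unfolding L_symbol_eq norm_divide norm_of_real using 1 by simp
    also have "\<dots> \<le> norm (poly P (\<i> * of_int k)) / 1" using 1 by (intro divide_left_mono) auto
    finally show ?thesis by simp
  qed
  also have "\<dots> \<le> (\<Sum>i\<le>lam. norm (coeff P i) * norm (\<i> * of_int k :: complex) ^ i)"
    unfolding poly_altdef deg by (intro order_trans[OF norm_sum]) (simp add: norm_mult norm_power)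
  also have "\<dots> \<le> (\<Sum>i\<le>lam. norm (coeff P i) * weight k powr real lam)"
  proof (intro sum_mono mult_left_mono)
    fix i assume "i \<in> {..lam}"
    have "norm (\<i> * of_int k :: complex) ^ i \<le> weight k ^ i" by (intro power_mono) (auto simp: norm_mult weight_def)
    also have "\<dots> \<le> weight k ^ lam" using \<open>i \<in> _\<close> by (intro power_increasing) auto
    finally show "norm (\<i> * of_int k :: complex) ^ i \<le> weight k powr real lam" by (simp add: powr_realpow)
  qed auto
  finally show "norm (L_symbol P \<epsilon> k) \<le> (\<Sum>i\<le>lam. norm (coeff P i)) * weight k powr real lam"
    by (simp add: sum_distrib_right)
qed (simp add: sum_nonneg)

lemma powr_le_prod: "0 \<le> a \<Longrightarrow> weight k powr a \<le> weight j powr a * weight (k - j) powr a"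
  using powr_mono2[OF _ _ weight_split[of k j], of a] by (simp add: powr_mult)

lemma phase_bound: "\<exists>C\<ge>0. \<forall>\<epsilon> k j. 0 < \<epsilon> \<longrightarrow> norm (phase P \<epsilon> k j) \<le> C * (weight j powr real lam * weight (k - j) powr real lam)"
proof -
  obtain C where C: "0 \<le> C" "\<And>\<epsilon> k. 0 < \<epsilon> \<Longrightarrow> norm (L_symbol P \<epsilon> k) \<le> C * weight k powr real lam"
    using L_symbol_bound by blast
  show ?thesis
  proof (intro exI[of _ "3 * C"] conjI allI impI)
    fix \<epsilon> :: real and k j assume e: "0 < \<epsilon>"
    define X where "X = weight j powr real lam * weight (k - j) powr real lam"
    have g1: "1 \<le> weight i powr real lam" for i by (intro ge_one_powr_ge_zero) auto
    have "weight k powr real lam \<le> X" unfolding X_def by (rule powr_le_prod) simp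
    moreover have "weight j powr real lam \<le> X" unfolding X_def using mult_left_mono[OF g1[of "k - j"], of "weight j powr real lam"] by simp
    moreover have "weight (k - j) powr real lam \<le> X" unfolding X_def using mult_right_mono[OF g1[of j], of "weight (k - j) powr real lam"] by simp
    ultimately have "C * weight k powr real lam + C * weight j powr real lam + C * weight (k - j) powr real lam \<le> C * X + C * X + C * X"
      using C(1) by (intro add_mono mult_left_mono) auto
    then have "norm (L_symbol P \<epsilon> k) + norm (L_symbol P \<epsilon> j) + norm (L_symbol P \<epsilon> (k - j)) \<le> 3 * C * X"
      using C(2)[OF e, of k] C(2)[OF e, of j] C(2)[OF e, of "k - j"] by simp
    moreover have "norm (phase P \<epsilon> k j) \<le> norm (L_symbol P \<epsilon> k) + norm (L_symbol P \<epsilon> j) + norm (L_symbol P \<epsilon> (k - j))"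
      unfolding phase_def by (intro order_trans[OF norm_triangle_ineq4] add_mono) (auto intro: norm_triangle_ineq4)
    ultimately show "norm (phase P \<epsilon> k j) \<le> 3 * C * (weight j powr real lam * weight (k - j) powr real lam)"
      by (simp add: X_def)
  qed (use C in simp)
qed

text \<open>Unlike the product bound, this one charges the whole cost of a phase to the higher of
  the two input frequencies. The product bound would charge both factors, which is too expensive
  when three phases occur.\<close>

lemma phase_bound_max: "\<exists>C\<ge>0. \<forall>\<epsilon> k j. 0 < \<epsilon> \<longrightarrow> norm (phase P \<epsilon> k j) \<le> C * max (weight j) (weight (k - j)) powr real lam"
proof -
  obtain C where C: "0 \<le> C" "\<And>\<epsilon> k. 0 < \<epsilon> \<Longrightarrow> norm (L_symbol P \<epsilon> k) \<le> C * weight k powr real lam"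
    using L_symbol_bound by blast
  show ?thesis
  proof (intro exI[of _ "C * (2 powr real lam + 2)"] conjI allI impI)
    fix \<epsilon> :: real and k j assume e: "0 < \<epsilon>"
    define X where "X = max (weight j) (weight (k - j)) powr real lam"
    have "weight k powr real lam \<le> 2 powr real lam * X" unfolding X_def by (rule weight_max_pow) simp
    moreover have "weight j powr real lam \<le> X" unfolding X_def by (intro powr_mono2) auto
    moreover have "weight (k - j) powr real lam \<le> X" unfolding X_def by (intro powr_mono2) auto
    ultimately have "C * weight k powr real lam + C * weight j powr real lam + C * weight (k - j) powr real lam \<le> C * (2 powr real lam * X) + C * X + C * X"
      using C(1) by (intro add_mono mult_left_mono) auto
    then have "norm (L_symbol P \<epsilon> k) + norm (L_symbol P \<epsilon> j) + norm (L_symbol P \<epsilon> (k - j)) \<le> C * (2 powr real lam + 2) * X"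
      using C(2)[OF e, of k] C(2)[OF e, of j] C(2)[OF e, of "k - j"] by (simp add: algebra_simps)
    moreover have "norm (phase P \<epsilon> k j) \<le> norm (L_symbol P \<epsilon> k) + norm (L_symbol P \<epsilon> j) + norm (L_symbol P \<epsilon> (k - j))"
      unfolding phase_def by (intro order_trans[OF norm_triangle_ineq4] add_mono) (auto intro: norm_triangle_ineq4)
    ultimately show "norm (phase P \<epsilon> k j) \<le> C * (2 powr real lam + 2) * max (weight j) (weight (k - j)) powr real lam"
      by (simp add: X_def)
  qed (use C in simp)
qed

text \<open>Fixed by choice so that it can occur in later bounds; the quantifiers put it before
  \<epsilon>, hence it depends on the polynomial only.\<close>

definition C1 where "C1 = (SOME C. 0 \<le> C \<and> (\<forall>\<epsilon> k j. 0 < \<epsilon> \<longrightarrow> norm (phase P \<epsilon> k j) \<le> C * (weight j powr real lam * weight (k - j) powr real lam)))"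

lemma C1: "0 \<le> C1" "0 < \<epsilon> \<Longrightarrow> norm (phase P \<epsilon> k j) \<le> C1 * (weight j powr real lam * weight (k - j) powr real lam)"
  using someI_ex[OF phase_bound[folded conj_assoc]] unfolding C1_def by auto

lemma phase_pow_bound:
  assumes "0 < \<epsilon>"
  shows "norm (phase P \<epsilon> k j) ^ n \<le> C1 ^ n * (weight j powr (real n * real lam) * weight (k - j) powr (real n * real lam))"
proof -
  have "norm (phase P \<epsilon> k j) ^ n \<le> (C1 * (weight j powr real lam * weight (k - j) powr real lam)) ^ n"
    using C1(2)[OF assms] by (intro power_mono) auto
  then show ?thesis by (simp add: power_mult_distrib powr_power mult.commute)
qed

lemma phase_kernel_bound: "norm (phase_kernel P n \<epsilon> t k j) \<le> norm (eL_symbol \<epsilon> k) * (\<bar>t\<bar> ^ n * norm (phase P \<epsilon> k j) ^ n)"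
proof -
  have "norm (exp (of_real t * phase P \<epsilon> k j) - (\<Sum>i<n. (of_real t * phase P \<epsilon> k j) ^ i / fact i)) \<le> norm (of_real t * phase P \<epsilon> k j) ^ n"
    by (rule norm_exp_remainder) simp
  then show ?thesis unfolding phase_kernel_def norm_mult by (intro mult_left_mono) (auto simp: norm_mult power_mult_distrib)
qed

text \<open>Stability version: the decay of the symbol is kept entirely for the summation over k, so
  no power of \<epsilon> is gained. The n phases and the \<rho> output derivatives are put on both
  factors.\<close>

lemma kernel_T:
  assumes "0 < \<epsilon>" "0 \<le> \<rho>" "norm q \<le> norm (eL_symbol \<epsilon> k) * (T * norm (phase P \<epsilon> k j) ^ n)" "0 \<le> T"
  shows "norm q * weight k powr \<rho> \<le> (2 * C1 ^ n * T) *
    (weight k powr -1 * (weight j powr (\<rho> + real n * real lam) * weight (k - j) powr (\<rho> + real n * real lam)))"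
proof -
  have "norm q \<le> (2 * weight k powr -1) * (T * (C1 ^ n * (weight j powr (real n * real lam) * weight (k - j) powr (real n * real lam))))"
    using assms C1(1) phase_pow_bound[OF assms(1)] eL_symbol_bound[OF assms(1)]
    by (intro order_trans[OF assms(3)] mult_mono) auto
  then have "norm q * weight k powr \<rho> \<le> (2 * weight k powr -1) * (T * (C1 ^ n * (weight j powr (real n * real lam) * weight (k - j) powr (real n * real lam)))) * (weight j powr \<rho> * weight (k - j) powr \<rho>)"
    using assms C1(1) powr_le_prod[OF assms(2)] by (intro mult_mono) (auto intro!: mult_nonneg_nonneg zero_le_power)
  then show ?thesis by (simp add: powr_add mult_ac)
qed

text \<open>Consistency version: the symbol is spent on \<open>eps_gain\<close>, which leaves the
  growth exponent \<open>1 - 2 * \<sigma>\<close>. The decay \<open>weight k powr -1\<close> is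
  bought with the margin \<open>lam \<ge> 1\<close> contained in
  \<open>s - 2 * lam = (r + 1 - 2 * \<sigma>) + lam\<close>. Up to two phases fit into H^s in this
  way; a third would overshoot by \<open>lam\<close>.\<close>

lemma kernel_K:
  assumes "0 < \<epsilon>" "norm q \<le> norm (eL_symbol \<epsilon> k) * (T * norm (phase P \<epsilon> k j) ^ n)" "0 \<le> T"
  shows "norm q * weight k powr r \<le> (2 * eps_gain \<epsilon> * C1 ^ n * T) *
    (weight k powr -1 * (weight j powr (s - 2 * real lam + real n * real lam) * weight (k - j) powr (s - 2 * real lam + real n * real lam)))"
proof -
  define \<mu> where "\<mu> = r + 1 - 2 * \<sigma> + real lam"
  have \<mu>: "0 \<le> \<mu>" "\<mu> = s - 2 * real lam" using r0 sig1 lam1' by (auto simp: \<mu>_def s_def)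
  have mkb: "norm (eL_symbol \<epsilon> k) \<le> 2 * eps_gain \<epsilon> * weight k powr (1 - 2 * \<sigma>)"
    using eL_symbol_bound_smoothing[OF assms(1) sig0 sig1] by (simp add: eps_gain_def)
  have "norm q \<le> (2 * eps_gain \<epsilon> * weight k powr (1 - 2 * \<sigma>)) * (T * (C1 ^ n * (weight j powr (real n * real lam) * weight (k - j) powr (real n * real lam))))"
    using assms C1(1) phase_pow_bound[OF assms(1)] mkb
    by (intro order_trans[OF assms(2)] mult_mono) auto
  then have "norm q * weight k powr r \<le> (2 * eps_gain \<epsilon> * weight k powr (1 - 2 * \<sigma>)) * (T * (C1 ^ n * (weight j powr (real n * real lam) * weight (k - j) powr (real n * real lam)))) * weight k powr r"
    by (intro mult_right_mono) auto
  also have "\<dots> = (2 * eps_gain \<epsilon> * T * C1 ^ n) * (weight j powr (real n * real lam) * weight (k - j) powr (real n * real lam)) * weight k powr (r + 1 - 2 * \<sigma>)"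
  proof -
    have X: "weight k powr (r + 1 - 2 * \<sigma>) = weight k powr (1 - 2 * \<sigma>) * weight k powr r" by (simp add: algebra_simps flip: powr_add)
    show ?thesis unfolding X by (simp only: mult_ac)
  qed
  also have "\<dots> \<le> (2 * eps_gain \<epsilon> * T * C1 ^ n) * (weight j powr (real n * real lam) * weight (k - j) powr (real n * real lam)) * (weight k powr -1 * (weight j powr \<mu> * weight (k - j) powr \<mu>))"
  proof (rule mult_left_mono)
    have "weight k powr (r + 1 - 2 * \<sigma>) \<le> weight k powr (-1 + \<mu>)" using lam1' by (intro powr_mono) (auto simp: \<mu>_def)
    also have "\<dots> = weight k powr -1 * weight k powr \<mu>" by (rule powr_add)
    also have "\<dots> \<le> weight k powr -1 * (weight j powr \<mu> * weight (k - j) powr \<mu>)" using powr_le_prod[OF \<mu>(1)] by (intro mult_left_mono) auto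
    finally show "weight k powr (r + 1 - 2 * \<sigma>) \<le> weight k powr -1 * (weight j powr \<mu> * weight (k - j) powr \<mu>)" .
  qed (use assms C1(1) in auto)
  finally show ?thesis unfolding \<mu>(2)[symmetric] powr_add by (simp add: mult_ac)
qed

lemma admissible_phase_kernel: "0 < \<epsilon> \<Longrightarrow> admissible (real n * real lam) (phase_kernel P n \<epsilon> t)"
proof -
  assume e: "0 < \<epsilon>"
  show ?thesis
    using kernel_T[OF e order_refl phase_kernel_bound[of n \<epsilon> t]] C1(1)
    unfolding admissible_def by (intro exI[of _ "2 * C1 ^ n * \<bar>t\<bar> ^ n"]) auto
qed

lemma admissible_phase_power_kernel: "0 < \<epsilon> \<Longrightarrow> admissible (real n * real lam) (phase_power_kernel P n \<epsilon>)"
proof -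
  assume e: "0 < \<epsilon>"
  have "norm (phase_power_kernel P n \<epsilon> k j) \<le> norm (eL_symbol \<epsilon> k) * (1 * norm (phase P \<epsilon> k j) ^ n)" for k j
    by (simp add: phase_power_kernel_def norm_mult norm_power)
  from kernel_T[OF e order_refl this] show ?thesis
    unfolding admissible_def using C1(1) by (intro exI[of _ "2 * C1 ^ n * 1"]) auto
qed

section \<open>The bilinear form and its Taylor expansion in time\<close>

definition B where "B \<epsilon> t = Bil (phase_kernel P 0 \<epsilon> t)"
text \<open>\<open>D1\<close> and \<open>D2\<close> are the first and second time derivatives of
  \<open>B\<close> at time 0. They are unbounded, and their values enter the expansions as opaque
  vectors, never expanded linearly.\<close>

definition D1 where "D1 \<epsilon> = Bil (phase_power_kernel P 1 \<epsilon>)"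
definition D2 where "D2 \<epsilon> = Bil (phase_power_kernel P 2 \<epsilon>)"

lemma adm0: "0 < \<epsilon> \<Longrightarrow> admissible 0 (phase_kernel P 0 \<epsilon> t)" using admissible_phase_kernel[of \<epsilon> 0 t] by simp

lemma B_sym: "B \<epsilon> t x y = B \<epsilon> t y x"
  unfolding B_def by (rule Bil_sym) (simp add: phase_kernel_def phase_def algebra_simps)

lemma B_add_left: "0 < \<epsilon> \<Longrightarrow> B \<epsilon> t (x + y) z = B \<epsilon> t x z + B \<epsilon> t y z"
  and B_scaleR_left: "0 < \<epsilon> \<Longrightarrow> B \<epsilon> t (c *\<^sub>R x) z = c *\<^sub>R B \<epsilon> t x z"
  unfolding B_def by (auto intro!: Bil_add_left Bil_scaleR_left adm0)
lemma B_add_right: "0 < \<epsilon> \<Longrightarrow> B \<epsilon> t z (x + y) = B \<epsilon> t z x + B \<epsilon> t z y"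
  and B_scaleR_right: "0 < \<epsilon> \<Longrightarrow> B \<epsilon> t z (c *\<^sub>R x) = c *\<^sub>R B \<epsilon> t z x"
  using B_add_left B_scaleR_left B_sym by metis+
lemma B_minus_left: "0 < \<epsilon> \<Longrightarrow> B \<epsilon> t (- x) z = - B \<epsilon> t x z"
  using B_scaleR_left[of \<epsilon> t "-1"] by simp
lemma B_minus_right: "0 < \<epsilon> \<Longrightarrow> B \<epsilon> t z (- x) = - B \<epsilon> t z x"
  using B_scaleR_right[of \<epsilon> t z "-1"] by simp
lemma B_diff_left: "0 < \<epsilon> \<Longrightarrow> B \<epsilon> t (x - y) z = B \<epsilon> t x z - B \<epsilon> t y z"
  using B_add_left[of \<epsilon> t x "- y" z] by (simp add: B_minus_left)
lemma B_diff_right: "0 < \<epsilon> \<Longrightarrow> B \<epsilon> t z (x - y) = B \<epsilon> t z x - B \<epsilon> t z y"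
  using B_add_right[of \<epsilon> t z x "- y"] by (simp add: B_minus_right)
lemmas B_linear = B_add_left B_add_right B_scaleR_left B_scaleR_right B_diff_left B_diff_right B_minus_left B_minus_right

lemma phase_kernel1: "0 < \<epsilon> \<Longrightarrow> Bil (phase_kernel P 1 \<epsilon> t) x y = B \<epsilon> t x y - B \<epsilon> 0 x y"
proof -
  assume e: "0 < \<epsilon>"
  obtain M N where Hs_le: "Hs_le 0 M x" "Hs_le 0 N y" using Hs_le_exists by meson
  have "phase_kernel P 1 \<epsilon> t = (\<lambda>k j. phase_kernel P 0 \<epsilon> t k j + of_real (-1) * phase_kernel P 0 \<epsilon> 0 k j)"
    by (simp add: phase_kernel_def fun_eq_iff algebra_simps)
  then show ?thesis
    by (simp only: Bil_axpy_kernel[OF adm0[OF e] adm0[OF e] Hs_le]) (simp add: B_def)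
qed

text \<open>The kernel sum may be split into its Taylor terms only if each converges separately,
  whence the regularity \<open>lam\<close> of both arguments.\<close>

lemma phase_kernel2:
  assumes e: "0 < \<epsilon>" and Hs_le: "Hs_le (real lam) M x" "Hs_le (real lam) N y"
  shows "Bil (phase_kernel P 2 \<epsilon> t) x y = B \<epsilon> t x y - B \<epsilon> 0 x y - t *\<^sub>R D1 \<epsilon> x y"
proof -
  have "phase_kernel P 2 \<epsilon> t = (\<lambda>k j. phase_kernel P 1 \<epsilon> t k j + of_real (-t) * phase_power_kernel P 1 \<epsilon> k j)"
    by (simp add: phase_kernel_def phase_power_kernel_def fun_eq_iff algebra_simps numeral_2_eq_2)
  moreover have a: "admissible (real lam) (phase_kernel P 1 \<epsilon> t)" "admissible (real lam) (phase_power_kernel P 1 \<epsilon>)"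
    using admissible_phase_kernel[OF e, of 1 t] admissible_phase_power_kernel[OF e, of 1] by auto
  ultimately show ?thesis
    by (simp only: Bil_axpy_kernel[OF a Hs_le] phase_kernel1[OF e]) (simp add: D1_def)
qed

lemma phase_kernel3:
  assumes e: "0 < \<epsilon>" and Hs_le: "Hs_le (2 * real lam) M x" "Hs_le (2 * real lam) N y"
  shows "Bil (phase_kernel P 3 \<epsilon> t) x y = B \<epsilon> t x y - B \<epsilon> 0 x y - t *\<^sub>R D1 \<epsilon> x y - (t\<^sup>2 / 2) *\<^sub>R D2 \<epsilon> x y"
proof -
  have "phase_kernel P 3 \<epsilon> t = (\<lambda>k j. phase_kernel P 2 \<epsilon> t k j + of_real (-(t\<^sup>2 / 2)) * phase_power_kernel P 2 \<epsilon> k j)"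
    by (simp add: phase_kernel_def phase_power_kernel_def fun_eq_iff algebra_simps numeral_2_eq_2 numeral_3_eq_3)
  moreover have a: "admissible (2 * real lam) (phase_kernel P 2 \<epsilon> t)" "admissible (2 * real lam) (phase_power_kernel P 2 \<epsilon>)"
    using admissible_phase_kernel[OF e, of 2 t] admissible_phase_power_kernel[OF e, of 2] by auto
  moreover have hb1: "Hs_le (real lam) M x" "Hs_le (real lam) N y" using Hs_le by (auto elim!: Hs_le_mono)
  ultimately show ?thesis
    by (simp only: Bil_axpy_kernel[OF a Hs_le] phase_kernel2[OF e hb1]) (simp add: D2_def)
qed

lemma Hs_le_phase_kernel_T:
  assumes "0 < \<epsilon>" "0 \<le> \<rho>" "Hs_le (\<rho> + real n * real lam) M x" "Hs_le (\<rho> + real n * real lam) N y"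
  shows "Hs_le \<rho> (2 * (2 * C1 ^ n * \<bar>t\<bar> ^ n) * (M * N)) (Bil (phase_kernel P n \<epsilon> t) x y)"
  by (rule Hs_le_Bil[OF kernel_T[OF assms(1,2) phase_kernel_bound] assms(3,4)]) (use C1(1) assms in auto)

lemma Hs_le_phase_power_kernel_T:
  assumes "0 < \<epsilon>" "0 \<le> \<rho>" "Hs_le (\<rho> + real n * real lam) M x" "Hs_le (\<rho> + real n * real lam) N y"
  shows "Hs_le \<rho> (2 * (2 * C1 ^ n * 1) * (M * N)) (Bil (phase_power_kernel P n \<epsilon>) x y)"
proof -
  have "norm (phase_power_kernel P n \<epsilon> k j) \<le> norm (eL_symbol \<epsilon> k) * (1 * norm (phase P \<epsilon> k j) ^ n)" for k j
    by (simp add: phase_power_kernel_def norm_mult norm_power)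
  from Hs_le_Bil[OF kernel_T[OF assms(1,2) this] assms(3,4)] show ?thesis using C1(1) assms by auto
qed

lemma Hs_le_phase_kernel_K:
  assumes "0 < \<epsilon>" "Hs_le (s - 2 * real lam + real n * real lam) M x" "Hs_le (s - 2 * real lam + real n * real lam) N y"
  shows "Hs_le r (2 * (2 * eps_gain \<epsilon> * C1 ^ n * \<bar>t\<bar> ^ n) * (M * N)) (Bil (phase_kernel P n \<epsilon> t) x y)"
  by (rule Hs_le_Bil[OF kernel_K[OF assms(1) phase_kernel_bound] assms(2,3)]) (use C1(1) assms r0 in auto)

definition C3 where "C3 = (SOME C. 0 \<le> C \<and> (\<forall>\<epsilon> k j. 0 < \<epsilon> \<longrightarrow> norm (phase P \<epsilon> k j) \<le> C * max (weight j) (weight (k - j)) powr real lam))"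

lemma C3: "0 \<le> C3" "0 < \<epsilon> \<Longrightarrow> norm (phase P \<epsilon> k j) \<le> C3 * max (weight j) (weight (k - j)) powr real lam"
  using someI_ex[OF phase_bound_max[folded conj_assoc]] unfolding C3_def by auto

text \<open>Peetre's inequality, valid for exponents of either sign. The sign matters because
  \<open>r + 1 - 2 * \<sigma>\<close> may be negative.\<close>

lemma powr_le_Peetre: "weight k powr \<mu> \<le> weight j powr \<mu> * weight (k - j) powr \<bar>\<mu>\<bar>"
proof (cases "0 \<le> \<mu>")
  case True then show ?thesis using powr_le_prod by simp
next
  case False
  have "weight j / weight (k - j) \<le> weight k" using weight_split'[of j k] by (simp add: field_simps)
  then have "weight k powr \<mu> \<le> (weight j / weight (k - j)) powr \<mu>" using False by (intro powr_mono2') auto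
  also have "\<dots> = weight j powr \<mu> * weight (k - j) powr \<bar>\<mu>\<bar>" using False by (simp add: powr_divide powr_minus_divide)
  finally show ?thesis .
qed

text \<open>In the cubic case all three derivatives may fall on one factor, so that the other factor only
  enters through its \<open>\<ell>\<^sup>1\<close> norm; the kernel is split according to which factor has the higher frequency.\<close>
lemma Hs_le_phase_kernel3_K:
  assumes e: "0 < \<epsilon>" and x: "Hs_le s M x"
  shows "Hs_le r (8 * eps_gain \<epsilon> * C3 ^ 3 * \<bar>t\<bar> ^ 3 * M\<^sup>2) (Bil (phase_kernel P 3 \<epsilon> t) x x)"
proof -
  define \<mu> where "\<mu> = r + 1 - 2 * \<sigma>"
  define c where "c = 2 * eps_gain \<epsilon> * C3 ^ 3 * \<bar>t\<bar> ^ 3"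
  have c: "0 \<le> c" using C3(1) by (simp add: c_def)
  have mu: "s = \<mu> + 3 * real lam" "\<bar>\<mu>\<bar> + 1 \<le> s" using lam1' r0 sig1 by (auto simp: \<mu>_def s_def abs_if)
  define p where "p = phase_kernel P 3 \<epsilon> t"
  have sym: "p k (k - j) = p k j" for k j by (simp add: p_def phase_kernel_def phase_def algebra_simps)
  have main: "norm (p k j) * weight k powr r \<le> c * (weight j powr s * weight (k - j) powr \<bar>\<mu>\<bar>)" if le: "weight (k - j) \<le> weight j" for k j
  proof -
    have "norm (phase P \<epsilon> k j) ^ 3 \<le> (C3 * weight j powr real lam) ^ 3"
      using C3(2)[OF e, of k j] le by (intro power_mono) (auto simp: max_def)
    then have phase: "norm (phase P \<epsilon> k j) ^ 3 \<le> C3 ^ 3 * weight j powr (3 * real lam)"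
      by (simp add: power_mult_distrib powr_power mult.commute)
    have mkb: "norm (eL_symbol \<epsilon> k) \<le> 2 * eps_gain \<epsilon> * weight k powr (1 - 2 * \<sigma>)"
      using eL_symbol_bound_smoothing[OF e sig0 sig1] by (simp add: eps_gain_def)
    have "norm (p k j) \<le> (2 * eps_gain \<epsilon> * weight k powr (1 - 2 * \<sigma>)) * (\<bar>t\<bar> ^ 3 * (C3 ^ 3 * weight j powr (3 * real lam)))"
      unfolding p_def using phase mkb by (intro order_trans[OF phase_kernel_bound] mult_mono) auto
    then have "norm (p k j) * weight k powr r \<le> (2 * eps_gain \<epsilon> * weight k powr (1 - 2 * \<sigma>)) * (\<bar>t\<bar> ^ 3 * (C3 ^ 3 * weight j powr (3 * real lam))) * weight k powr r"
      by (intro mult_right_mono) auto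
    also have "\<dots> = c * weight j powr (3 * real lam) * weight k powr \<mu>"
    proof -
      have X: "weight k powr \<mu> = weight k powr (1 - 2 * \<sigma>) * weight k powr r" by (simp add: \<mu>_def algebra_simps flip: powr_add)
      show ?thesis unfolding c_def X by (simp only: mult_ac)
    qed
    also have "\<dots> \<le> c * weight j powr (3 * real lam) * (weight j powr \<mu> * weight (k - j) powr \<bar>\<mu>\<bar>)"
      using powr_le_Peetre c by (intro mult_left_mono) auto
    finally show ?thesis by (simp add: mu(1) powr_add mult_ac)
  qed
  \<comment> \<open>Ties go to \<open>p1\<close> and \<open>p2\<close> is strict, so the diagonal is
    counted once: by symmetry of the kernel, \<open>p\<close> is \<open>p1\<close> plus the
    reflection of \<open>p2\<close>, and both parts carry the higher frequency on their first
    argument.\<close>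
  define p1 where "p1 k j = (if weight (k - j) \<le> weight j then p k j else 0)" for k j
  define p2 where "p2 k j = (if weight (k - j) < weight j then p k j else 0)" for k j
  have b1: "norm (p1 k j) * weight k powr r \<le> c * (weight j powr s * weight (k - j) powr \<bar>\<mu>\<bar>)" for k j
    using main[of k j] c by (auto simp: p1_def)
  have b2: "norm (p2 k j) * weight k powr r \<le> c * (weight j powr s * weight (k - j) powr \<bar>\<mu>\<bar>)" for k j
    using main[of k j] c by (auto simp: p2_def)
  have x': "wl2_le s M (coord x)" "wl2_le (\<bar>\<mu>\<bar> + 1) M (coord x)"
    using x Hs_le_mono[OF x mu(2) order_refl] by (auto simp: Hs_le_def)
  note k1 = kernel_sum_wl2_le_l1[OF b1 x' c] and k2 = kernel_sum_wl2_le_l1[OF b2 x' c]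
  have sum2: "(\<lambda>j. p2 k (k - j) * coord x j * coord x (k - j)) abs_summable_on UNIV" for k
    using kernel_sum_flip_summable[of p2 k "coord x" "coord x"] k2(1)[of k] by simp
  have "kernel_sum p (coord x) (coord x) k = kernel_sum p1 (coord x) (coord x) k + kernel_sum p2 (coord x) (coord x) k" for k
  proof -
    have "kernel_sum p (coord x) (coord x) k = (\<Sum>\<^sub>\<infinity>j. p1 k j * coord x j * coord x (k - j) + p2 k (k - j) * coord x j * coord x (k - j))"
      unfolding kernel_sum_def by (rule infsum_cong) (simp add: p1_def p2_def sym, linarith?)
    also have "\<dots> = kernel_sum p1 (coord x) (coord x) k + kernel_sum (\<lambda>k j. p2 k (k - j)) (coord x) (coord x) k"
      unfolding kernel_sum_def by (rule infsum_add[OF abs_summable_summable[OF k1(1)] abs_summable_summable[OF sum2]])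
    also have "kernel_sum (\<lambda>k j. p2 k (k - j)) (coord x) (coord x) = kernel_sum p2 (coord x) (coord x)"
      by (rule kernel_sum_flip[symmetric])
    finally show ?thesis .
  qed
  then have "kernel_sum p (coord x) (coord x) = (\<lambda>k. kernel_sum p1 (coord x) (coord x) k + kernel_sum p2 (coord x) (coord x) k)"
    by (rule ext)
  then have "wl2_le r (2 * c * (M * M) + 2 * c * (M * M)) (kernel_sum p (coord x) (coord x))"
    using wl2_le_add[OF k1(2) k2(2)] by simp
  then have "Hs_le r (2 * c * (M * M) + 2 * c * (M * M)) (Bil p x x)"
    using coord_Abs r0 by (simp add: Hs_le_def Bil_def)
  then show ?thesis by (simp add: p_def c_def power2_eq_square mult_ac)
qed

end

section \<open>Asymptotic bounds for families\<close>

text \<open>A Landau symbol with one constant for the whole family. The indices will contain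
  \<epsilon>, the step size and the data, so membership of a family in this class is precisely
  uniformity in them.\<close>

definition big_O :: "'i set \<Rightarrow> real \<Rightarrow> ('i \<Rightarrow> real) \<Rightarrow> ('i \<Rightarrow> l2) \<Rightarrow> bool" where
  "big_O I \<rho> g x \<longleftrightarrow> (\<exists>C\<ge>0. \<forall>i\<in>I. Hs_le \<rho> (C * g i) (x i))"

lemma big_OI: "0 \<le> C \<Longrightarrow> (\<And>i. i \<in> I \<Longrightarrow> Hs_le \<rho> (C * g i) (x i)) \<Longrightarrow> big_O I \<rho> g x"
  unfolding big_O_def by blast

lemma big_OE:
  assumes "big_O I \<rho> g x" obtains C where "0 \<le> C" "\<And>i. i \<in> I \<Longrightarrow> Hs_le \<rho> (C * g i) (x i)"
  using assms unfolding big_O_def by blast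

lemma big_O_add: assumes "big_O I \<rho> g x" "big_O I \<rho> g y" shows "big_O I \<rho> g (\<lambda>i. x i + y i)"
proof -
  obtain C where C: "0 \<le> C" "\<And>i. i \<in> I \<Longrightarrow> Hs_le \<rho> (C * g i) (x i)" using assms(1) by (rule big_OE) blast
  obtain D where D: "0 \<le> D" "\<And>i. i \<in> I \<Longrightarrow> Hs_le \<rho> (D * g i) (y i)" using assms(2) by (rule big_OE) blast
  show ?thesis using C D Hs_le_add[OF C(2) D(2)] by (intro big_OI[of "C + D"]) (auto simp: distrib_right)
qed

lemma big_O_scale: assumes "big_O I \<rho> g x" shows "big_O I \<rho> (\<lambda>i. \<bar>c i\<bar> * g i) (\<lambda>i. c i *\<^sub>R x i)"
proof -
  obtain C where C: "0 \<le> C" "\<And>i. i \<in> I \<Longrightarrow> Hs_le \<rho> (C * g i) (x i)" using assms(1) by (rule big_OE) blast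
  show ?thesis using C(1) Hs_le_scaleR[OF C(2)] by (intro big_OI[of C]) (simp_all add: mult.left_commute)
qed

lemma big_O_weaken:
  assumes "big_O I \<rho> g x" "\<rho>' \<le> \<rho>" "0 \<le> K" "\<And>i. i \<in> I \<Longrightarrow> g i \<le> K * h i" shows "big_O I \<rho>' h x"
proof -
  obtain C where C: "0 \<le> C" "\<And>i. i \<in> I \<Longrightarrow> Hs_le \<rho> (C * g i) (x i)" using assms(1) by (rule big_OE) blast
  show ?thesis using C assms(2-)
    by (intro big_OI[of "C * K"]) (auto intro!: Hs_le_mono[OF C(2)] simp: mult.assoc mult_left_mono)
qed

lemma big_O_minus: assumes "big_O I \<rho> g x" shows "big_O I \<rho> g (\<lambda>i. - x i)"
  using big_O_scale[OF assms, of "\<lambda>i. -1"] by simp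

lemma big_O_diff: assumes "big_O I \<rho> g x" "big_O I \<rho> g y" shows "big_O I \<rho> g (\<lambda>i. x i - y i)"
  using big_O_add[OF assms(1) big_O_minus[OF assms(2)]] by simp

lemma big_O_cong: "big_O I \<rho> g y \<Longrightarrow> (\<And>i. i \<in> I \<Longrightarrow> x i = y i) \<Longrightarrow> big_O I \<rho> g x"
  unfolding big_O_def by metis

lemma big_O_zero: "(\<And>i. i \<in> I \<Longrightarrow> 0 \<le> g i) \<Longrightarrow> big_O I \<rho> g (\<lambda>i. 0)"
  by (intro big_OI[of 0]) (auto intro: Hs_le_zero)

context bbm
begin

text \<open>The numerical flow in coefficients, with the bilinear form frozen at time \<theta>. The
  scheme itself uses \<theta> = 0; other values arise by conjugation with the linear flow.\<close>

definition Phi where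
  "Phi \<epsilon> \<theta> t w = w - t *\<^sub>R B \<epsilon> \<theta> w w + t\<^sup>2 *\<^sub>R B \<epsilon> \<theta> w (B \<epsilon> \<theta> w w)
     - (t ^ 3 / 3) *\<^sub>R B \<epsilon> \<theta> (B \<epsilon> \<theta> w w) (B \<epsilon> \<theta> w w)
     - (2 / 3 * t ^ 3) *\<^sub>R B \<epsilon> \<theta> w (B \<epsilon> \<theta> w (B \<epsilon> \<theta> w w))"

text \<open>One splitting step followed by the inverse linear flow over the whole step, so that it
  is to be compared with the twisted solution. Of the weights d only their partial sums 0, 2/3, 0
  survive, as frozen times.\<close>

definition twisted_step where
  "twisted_step \<epsilon> t x = Phi \<epsilon> 0 (- 1 / 24 * t) (Phi \<epsilon> (2 / 3 * t) (3 / 4 * t) (Phi \<epsilon> 0 (7 / 24 * t) x))"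

end

locale bbm_family = bbm +
  fixes I :: "'i set" and ep tm :: "'i \<Rightarrow> real"
  assumes ep: "i \<in> I \<Longrightarrow> 0 < ep i" and ep1: "i \<in> I \<Longrightarrow> ep i \<le> 1"
    and tm: "i \<in> I \<Longrightarrow> 0 \<le> tm i" and tm1: "i \<in> I \<Longrightarrow> tm i \<le> 1"
begin

text \<open>Two currencies of smallness: \<open>T\<close> records an order in the step size at some
  regularity without any gain in \<epsilon>, \<open>K\<close> is the target scale of the error. A
  \<open>T\<close> estimate passes to \<open>K\<close> by going through one more, outermost,
  bilinear form.\<close>

abbreviation "T n \<rho> x \<equiv> big_O I \<rho> (\<lambda>i. tm i ^ n) x"
abbreviation "K n x \<equiv> big_O I r (\<lambda>i. eps_gain (ep i) * tm i ^ n) x"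

lemma tm_pow_le: "i \<in> I \<Longrightarrow> m \<le> n \<Longrightarrow> tm i ^ n \<le> tm i ^ m"
  using tm tm1 by (intro power_decreasing) auto

lemma T_lower: "T n \<rho> x \<Longrightarrow> m \<le> n \<Longrightarrow> \<rho>' \<le> \<rho> \<Longrightarrow> T m \<rho>' x"
  by (rule big_O_weaken[where K = 1]) (auto simp: tm_pow_le)

lemma T_zero: "T n \<rho> (\<lambda>i. 0)" and K_zero: "K n (\<lambda>i. 0)"
  by (auto intro!: big_O_zero simp: tm)

text \<open>The scalar has the fixed shape \<open>c * tm i ^ m\<close> so that resolution can read
  off the power; this explains factors such as \<open>1 * tm i ^ 1\<close> in later
  witnesses.\<close>

lemma T_scale: assumes "T n \<rho> x" "l \<le> m + n" shows "T l \<rho> (\<lambda>i. (c * tm i ^ m) *\<^sub>R x i)"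
proof (rule big_O_weaken[OF big_O_scale[OF assms(1), of "\<lambda>i. c * tm i ^ m"], where K = "\<bar>c\<bar>"])
  fix i assume i: "i \<in> I"
  have "\<bar>c * tm i ^ m\<bar> * tm i ^ n = \<bar>c\<bar> * tm i ^ (m + n)" using tm[OF i] by (simp add: abs_mult power_add)
  also have "\<dots> \<le> \<bar>c\<bar> * tm i ^ l" using tm_pow_le[OF i assms(2)] by (intro mult_left_mono) auto
  finally show "\<bar>c * tm i ^ m\<bar> * tm i ^ n \<le> \<bar>c\<bar> * tm i ^ l" .
qed auto

lemma K_scale: assumes "K n x" "l \<le> m + n" shows "K l (\<lambda>i. (c * tm i ^ m) *\<^sub>R x i)"
proof (rule big_O_weaken[OF big_O_scale[OF assms(1), of "\<lambda>i. c * tm i ^ m"], where K = "\<bar>c\<bar>"])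
  fix i assume i: "i \<in> I"
  have "\<bar>c * tm i ^ m\<bar> * (eps_gain (ep i) * tm i ^ n) = \<bar>c\<bar> * (eps_gain (ep i) * tm i ^ (m + n))" using tm[OF i] by (simp add: abs_mult power_add)
  also have "\<dots> \<le> \<bar>c\<bar> * (eps_gain (ep i) * tm i ^ l)" using tm_pow_le[OF i assms(2)] by (intro mult_left_mono) auto
  finally show "\<bar>c * tm i ^ m\<bar> * (eps_gain (ep i) * tm i ^ n) \<le> \<bar>c\<bar> * (eps_gain (ep i) * tm i ^ l)" .
qed auto

lemma T_const: "T n \<rho> x \<Longrightarrow> T n \<rho> (\<lambda>i. c *\<^sub>R x i)" and K_const: "K n x \<Longrightarrow> K n (\<lambda>i. c *\<^sub>R x i)"
  using T_scale[where n = n and l = n and m = 0 and c = c and x = x] K_scale[where n = n and l = n and m = 0 and c = c and x = x] by auto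

lemma big_O_B:
  assumes "big_O I \<rho> g x" "big_O I \<rho> h y" "0 \<le> \<rho>"
  shows "big_O I \<rho> (\<lambda>i. g i * h i) (\<lambda>i. B (ep i) (\<theta> i) (x i) (y i))"
proof -
  obtain C where C: "0 \<le> C" "\<And>i. i \<in> I \<Longrightarrow> Hs_le \<rho> (C * g i) (x i)" using assms(1) by (rule big_OE) blast
  obtain D where D: "0 \<le> D" "\<And>i. i \<in> I \<Longrightarrow> Hs_le \<rho> (D * h i) (y i)" using assms(2) by (rule big_OE) blast
  show ?thesis
  proof (rule big_OI[of "4 * C * D"])
    fix i assume i: "i \<in> I"
    show "Hs_le \<rho> (4 * C * D * (g i * h i)) (B (ep i) (\<theta> i) (x i) (y i))"
      using Hs_le_phase_kernel_T[OF ep[OF i] assms(3), of 0 "C * g i" "x i" "D * h i" "y i" "\<theta> i"] C(2)[OF i] D(2)[OF i]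
      by (simp add: B_def mult_ac)
  qed (use C D in simp)
qed

lemma phase_kernel_T:
  assumes "T a (\<rho> + real n * real lam) x" "T b (\<rho> + real n * real lam) y" "0 \<le> \<rho>"
    and phase: "\<And>i. i \<in> I \<Longrightarrow> \<bar>\<theta> i\<bar> \<le> tm i" and l: "l \<le> a + b + n"
  shows "T l \<rho> (\<lambda>i. Bil (phase_kernel P n (ep i) (\<theta> i)) (x i) (y i))"
proof -
  obtain C where C: "0 \<le> C" "\<And>i. i \<in> I \<Longrightarrow> Hs_le (\<rho> + real n * real lam) (C * tm i ^ a) (x i)" using assms(1) by (rule big_OE) blast
  obtain D where D: "0 \<le> D" "\<And>i. i \<in> I \<Longrightarrow> Hs_le (\<rho> + real n * real lam) (D * tm i ^ b) (y i)" using assms(2) by (rule big_OE) blast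
  show ?thesis
  proof (rule big_OI[of "4 * C1 ^ n * C * D"])
    fix i assume i: "i \<in> I"
    have "4 * C1 ^ n * C * D * (\<bar>\<theta> i\<bar> ^ n * tm i ^ (a + b)) \<le> 4 * C1 ^ n * C * D * tm i ^ l"
    proof (rule mult_left_mono)
      have "\<bar>\<theta> i\<bar> ^ n * tm i ^ (a + b) \<le> tm i ^ n * tm i ^ (a + b)" using phase[OF i] tm[OF i] by (intro mult_right_mono power_mono) auto
      also have "\<dots> \<le> tm i ^ l" using tm_pow_le[OF i l] by (simp add: power_add mult_ac)
      finally show "\<bar>\<theta> i\<bar> ^ n * tm i ^ (a + b) \<le> tm i ^ l" .
    qed (use C D C1(1) in simp)
    then show "Hs_le \<rho> (4 * C1 ^ n * C * D * tm i ^ l) (Bil (phase_kernel P n (ep i) (\<theta> i)) (x i) (y i))"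
      by (intro Hs_le_mono[OF Hs_le_phase_kernel_T[OF ep[OF i] assms(3) C(2)[OF i] D(2)[OF i], of "\<theta> i"] order_refl])
        (simp add: power_add mult_ac)
  qed (use C D C1(1) in simp)
qed

lemma phase_kernel_K:
  assumes "T a (s - 2 * real lam + real n * real lam) x" "T b (s - 2 * real lam + real n * real lam) y"
    and phase: "n = 0 \<or> (\<forall>i\<in>I. \<bar>\<theta> i\<bar> \<le> tm i)" and l: "l \<le> a + b + n"
  shows "K l (\<lambda>i. Bil (phase_kernel P n (ep i) (\<theta> i)) (x i) (y i))"
proof -
  obtain C where C: "0 \<le> C" "\<And>i. i \<in> I \<Longrightarrow> Hs_le (s - 2 * real lam + real n * real lam) (C * tm i ^ a) (x i)" using assms(1) by (rule big_OE) blast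
  obtain D where D: "0 \<le> D" "\<And>i. i \<in> I \<Longrightarrow> Hs_le (s - 2 * real lam + real n * real lam) (D * tm i ^ b) (y i)" using assms(2) by (rule big_OE) blast
  show ?thesis
  proof (rule big_OI[of "4 * C1 ^ n * C * D"])
    fix i assume i: "i \<in> I"
    have "4 * C1 ^ n * C * D * (eps_gain (ep i) * (\<bar>\<theta> i\<bar> ^ n * tm i ^ (a + b))) \<le> 4 * C1 ^ n * C * D * (eps_gain (ep i) * tm i ^ l)"
    proof (intro mult_left_mono)
      have "\<bar>\<theta> i\<bar> ^ n \<le> tm i ^ n" using phase i tm[OF i] by (auto intro: power_mono)
      then have "\<bar>\<theta> i\<bar> ^ n * tm i ^ (a + b) \<le> tm i ^ n * tm i ^ (a + b)" using tm[OF i] by (intro mult_right_mono) auto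
      also have "\<dots> \<le> tm i ^ l" using tm_pow_le[OF i l] by (simp add: power_add mult_ac)
      finally show "\<bar>\<theta> i\<bar> ^ n * tm i ^ (a + b) \<le> tm i ^ l" .
    qed (use C D C1(1) in auto)
    then show "Hs_le r (4 * C1 ^ n * C * D * (eps_gain (ep i) * tm i ^ l)) (Bil (phase_kernel P n (ep i) (\<theta> i)) (x i) (y i))"
      by (intro Hs_le_mono[OF Hs_le_phase_kernel_K[OF ep[OF i] C(2)[OF i] D(2)[OF i], of "\<theta> i"] order_refl])
        (simp add: power_add mult_ac)
  qed (use C D C1(1) in simp)
qed

lemma s_bounds: "0 \<le> s - 2 * real lam" "r \<le> s - 2 * real lam" "r \<le> s"
  using lam1' r0 sig1 by (auto simp: s_def)

lemma T_B:
  assumes "T a \<rho> x" "T b \<rho> y" "0 \<le> \<rho>" "l \<le> a + b"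
  shows "T l \<rho> (\<lambda>i. B (ep i) (\<theta> i) (x i) (y i))"
  by (rule big_O_weaken[OF big_O_B[OF assms(1-3)], where K = 1])
    (use assms(4) tm_pow_le in \<open>auto simp flip: power_add\<close>)

lemma K_B:
  assumes "T a (s - 2 * real lam) x" "T b (s - 2 * real lam) y" "l \<le> a + b"
  shows "K l (\<lambda>i. B (ep i) (\<theta> i) (x i) (y i))"
  using phase_kernel_K[where a = a and b = b and n = 0] assms by (simp add: B_def)

lemma T_B1:
  assumes "T a (\<rho> + real lam) x" "T b (\<rho> + real lam) y" "0 \<le> \<rho>" "\<And>i. i \<in> I \<Longrightarrow> \<bar>\<theta> i\<bar> \<le> tm i" "l \<le> Suc (a + b)"
  shows "T l \<rho> (\<lambda>i. B (ep i) (\<theta> i) (x i) (y i) - B (ep i) 0 (x i) (y i))"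
  by (rule big_O_cong[OF phase_kernel_T[where a = a and b = b and n = 1]]) (use assms phase_kernel1 ep in auto)

lemma K_B1:
  assumes "T a (s - real lam) x" "T b (s - real lam) y" "\<And>i. i \<in> I \<Longrightarrow> \<bar>\<theta> i\<bar> \<le> tm i" "l \<le> Suc (a + b)"
  shows "K l (\<lambda>i. B (ep i) (\<theta> i) (x i) (y i) - B (ep i) 0 (x i) (y i))"
  by (rule big_O_cong[OF phase_kernel_K[where a = a and b = b and n = 1]]) (use assms phase_kernel1 ep in auto)

lemma T_hbD: assumes "T a \<rho> x" "i \<in> I" obtains M where "Hs_le \<rho> M (x i)"
  using assms by (auto simp: big_O_def)

lemma T_B2:
  assumes "T a (\<rho> + 2 * real lam) x" "T b (\<rho> + 2 * real lam) y" "0 \<le> \<rho>" "\<And>i. i \<in> I \<Longrightarrow> \<bar>\<theta> i\<bar> \<le> tm i" "l \<le> 2 + (a + b)"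
  shows "T l \<rho> (\<lambda>i. B (ep i) (\<theta> i) (x i) (y i) - B (ep i) 0 (x i) (y i) - \<theta> i *\<^sub>R D1 (ep i) (x i) (y i))"
proof (rule big_O_cong[OF phase_kernel_T[where a = a and b = b and n = 2]])
  fix i assume i: "i \<in> I"
  obtain M N where "Hs_le (\<rho> + 2 * real lam) M (x i)" "Hs_le (\<rho> + 2 * real lam) N (y i)" using T_hbD assms(1,2) i by meson
  then have "Hs_le (real lam) M (x i)" "Hs_le (real lam) N (y i)" using assms(3) by (auto elim!: Hs_le_mono)
  then show "B (ep i) (\<theta> i) (x i) (y i) - B (ep i) 0 (x i) (y i) - \<theta> i *\<^sub>R D1 (ep i) (x i) (y i) = Bil (phase_kernel P 2 (ep i) (\<theta> i)) (x i) (y i)"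
    using phase_kernel2 ep[OF i] by simp
qed (use assms in auto)

lemma K_B2:
  assumes "T a s x" "T b s y" "\<And>i. i \<in> I \<Longrightarrow> \<bar>\<theta> i\<bar> \<le> tm i" "l \<le> 2 + (a + b)"
  shows "K l (\<lambda>i. B (ep i) (\<theta> i) (x i) (y i) - B (ep i) 0 (x i) (y i) - \<theta> i *\<^sub>R D1 (ep i) (x i) (y i))"
proof (rule big_O_cong[OF phase_kernel_K[where a = a and b = b and n = 2]])
  fix i assume i: "i \<in> I"
  obtain M N where "Hs_le s M (x i)" "Hs_le s N (y i)" using T_hbD assms(1,2) i by meson
  then have "Hs_le (real lam) M (x i)" "Hs_le (real lam) N (y i)" using s_bounds by (auto elim!: Hs_le_mono)
  then show "B (ep i) (\<theta> i) (x i) (y i) - B (ep i) 0 (x i) (y i) - \<theta> i *\<^sub>R D1 (ep i) (x i) (y i) = Bil (phase_kernel P 2 (ep i) (\<theta> i)) (x i) (y i)"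
    using phase_kernel2 ep[OF i] by simp
qed (use assms in auto)

text \<open>Restricted to equal arguments, because the underlying kernel estimate moves the higher
  frequency to a fixed argument by symmetry. The expansions need three phases only for the initial
  value paired with itself.\<close>

lemma K_B3:
  assumes "T 0 s x" and phase: "\<And>i. i \<in> I \<Longrightarrow> \<bar>\<theta> i\<bar> \<le> tm i"
  shows "K 3 (\<lambda>i. B (ep i) (\<theta> i) (x i) (x i) - B (ep i) 0 (x i) (x i) - \<theta> i *\<^sub>R D1 (ep i) (x i) (x i) - ((\<theta> i)\<^sup>2 / 2) *\<^sub>R D2 (ep i) (x i) (x i))"
proof -
  obtain C where C: "0 \<le> C" "\<And>i. i \<in> I \<Longrightarrow> Hs_le s (C * tm i ^ 0) (x i)" using assms(1) by (rule big_OE) blast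
  show ?thesis
  proof (rule big_OI[of "8 * C3 ^ 3 * C\<^sup>2"])
    fix i assume i: "i \<in> I"
    have x: "Hs_le s C (x i)" using C(2)[OF i] by simp
    have "8 * C3 ^ 3 * C\<^sup>2 * (eps_gain (ep i) * \<bar>\<theta> i\<bar> ^ 3) \<le> 8 * C3 ^ 3 * C\<^sup>2 * (eps_gain (ep i) * tm i ^ 3)"
      using phase[OF i] C3(1) by (intro mult_left_mono power_mono) auto
    then have "Hs_le r (8 * C3 ^ 3 * C\<^sup>2 * (eps_gain (ep i) * tm i ^ 3)) (Bil (phase_kernel P 3 (ep i) (\<theta> i)) (x i) (x i))"
      by (intro Hs_le_mono[OF Hs_le_phase_kernel3_K[OF ep[OF i] x, of "\<theta> i"] order_refl]) (simp add: mult_ac)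
    moreover have "Hs_le (2 * real lam) C (x i)" using s_bounds by (intro Hs_le_mono[OF x]) auto
    ultimately show "Hs_le r (8 * C3 ^ 3 * C\<^sup>2 * (eps_gain (ep i) * tm i ^ 3)) (B (ep i) (\<theta> i) (x i) (x i) - B (ep i) 0 (x i) (x i) - \<theta> i *\<^sub>R D1 (ep i) (x i) (x i) - ((\<theta> i)\<^sup>2 / 2) *\<^sub>R D2 (ep i) (x i) (x i))"
      using phase_kernel3 ep[OF i] by simp
  qed (use C C3(1) in simp)
qed

lemma T_D1:
  assumes "T a (\<rho> + real lam) x" "T b (\<rho> + real lam) y" "0 \<le> \<rho>"
  shows "T 0 \<rho> (\<lambda>i. D1 (ep i) (x i) (y i))"
proof -
  have "T 0 (\<rho> + real lam) x" "T 0 (\<rho> + real lam) y" by (rule T_lower[OF assms(1)], simp, simp) (rule T_lower[OF assms(2)], simp, simp)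
  then obtain C D where C: "0 \<le> C" "\<And>i. i \<in> I \<Longrightarrow> Hs_le (\<rho> + real lam) C (x i)" 
    and D: "0 \<le> D" "\<And>i. i \<in> I \<Longrightarrow> Hs_le (\<rho> + real lam) D (y i)" by (auto simp: big_O_def)
  show ?thesis
    using Hs_le_phase_power_kernel_T[where n = 1 and M = C and N = D] ep C D assms(3) C1(1)
    by (intro big_OI[of "4 * C1 * C * D"]) (auto simp: D1_def mult_ac)
qed

text \<open>The flow applied to a cubic polynomial in the step size, re-expanded to third order. The
  time \<theta> is left unexpanded, so only bilinearity and symmetry of one bounded form enter: all
  coefficients stay in H^s, and the remainder owes its factor in \<epsilon> to the outermost
  form.\<close>

lemma Phi_expansion:
  fixes p0 p1 p2 p3 :: "'i \<Rightarrow> l2" and \<theta> :: "'i \<Rightarrow> real" and \<alpha> :: real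
  assumes p: "T 0 s p0" "T 0 s p1" "T 0 s p2" "T 0 s p3"
  defines "D \<equiv> \<lambda>i. B (ep i) (\<theta> i)"
  defines "a \<equiv> \<lambda>i. D i (p0 i) (p0 i)"
  shows "K 4 (\<lambda>i. Phi (ep i) (\<theta> i) (\<alpha> * tm i) (p0 i + tm i *\<^sub>R p1 i + (tm i)\<^sup>2 *\<^sub>R p2 i + (tm i ^ 3) *\<^sub>R p3 i)
     - (p0 i + tm i *\<^sub>R (p1 i - \<alpha> *\<^sub>R a i)
        + (tm i)\<^sup>2 *\<^sub>R (p2 i - (2 * \<alpha>) *\<^sub>R D i (p0 i) (p1 i) + \<alpha>\<^sup>2 *\<^sub>R D i (p0 i) (a i))
        + (tm i ^ 3) *\<^sub>R (p3 i - (2 * \<alpha>) *\<^sub>R D i (p0 i) (p2 i) - \<alpha> *\<^sub>R D i (p1 i) (p1 i)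
            + \<alpha>\<^sup>2 *\<^sub>R (D i (p1 i) (a i) + 2 *\<^sub>R D i (p0 i) (D i (p0 i) (p1 i)))
            - (\<alpha> ^ 3 / 3) *\<^sub>R D i (a i) (a i) - (2 / 3 * \<alpha> ^ 3) *\<^sub>R D i (p0 i) (D i (p0 i) (a i)))))" (is "K 4 ?x")
proof -
  have s0: "0 \<le> s" using s_bounds r0 by auto
  \<comment> \<open>\<open>W\<close> is the input, \<open>A\<close> its quadratic image with Taylor
    coefficients \<open>a\<close>, \<open>A1\<close>, \<open>A2\<close>, and \<open>G\<close> the
    next iterate. The scalar powers are spelled out for the scaling rules.\<close>
  define W where "W i = p0 i + (1 * tm i ^ 1) *\<^sub>R p1 i + (1 * tm i ^ 2) *\<^sub>R p2 i + (1 * tm i ^ 3) *\<^sub>R p3 i" for i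
  define A where "A i = D i (W i) (W i)" for i
  define A1 where "A1 i = 2 *\<^sub>R D i (p0 i) (p1 i)" for i
  define A2 where "A2 i = 2 *\<^sub>R D i (p0 i) (p2 i) + D i (p1 i) (p1 i)" for i
  define G where "G i = D i (W i) (A i)" for i
  have lin: "D i (x + y) z = D i x z + D i y z" "D i z (x + y) = D i z x + D i z y"
    "D i (x - y) z = D i x z - D i y z" "D i z (x - y) = D i z x - D i z y"
    "D i (c *\<^sub>R x) z = c *\<^sub>R D i x z" "D i z (c *\<^sub>R x) = c *\<^sub>R D i z x"
    if "i \<in> I" for i x y z c
    unfolding D_def using ep[OF that] by (auto simp: B_linear)
  have sym: "D i x y = D i y x" for i x y unfolding D_def by (rule B_sym)
  have TD: "T l s (\<lambda>i. D i (x i) (y i))" if "T n s x" "T m s y" "l \<le> n + m" for x y l n m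
    unfolding D_def using that s0 by (intro T_B)
  have KD: "K l (\<lambda>i. D i (x i) (y i))" if "T n s x" "T m s y" "l \<le> n + m" for x y l n m
    unfolding D_def using that s0 by (intro K_B[of n _ m]) (auto intro: T_lower)
  have TW: "T 0 s W" unfolding W_def by (intro big_O_add T_scale[where n = 0] p) auto
  have Ta: "T 0 s a" unfolding a_def by (intro TD[of 0 _ 0] p) auto
  have TA: "T 0 s A" unfolding A_def by (intro TD[of 0 _ 0] TW) auto
  have TA1: "T 0 s A1" unfolding A1_def by (intro T_const TD[of 0 _ 0] p) auto
  have TW0: "T 1 s (\<lambda>i. W i - p0 i)"
  proof (rule big_O_cong[where y = "\<lambda>i. (1 * tm i ^ 1) *\<^sub>R p1 i + (1 * tm i ^ 2) *\<^sub>R p2 i + (1 * tm i ^ 3) *\<^sub>R p3 i"])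
    show "T 1 s (\<lambda>i. (1 * tm i ^ 1) *\<^sub>R p1 i + (1 * tm i ^ 2) *\<^sub>R p2 i + (1 * tm i ^ 3) *\<^sub>R p3 i)"
      by (intro big_O_add T_scale[where n = 0] p) auto
  qed (simp add: W_def)
  have TAa: "T 1 s (\<lambda>i. A i - a i)"
  proof (rule big_O_cong[where y = "\<lambda>i. D i (W i - p0 i) (W i) + D i (p0 i) (W i - p0 i)"])
    show "T 1 s (\<lambda>i. D i (W i - p0 i) (W i) + D i (p0 i) (W i - p0 i))"
      by (intro big_O_add TD[OF TW0 TW] TD[OF p(1) TW0]) auto
  qed (simp add: lin A_def a_def)
  \<comment> \<open>The quadratic image is needed twice. Inside another form its remainder must be
    small in H^s, which is this estimate; on its own it must be of order 3 in the \<open>K\<close>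
    scale, which is the next one.\<close>
  let ?y = "\<lambda>i. D i (W i - p0 i) (W i - p0 i) + (2 * tm i ^ 2) *\<^sub>R D i (p0 i) (p2 i) + (2 * tm i ^ 3) *\<^sub>R D i (p0 i) (p3 i)"
  have TAa1: "T 2 s (\<lambda>i. A i - a i - tm i *\<^sub>R A1 i)"
  proof (rule big_O_cong[where y = ?y])
    show "T 2 s ?y"
      by (intro big_O_add T_scale[where n = 0] TD[OF TW0 TW0] TD[OF p(1) p(3)] TD[OF p(1) p(4)]) auto
    fix i assume i: "i \<in> I"
    show "A i - a i - tm i *\<^sub>R A1 i = ?y i"
      by (rule l2_eqI) (simp add: A_def a_def A1_def W_def lin[OF i] sym[of i "p1 i" "p0 i"] sym[of i "p2 i" "p0 i"] sym[of i "p3 i" "p0 i"] algebra_simps)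
  qed
  \<comment> \<open>Inclusion-exclusion for the cubic coefficient of the input: the first two terms
    count the pair \<open>p3\<close>, \<open>p3\<close> twice.\<close>
  let ?y = "\<lambda>i. (1 * tm i ^ 3) *\<^sub>R D i (p3 i) (W i) + (1 * tm i ^ 3) *\<^sub>R D i (W i) (p3 i) - (1 * tm i ^ 6) *\<^sub>R D i (p3 i) (p3 i)
      + (2 * tm i ^ 3) *\<^sub>R D i (p1 i) (p2 i) + (1 * tm i ^ 4) *\<^sub>R D i (p2 i) (p2 i)"
  have KA: "K 3 (\<lambda>i. A i - a i - tm i *\<^sub>R A1 i - (tm i)\<^sup>2 *\<^sub>R A2 i)"
  proof (rule big_O_cong[where y = ?y])
    show "K 3 ?y"
      by (intro big_O_add big_O_diff K_scale[where n = 0] KD[of 0 _ 0] TW p) auto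
    fix i assume i: "i \<in> I"
    show "A i - a i - tm i *\<^sub>R A1 i - (tm i)\<^sup>2 *\<^sub>R A2 i = ?y i"
      by (rule l2_eqI) (simp add: A_def a_def A1_def A2_def W_def lin[OF i] sym[of i "p1 i" "p0 i"] sym[of i "p2 i" "p0 i"] sym[of i "p3 i" "p0 i"]
        sym[of i "p2 i" "p1 i"] sym[of i "p3 i" "p1 i"] sym[of i "p3 i" "p2 i"] algebra_simps power_numeral_reduce)
  qed
  have TGa: "T 1 s (\<lambda>i. G i - D i (p0 i) (a i))"
  proof (rule big_O_cong[where y = "\<lambda>i. D i (W i) (A i - a i) + D i (W i - p0 i) (a i)"])
    show "T 1 s (\<lambda>i. D i (W i) (A i - a i) + D i (W i - p0 i) (a i))"
      by (intro big_O_add TD[OF TW TAa] TD[OF TW0 Ta]) auto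
  qed (simp add: lin G_def)
  let ?y = "\<lambda>i. D i (W i) (A i - a i - tm i *\<^sub>R A1 i) + (1 * tm i ^ 2) *\<^sub>R D i (p2 i) (a i) + (1 * tm i ^ 3) *\<^sub>R D i (p3 i) (a i)
      + (1 * tm i ^ 1) *\<^sub>R D i (W i - p0 i) (A1 i)"
  have KG: "K 2 (\<lambda>i. G i - D i (p0 i) (a i) - tm i *\<^sub>R (D i (p1 i) (a i) + D i (p0 i) (A1 i)))"
  proof (rule big_O_cong[where y = ?y])
    show "K 2 ?y"
      by (intro big_O_add KD[OF TW TAa1] K_scale[where n = 0] K_scale[where n = 1] KD[OF p(3) Ta] KD[OF p(4) Ta] KD[OF TW0 TA1]) auto
    fix i assume i: "i \<in> I"
    show "G i - D i (p0 i) (a i) - tm i *\<^sub>R (D i (p1 i) (a i) + D i (p0 i) (A1 i)) = ?y i"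
      unfolding G_def lin[OF i] by (rule l2_eqI) (simp add: W_def lin[OF i] algebra_simps)
  qed
  have KAA: "K 1 (\<lambda>i. D i (A i) (A i) - D i (a i) (a i))"
  proof (rule big_O_cong[where y = "\<lambda>i. D i (A i - a i) (A i) + D i (a i) (A i - a i)"])
    show "K 1 (\<lambda>i. D i (A i - a i) (A i) + D i (a i) (A i - a i))"
      by (intro big_O_add KD[OF TAa TA] KD[OF Ta TAa]) auto
  qed (simp add: lin)
  have KWG: "K 1 (\<lambda>i. D i (W i) (G i) - D i (p0 i) (D i (p0 i) (a i)))"
  proof (rule big_O_cong[where y = "\<lambda>i. D i (W i) (G i - D i (p0 i) (a i)) + D i (W i - p0 i) (D i (p0 i) (a i))"])
    show "K 1 (\<lambda>i. D i (W i) (G i - D i (p0 i) (a i)) + D i (W i - p0 i) (D i (p0 i) (a i)))"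
      by (intro big_O_add KD[OF TW TGa] KD[OF TW0 TD[OF p(1) Ta]]) auto
  qed (simp add: lin)
  \<comment> \<open>The four terms of the flow carry the powers 1, 2, 3, 3 of the step, matching the
    remainders of order 3, 2, 1, 1 established above.\<close>
  let ?y = "\<lambda>i. (- \<alpha> * tm i ^ 1) *\<^sub>R (A i - a i - tm i *\<^sub>R A1 i - (tm i)\<^sup>2 *\<^sub>R A2 i)
     + (\<alpha>\<^sup>2 * tm i ^ 2) *\<^sub>R (G i - D i (p0 i) (a i) - tm i *\<^sub>R (D i (p1 i) (a i) + D i (p0 i) (A1 i)))
     + (- (\<alpha> ^ 3 / 3) * tm i ^ 3) *\<^sub>R (D i (A i) (A i) - D i (a i) (a i))
     + (- (2 / 3 * \<alpha> ^ 3) * tm i ^ 3) *\<^sub>R (D i (W i) (G i) - D i (p0 i) (D i (p0 i) (a i)))"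
  show ?thesis
  proof (rule big_O_cong[where y = ?y])
    show "K 4 ?y"
      by (intro big_O_add K_scale[OF KA] K_scale[OF KG] K_scale[OF KAA] K_scale[OF KWG]) auto
    fix i assume i: "i \<in> I"
    have W': "p0 i + tm i *\<^sub>R p1 i + (tm i)\<^sup>2 *\<^sub>R p2 i + (tm i ^ 3) *\<^sub>R p3 i = W i" by (simp add: W_def)
    have Ph: "Phi (ep i) (\<theta> i) (\<alpha> * tm i) (W i) = W i - (\<alpha> * tm i) *\<^sub>R A i + (\<alpha> * tm i)\<^sup>2 *\<^sub>R G i
      - ((\<alpha> * tm i) ^ 3 / 3) *\<^sub>R D i (A i) (A i) - (2 / 3 * (\<alpha> * tm i) ^ 3) *\<^sub>R D i (W i) (G i)"
      by (simp add: Phi_def A_def G_def D_def)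
    show "?x i = ?y i"
      unfolding W' Ph A1_def A2_def lin[OF i]
      by (rule l2_eqI) (simp add: W_def algebra_simps power_mult_distrib power2_eq_square power3_eq_cube)
  qed
qed


section \<open>Lipschitz dependence of the step on its data\<close>

lemma big_O_B_lip:
  assumes x: "big_O I \<rho> (\<lambda>i. 1) x" "big_O I \<rho> (\<lambda>i. 1) x'" "big_O I \<rho> g (\<lambda>i. x i - x' i)"
    and y: "big_O I \<rho> (\<lambda>i. 1) y" "big_O I \<rho> (\<lambda>i. 1) y'" "big_O I \<rho> g (\<lambda>i. y i - y' i)" and "0 \<le> \<rho>"
  shows "big_O I \<rho> g (\<lambda>i. B (ep i) (\<theta> i) (x i) (y i) - B (ep i) (\<theta> i) (x' i) (y' i))"
proof (rule big_O_cong[where y = "\<lambda>i. B (ep i) (\<theta> i) (x i - x' i) (y i) + B (ep i) (\<theta> i) (x' i) (y i - y' i)"])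
  show "big_O I \<rho> g (\<lambda>i. B (ep i) (\<theta> i) (x i - x' i) (y i) + B (ep i) (\<theta> i) (x' i) (y i - y' i))"
    using big_O_B[OF x(3) y(1) assms(7), of \<theta>] big_O_B[OF x(2) y(3) assms(7), of \<theta>] by (intro big_O_add) auto
qed (simp add: B_linear ep)

lemma big_O_B1:
  assumes "big_O I \<rho> (\<lambda>i. 1) x" "big_O I \<rho> (\<lambda>i. 1) y" "0 \<le> \<rho>"
  shows "big_O I \<rho> (\<lambda>i. 1) (\<lambda>i. B (ep i) (\<theta> i) (x i) (y i))"
  using big_O_B[OF assms] by simp

lemma big_O_scale_tm:
  assumes "big_O I \<rho> g x" "\<And>i. i \<in> I \<Longrightarrow> 0 \<le> g i" "1 \<le> m"
  shows "big_O I \<rho> (\<lambda>i. tm i * g i) (\<lambda>i. (c * tm i ^ m) *\<^sub>R x i)"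
proof (rule big_O_weaken[OF big_O_scale[OF assms(1), of "\<lambda>i. c * tm i ^ m"], where K = "\<bar>c\<bar>"])
  fix i assume i: "i \<in> I"
  have "\<bar>c * tm i ^ m\<bar> * g i = \<bar>c\<bar> * (tm i ^ m * g i)" using tm[OF i] by (simp add: abs_mult)
  also have "\<dots> \<le> \<bar>c\<bar> * (tm i * g i)"
    using tm_pow_le[OF i assms(3)] assms(2)[OF i] by (intro mult_left_mono mult_right_mono) auto
  finally show "\<bar>c * tm i ^ m\<bar> * g i \<le> \<bar>c\<bar> * (tm i * g i)" .
qed auto

text \<open>After subtracting the identity a factor \<open>tm\<close> is gained, since every
  nonlinear term carries at least one power of the step. This gives a Lipschitz constant 1 + C
  \<tau>, whose powers stay bounded over about 1/\<tau> steps; an arbitrary constant would not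
  do.\<close>

lemma Phi_lip:
  assumes w: "big_O I r (\<lambda>i. 1) w" and w': "big_O I r (\<lambda>i. 1) w'" and d: "big_O I r g (\<lambda>i. w i - w' i)"
    and g: "\<And>i. i \<in> I \<Longrightarrow> 0 \<le> g i"
  shows "big_O I r (\<lambda>i. tm i * g i) (\<lambda>i. Phi (ep i) (\<theta> i) (\<alpha> * tm i) (w i) - Phi (ep i) (\<theta> i) (\<alpha> * tm i) (w' i) - (w i - w' i))"
proof -
  define D where "D i = B (ep i) (\<theta> i)" for i
  note b = big_O_B1[OF _ _ r0, where \<theta> = \<theta>, folded D_def]
  note l = big_O_B_lip[OF _ _ _ _ _ _ r0, where \<theta> = \<theta>, folded D_def]
  define A A' G G' where "A i = D i (w i) (w i)" and "A' i = D i (w' i) (w' i)"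
    and "G i = D i (w i) (A i)" and "G' i = D i (w' i) (A' i)" for i
  have A: "big_O I r (\<lambda>i. 1) A" "big_O I r (\<lambda>i. 1) A'" "big_O I r g (\<lambda>i. A i - A' i)"
    unfolding A_def A'_def by (intro b l w w' d)+
  have G: "big_O I r (\<lambda>i. 1) G" "big_O I r (\<lambda>i. 1) G'" "big_O I r g (\<lambda>i. G i - G' i)"
    unfolding G_def G'_def by (intro b l w w' d A)+
  let ?y = "\<lambda>i. (- \<alpha> * tm i ^ 1) *\<^sub>R (A i - A' i) + (\<alpha>\<^sup>2 * tm i ^ 2) *\<^sub>R (G i - G' i)
      + (- (\<alpha> ^ 3 / 3) * tm i ^ 3) *\<^sub>R (D i (A i) (A i) - D i (A' i) (A' i))
      + (- (2 / 3 * \<alpha> ^ 3) * tm i ^ 3) *\<^sub>R (D i (w i) (G i) - D i (w' i) (G' i))"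
  show ?thesis
  proof (rule big_O_cong[where y = ?y])
    show "big_O I r (\<lambda>i. tm i * g i) ?y"
      by (intro big_O_add big_O_scale_tm A G l w w' d g) auto
  qed (simp add: Phi_def A_def A'_def G_def G'_def D_def algebra_simps power_mult_distrib)
qed

lemma Phi_bounded:
  assumes w: "big_O I r (\<lambda>i. 1) w"
  shows "big_O I r (\<lambda>i. 1) (\<lambda>i. Phi (ep i) (\<theta> i) (\<alpha> * tm i) (w i))"
proof -
  note b = big_O_B1[OF _ _ r0, where \<theta> = \<theta>]
  have c: "big_O I r (\<lambda>i. 1) x \<Longrightarrow> big_O I r (\<lambda>i. 1) (\<lambda>i. (c * tm i ^ m) *\<^sub>R x i)" for x c m
    using T_scale[where n = 0 and m = m and l = 0 and \<rho> = r and x = x and c = c] by simp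
  show ?thesis
  proof (rule big_O_cong)
    show "big_O I r (\<lambda>i. 1) (\<lambda>i. w i - (\<alpha> * tm i ^ 1) *\<^sub>R B (ep i) (\<theta> i) (w i) (w i) + (\<alpha>\<^sup>2 * tm i ^ 2) *\<^sub>R B (ep i) (\<theta> i) (w i) (B (ep i) (\<theta> i) (w i) (w i))
      - (\<alpha> ^ 3 / 3 * tm i ^ 3) *\<^sub>R B (ep i) (\<theta> i) (B (ep i) (\<theta> i) (w i) (w i)) (B (ep i) (\<theta> i) (w i) (w i))
      - (2 / 3 * \<alpha> ^ 3 * tm i ^ 3) *\<^sub>R B (ep i) (\<theta> i) (w i) (B (ep i) (\<theta> i) (w i) (B (ep i) (\<theta> i) (w i) (w i))))"
      by (intro big_O_add big_O_diff c b w)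
  qed (simp add: Phi_def power_mult_distrib mult_ac)
qed

lemma Phi_lip':
  assumes "big_O I r (\<lambda>i. 1) w" "big_O I r (\<lambda>i. 1) w'" "big_O I r g (\<lambda>i. w i - w' i)"
    and g: "\<And>i. i \<in> I \<Longrightarrow> 0 \<le> g i"
  shows "big_O I r g (\<lambda>i. Phi (ep i) (\<theta> i) (\<alpha> * tm i) (w i) - Phi (ep i) (\<theta> i) (\<alpha> * tm i) (w' i))"
proof (rule big_O_cong)
  have "big_O I r g (\<lambda>i. Phi (ep i) (\<theta> i) (\<alpha> * tm i) (w i) - Phi (ep i) (\<theta> i) (\<alpha> * tm i) (w' i) - (w i - w' i))"
    using tm tm1 g by (intro big_O_weaken[OF Phi_lip[OF assms], where K = 1]) (auto intro: mult_left_le_one_le)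
  then show "big_O I r g (\<lambda>i. (Phi (ep i) (\<theta> i) (\<alpha> * tm i) (w i) - Phi (ep i) (\<theta> i) (\<alpha> * tm i) (w' i) - (w i - w' i)) + (w i - w' i))"
    by (intro big_O_add assms(3))
qed simp

text \<open>The deviations from the identity of the three stages telescope, and each stage needs the
  plain Lipschitz bound of the preceding ones.\<close>

lemma twisted_step_lip:
  assumes w: "big_O I r (\<lambda>i. 1) w" and w': "big_O I r (\<lambda>i. 1) w'" and d: "big_O I r g (\<lambda>i. w i - w' i)"
    and g: "\<And>i. i \<in> I \<Longrightarrow> 0 \<le> g i"
  shows "big_O I r (\<lambda>i. tm i * g i) (\<lambda>i. twisted_step (ep i) (tm i) (w i) - twisted_step (ep i) (tm i) (w' i) - (w i - w' i))"
proof -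
  define a a' b b' where "a i = Phi (ep i) 0 (7 / 24 * tm i) (w i)" and "a' i = Phi (ep i) 0 (7 / 24 * tm i) (w' i)"
    and "b i = Phi (ep i) (2 / 3 * tm i) (3 / 4 * tm i) (a i)" and "b' i = Phi (ep i) (2 / 3 * tm i) (3 / 4 * tm i) (a' i)" for i
  have a: "big_O I r (\<lambda>i. 1) a" "big_O I r (\<lambda>i. 1) a'" "big_O I r g (\<lambda>i. a i - a' i)"
    unfolding a_def a'_def by (intro Phi_bounded Phi_lip' w w' d g; assumption)+
  have b: "big_O I r (\<lambda>i. 1) b" "big_O I r (\<lambda>i. 1) b'" "big_O I r g (\<lambda>i. b i - b' i)"
    unfolding b_def b'_def by (intro Phi_bounded Phi_lip' a g; assumption)+
  show ?thesis
  proof (rule big_O_cong)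
    show "big_O I r (\<lambda>i. tm i * g i) (\<lambda>i. (Phi (ep i) 0 (- 1 / 24 * tm i) (b i) - Phi (ep i) 0 (- 1 / 24 * tm i) (b' i) - (b i - b' i))
      + (Phi (ep i) (2 / 3 * tm i) (3 / 4 * tm i) (a i) - Phi (ep i) (2 / 3 * tm i) (3 / 4 * tm i) (a' i) - (a i - a' i))
      + (Phi (ep i) 0 (7 / 24 * tm i) (w i) - Phi (ep i) 0 (7 / 24 * tm i) (w' i) - (w i - w' i)))"
      by (intro big_O_add Phi_lip a b w w' d g; assumption)
  qed (simp add: twisted_step_def a_def a'_def b_def b'_def)
qed

end

section \<open>Expansion of the splitting step\<close>

context bbm_family
begin

text \<open>Cubic terms matter only to leading order, so their times may be reset to 0 and their
  arguments replaced by limits at the cost of one power of the step. The second conclusion has the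
  form required of an argument in the first, so the lemma can be applied to nested forms.\<close>

lemma K_B_perturb:
  assumes x: "T 0 s x" "T 0 s x'" "T 1 (s - 2 * real lam) (\<lambda>i. x i - x' i)"
    and y: "T 0 s y" "T 0 s y'" "T 1 (s - 2 * real lam) (\<lambda>i. y i - y' i)"
    and phase: "\<And>i. i \<in> I \<Longrightarrow> \<bar>\<theta> i\<bar> \<le> tm i"
  shows "K 1 (\<lambda>i. B (ep i) (\<theta> i) (x i) (y i) - B (ep i) 0 (x' i) (y' i))"
    and "T 1 (s - 2 * real lam) (\<lambda>i. B (ep i) (\<theta> i) (x i) (y i) - B (ep i) 0 (x' i) (y' i))"
proof -
  have id: "B (ep i) (\<theta> i) (x i) (y i) - B (ep i) 0 (x' i) (y' i)
      = (B (ep i) (\<theta> i) (x i) (y i) - B (ep i) 0 (x i) (y i)) + B (ep i) 0 (x i - x' i) (y i) + B (ep i) 0 (x' i) (y i - y' i)" if "i \<in> I" for i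
    using ep[OF that] by (simp add: B_linear)
  have x1: "T 0 (s - real lam) x" by (rule T_lower[OF x(1)]) auto
  have y1: "T 0 (s - real lam) y" by (rule T_lower[OF y(1)]) auto
  have x2: "T 0 (s - 2 * real lam) x'" by (rule T_lower[OF x(2)]) auto
  have y2: "T 0 (s - 2 * real lam) y" by (rule T_lower[OF y(1)]) auto
  have e: "s - 2 * real lam + real lam = s - real lam" by simp
  show "K 1 (\<lambda>i. B (ep i) (\<theta> i) (x i) (y i) - B (ep i) 0 (x' i) (y' i))"
  proof (rule big_O_cong[OF _ id])
    show "K 1 (\<lambda>i. (B (ep i) (\<theta> i) (x i) (y i) - B (ep i) 0 (x i) (y i)) + B (ep i) 0 (x i - x' i) (y i) + B (ep i) 0 (x' i) (y i - y' i))"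
      by (intro big_O_add K_B1[OF x1 y1 phase] K_B[OF x(3) y2] K_B[OF x2 y(3)]) auto
  qed
  show "T 1 (s - 2 * real lam) (\<lambda>i. B (ep i) (\<theta> i) (x i) (y i) - B (ep i) 0 (x' i) (y' i))"
  proof (rule big_O_cong[OF _ id])
    show "T 1 (s - 2 * real lam) (\<lambda>i. (B (ep i) (\<theta> i) (x i) (y i) - B (ep i) 0 (x i) (y i)) + B (ep i) 0 (x i - x' i) (y i) + B (ep i) 0 (x' i) (y i - y' i))"
      using s_bounds by (intro big_O_add T_B1[where a = 0 and b = 0] T_B[OF x(3) y2] T_B[OF x2 y(3)] phase) (auto simp only: e x1 y1)
  qed
qed

text \<open>The Taylor polynomial at 0 of v' = - B_t(v, v). Writing e for B_0(v_0, v_0), one finds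
  v'' = - D1(v_0, v_0) + 2 B_0(v_0, e) and v''' = - D2(v_0, v_0) + 4 D1(v_0, e) - 2 B_0(e, e) - 2
  B_0(v_0, v'') at time 0.\<close>

definition taylor_poly where
  "taylor_poly v0 i = (let e = B (ep i) 0 (v0 i) (v0 i) in
     v0 i + tm i *\<^sub>R (- e) + (tm i)\<^sup>2 *\<^sub>R (- (1 / 2) *\<^sub>R D1 (ep i) (v0 i) (v0 i) + B (ep i) 0 (v0 i) e)
     + tm i ^ 3 *\<^sub>R (- (1 / 6) *\<^sub>R D2 (ep i) (v0 i) (v0 i) + (2 / 3) *\<^sub>R D1 (ep i) (v0 i) e
         + (1 / 3) *\<^sub>R B (ep i) 0 (v0 i) (D1 (ep i) (v0 i) (v0 i))
         - (2 / 3) *\<^sub>R B (ep i) 0 (v0 i) (B (ep i) 0 (v0 i) e) - (1 / 3) *\<^sub>R B (ep i) 0 e e))"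

lemma T_to_r: "T 0 s x \<Longrightarrow> big_O I r (\<lambda>i. 1) x"
  using T_lower[where n = 0 and m = 0 and \<rho> = s and \<rho>' = r and x = x] s_bounds by simp

text \<open>Two expansions in succession: in the step size with the form \<open>F\<close> at time
  2/3 of the step kept intact, and then of \<open>F\<close> around \<open>E\<close>. Each occurrence
  of \<open>F\<close> is expanded only to the order that its power of the step leaves open.\<close>

lemma twisted_step_expansion:
  assumes v0: "T 0 s v0"
  shows "K 4 (\<lambda>i. twisted_step (ep i) (tm i) (v0 i) - taylor_poly v0 i)"
proof -
  have s0: "0 \<le> s" "0 \<le> s - real lam" "0 \<le> s - 2 * real lam" using s_bounds r0 by auto
  define E F where "E i = B (ep i) 0" and "F i = B (ep i) (2 / 3 * tm i)" for i
  have phase: "\<bar>2 / 3 * tm i\<bar> \<le> tm i" "\<bar>0 :: real\<bar> \<le> tm i" if "i \<in> I" for i using tm[OF that] by auto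
  have TE: "T 0 s (\<lambda>i. E i (x i) (y i))" and TF: "T 0 s (\<lambda>i. F i (x i) (y i))" if "T 0 s x" "T 0 s y" for x y
    unfolding E_def F_def using that s0 by (intro T_B[where a = 0 and b = 0 and l = 0]; simp)+
  have linE: "E i (x + y) z = E i x z + E i y z" "E i z (x + y) = E i z x + E i z y"
    "E i (x - y) z = E i x z - E i y z" "E i z (x - y) = E i z x - E i z y"
    "E i (c *\<^sub>R x) z = c *\<^sub>R E i x z" "E i z (c *\<^sub>R x) = c *\<^sub>R E i z x"
    "E i (- x) z = - E i x z" "E i z (- x) = - E i z x"
    if "i \<in> I" for i x y z c
    unfolding E_def using ep[OF that] by (auto simp: B_linear)
  have linF: "F i (x + y) z = F i x z + F i y z" "F i z (x + y) = F i z x + F i z y"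
    "F i (x - y) z = F i x z - F i y z" "F i z (x - y) = F i z x - F i z y"
    "F i (c *\<^sub>R x) z = c *\<^sub>R F i x z" "F i z (c *\<^sub>R x) = c *\<^sub>R F i z x"
    "F i (- x) z = - F i x z" "F i z (- x) = - F i z x"
    if "i \<in> I" for i x y z c
    unfolding F_def using ep[OF that] by (auto simp: B_linear)
  have symE: "E i x y = E i y x" and symF: "F i x y = F i y x" for i x y
    unfolding E_def F_def by (rule B_sym)+
  have zE: "E i x 0 = 0" "E i 0 x = 0" if "i \<in> I" for i x
    using linE(5)[OF that, of 0 0 x] linE(6)[OF that, of x 0 0] by simp_all
  define e f where "e i = E i (v0 i) (v0 i)" and "f i = F i (v0 i) (v0 i)" for i
  define b where "b i = D1 (ep i) (v0 i) (v0 i)" for i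
  define c where "c i = D1 (ep i) (v0 i) (e i)" for i
  define d where "d i = D2 (ep i) (v0 i) (v0 i)" for i
  define h where "h i = E i (v0 i) (e i)" for i
  have Te: "T 0 s e" and Tf: "T 0 s f" and Th: "T 0 s h"
    unfolding h_def e_def f_def by (intro TE TF v0)+
  \<comment> \<open>\<open>q\<close>, \<open>u\<close> and \<open>w\<close> are the coefficients
    after the first, second and third stage, copied from the general expansion with \<alpha> = 7/24,
    3/4, -1/24. The first stage starts from a constant polynomial.\<close>
  define q1 q2 q3 where "q1 i = (- 7 / 24) *\<^sub>R e i" and "q2 i = ((7 / 24)\<^sup>2) *\<^sub>R h i"
    and "q3 i = - ((7 / 24) ^ 3 / 3) *\<^sub>R E i (e i) (e i) - (2 / 3 * (7 / 24) ^ 3) *\<^sub>R E i (v0 i) (h i)" for i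
  have q: "T 0 s q1" "T 0 s q2" "T 0 s q3"
    unfolding q1_def q2_def q3_def by (intro big_O_diff T_const TE v0 Te Th)+
  define u1 u2 u3 where "u1 i = q1 i - (3 / 4) *\<^sub>R f i"
    and "u2 i = q2 i - (2 * (3 / 4)) *\<^sub>R F i (v0 i) (q1 i) + ((3 / 4)\<^sup>2) *\<^sub>R F i (v0 i) (f i)"
    and "u3 i = q3 i - (2 * (3 / 4)) *\<^sub>R F i (v0 i) (q2 i) - (3 / 4) *\<^sub>R F i (q1 i) (q1 i)
       + ((3 / 4)\<^sup>2) *\<^sub>R (F i (q1 i) (f i) + 2 *\<^sub>R F i (v0 i) (F i (v0 i) (q1 i)))
       - ((3 / 4) ^ 3 / 3) *\<^sub>R F i (f i) (f i) - (2 / 3 * (3 / 4) ^ 3) *\<^sub>R F i (v0 i) (F i (v0 i) (f i))" for i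
  have u: "T 0 s u1" "T 0 s u2" "T 0 s u3"
    unfolding u1_def u2_def u3_def by (intro big_O_add big_O_diff T_const TF TE v0 Tf q)+
  define w1 w2 w3 where "w1 i = u1 i - (- 1 / 24) *\<^sub>R e i"
    and "w2 i = u2 i - (2 * (- 1 / 24)) *\<^sub>R E i (v0 i) (u1 i) + ((- 1 / 24)\<^sup>2) *\<^sub>R E i (v0 i) (e i)"
    and "w3 i = u3 i - (2 * (- 1 / 24)) *\<^sub>R E i (v0 i) (u2 i) - (- 1 / 24) *\<^sub>R E i (u1 i) (u1 i)
       + ((- 1 / 24)\<^sup>2) *\<^sub>R (E i (u1 i) (e i) + 2 *\<^sub>R E i (v0 i) (E i (v0 i) (u1 i)))
       - ((- 1 / 24) ^ 3 / 3) *\<^sub>R E i (e i) (e i) - (2 / 3 * (- 1 / 24) ^ 3) *\<^sub>R E i (v0 i) (E i (v0 i) (e i))" for i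
  define Q U W where "Q i = v0 i + tm i *\<^sub>R q1 i + (tm i)\<^sup>2 *\<^sub>R q2 i + tm i ^ 3 *\<^sub>R q3 i"
    and "U i = v0 i + tm i *\<^sub>R u1 i + (tm i)\<^sup>2 *\<^sub>R u2 i + tm i ^ 3 *\<^sub>R u3 i"
    and "W i = v0 i + tm i *\<^sub>R w1 i + (tm i)\<^sup>2 *\<^sub>R w2 i + tm i ^ 3 *\<^sub>R w3 i" for i
  have poly: "T 0 s (\<lambda>i. v0 i + tm i *\<^sub>R x1 i + (tm i)\<^sup>2 *\<^sub>R x2 i + tm i ^ 3 *\<^sub>R x3 i)"
    if "T 0 s x1" "T 0 s x2" "T 0 s x3" for x1 x2 x3
  proof (rule big_O_cong)
    show "T 0 s (\<lambda>i. v0 i + (1 * tm i ^ 1) *\<^sub>R x1 i + (1 * tm i ^ 2) *\<^sub>R x2 i + (1 * tm i ^ 3) *\<^sub>R x3 i)"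
      by (intro big_O_add T_scale[where n = 0] that v0) auto
  qed simp
  have TQ: "T 0 s Q" and TU: "T 0 s U" unfolding Q_def U_def by (intro poly q u)+
  define y1 y2 where "y1 i = Phi (ep i) 0 (7 / 24 * tm i) (v0 i)"
    and "y2 i = Phi (ep i) (2 / 3 * tm i) (3 / 4 * tm i) (y1 i)" for i
  have 1: "K 4 (\<lambda>i. y1 i - Q i)"
    by (rule big_O_cong[OF Phi_expansion[OF v0 T_zero T_zero T_zero, where \<theta> = "\<lambda>i. 0" and \<alpha> = "7 / 24"]])
      (simp add: y1_def Q_def q1_def q2_def q3_def h_def e_def zE flip: E_def)
  have 2: "K 4 (\<lambda>i. Phi (ep i) (2 / 3 * tm i) (3 / 4 * tm i) (Q i) - U i)"
    by (rule big_O_cong[OF Phi_expansion[OF v0 q, where \<theta> = "\<lambda>i. 2 / 3 * tm i" and \<alpha> = "3 / 4"]])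
      (simp only: Q_def U_def u1_def u2_def u3_def f_def flip: F_def)
  have 3: "K 4 (\<lambda>i. Phi (ep i) 0 (- 1 / 24 * tm i) (U i) - W i)"
    by (rule big_O_cong[OF Phi_expansion[OF v0 u, where \<theta> = "\<lambda>i. 0" and \<alpha> = "- 1 / 24"]])
      (simp only: U_def W_def w1_def w2_def w3_def e_def flip: E_def)
  have g0: "0 \<le> eps_gain (ep i) * tm i ^ 4" if "i \<in> I" for i using tm[OF that] by simp
  have b1: "big_O I r (\<lambda>i. 1) y1" unfolding y1_def by (intro Phi_bounded T_to_r v0)
  have b2: "big_O I r (\<lambda>i. 1) y2" unfolding y2_def by (intro Phi_bounded b1)
  \<comment> \<open>The error of the first stage is carried through the second by its Lipschitz
    bound in H^r; it is not re-expanded.\<close>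
  have 4: "K 4 (\<lambda>i. y2 i - U i)"
  proof (rule big_O_cong)
    show "K 4 (\<lambda>i. (Phi (ep i) (2 / 3 * tm i) (3 / 4 * tm i) (y1 i) - Phi (ep i) (2 / 3 * tm i) (3 / 4 * tm i) (Q i)) + (Phi (ep i) (2 / 3 * tm i) (3 / 4 * tm i) (Q i) - U i))"
      by (intro big_O_add 2 Phi_lip'[OF b1 T_to_r[OF TQ] 1 g0])
  qed (simp add: y2_def)
  have 5: "K 4 (\<lambda>i. twisted_step (ep i) (tm i) (v0 i) - W i)"
  proof (rule big_O_cong)
    show "K 4 (\<lambda>i. (Phi (ep i) 0 (- 1 / 24 * tm i) (y2 i) - Phi (ep i) 0 (- 1 / 24 * tm i) (U i)) + (Phi (ep i) 0 (- 1 / 24 * tm i) (U i) - W i))"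
      by (intro big_O_add 3 Phi_lip'[OF b2 T_to_r[OF TU] 4 g0])
  qed (simp add: twisted_step_def y1_def y2_def)
  have v1: "T 0 (s - real lam) v0" by (rule T_lower[OF v0]) auto
  have v2: "T 0 (s - 2 * real lam) v0" by (rule T_lower[OF v0]) auto
  have v1': "T 0 (s - real lam + real lam) v0" and v2': "T 0 (s - 2 * real lam + 2 * real lam) v0"
    by (simp_all only: diff_add_cancel v0)
  have fe1: "T 1 (s - real lam) (\<lambda>i. f i - e i)"
    unfolding f_def e_def E_def F_def by (rule T_B1[OF v1' v1' s0(2) phase(1)]) auto
  have fe2: "T 2 (s - 2 * real lam) (\<lambda>i. f i - e i - (2 / 3 * tm i) *\<^sub>R b i)"
    unfolding f_def e_def b_def E_def F_def by (rule T_B2[OF v2' v2' s0(3) phase(1)]) auto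
  have X: "K 3 (\<lambda>i. f i - e i - (2 / 3 * tm i) *\<^sub>R b i - ((2 / 3 * tm i)\<^sup>2 / 2) *\<^sub>R d i)"
    unfolding f_def e_def b_def d_def E_def F_def by (intro K_B3 v0 phase)
  have Y1: "K 2 (\<lambda>i. F i (v0 i) (e i) - h i - (2 / 3 * tm i) *\<^sub>R c i)"
    unfolding c_def h_def E_def F_def by (intro K_B2[OF v0 Te] phase) auto
  have Y2: "K 2 (\<lambda>i. E i (v0 i) (f i - e i - (2 / 3 * tm i) *\<^sub>R b i))"
    unfolding E_def by (intro K_B[OF v2 fe2]) auto
  have Y3: "K 2 (\<lambda>i. F i (v0 i) (f i - e i) - E i (v0 i) (f i - e i))"
    unfolding E_def F_def by (intro K_B1[OF v1 fe1] phase) auto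
  have fe: "T 1 (s - 2 * real lam) (\<lambda>i. f i - e i)" by (rule T_lower[OF fe1]) auto
  have z: "T 1 (s - 2 * real lam) (\<lambda>i. x i - x i)" for x :: "'i \<Rightarrow> l2" using T_zero[where n = 1 and \<rho> = "s - 2 * real lam"] by simp
  note pE = K_B_perturb[where \<theta> = "\<lambda>i. 0", OF _ _ _ _ _ _ phase(2), folded E_def]
  note pF = K_B_perturb[where \<theta> = "\<lambda>i. 2 / 3 * tm i", OF _ _ _ _ _ _ phase(1), folded E_def F_def]
  have i1: "T 1 (s - 2 * real lam) (\<lambda>i. F i (v0 i) (e i) - h i)" unfolding h_def by (intro pF(2) v0 Te z)
  have i2: "T 1 (s - 2 * real lam) (\<lambda>i. F i (v0 i) (f i) - h i)" unfolding h_def by (intro pF(2) v0 Te Tf z fe)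
  have i3: "T 1 (s - 2 * real lam) (\<lambda>i. E i (v0 i) (f i) - h i)" unfolding h_def by (intro pE(2) v0 Te Tf z fe)
  \<comment> \<open>Every cubic term, whichever mixture of times it contains, has \<open>A\<close>
    or \<open>QQ\<close> as its limit: nested chains tend to \<open>A\<close>, forms of two
    quadratic images to \<open>QQ\<close>.\<close>
  define A where "A i = E i (v0 i) (h i)" for i
  define QQ where "QQ i = E i (e i) (e i)" for i
  have k1: "K 1 (\<lambda>i. F i (v0 i) (h i) - A i)" unfolding A_def by (intro pF(1) v0 Th z)
  have k2: "K 1 (\<lambda>i. F i (e i) (e i) - QQ i)" unfolding QQ_def by (intro pF(1) Te z)
  have k3: "K 1 (\<lambda>i. F i (e i) (f i) - QQ i)" unfolding QQ_def by (intro pF(1) Te Tf z fe)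
  have k4: "K 1 (\<lambda>i. F i (v0 i) (F i (v0 i) (e i)) - A i)" unfolding A_def by (intro pF(1) v0 Th TF Te z i1)
  have k5: "K 1 (\<lambda>i. F i (f i) (f i) - QQ i)" unfolding QQ_def by (intro pF(1) Te Tf z fe)
  have k6: "K 1 (\<lambda>i. F i (v0 i) (F i (v0 i) (f i)) - A i)" unfolding A_def by (intro pF(1) v0 Th TF Tf z i2)
  have k7: "K 1 (\<lambda>i. E i (v0 i) (F i (v0 i) (e i)) - A i)" unfolding A_def by (intro pE(1) v0 Th TF Te z i1)
  have k8: "K 1 (\<lambda>i. E i (v0 i) (F i (v0 i) (f i)) - A i)" unfolding A_def by (intro pE(1) v0 Th TF Tf z i2)
  have k9: "K 1 (\<lambda>i. E i (v0 i) (E i (v0 i) (f i)) - A i)" unfolding A_def by (intro pE(1) v0 Th TE Tf z i3)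
  have k10: "K 1 (\<lambda>i. E i (e i) (f i) - QQ i)" unfolding QQ_def by (intro pE(1) Te Tf z fe)
  have k11: "K 1 (\<lambda>i. E i (f i) (f i) - QQ i)" unfolding QQ_def by (intro pE(1) Te Tf z fe)
  \<comment> \<open>One summand for each cubic term that involves \<open>F\<close> or
    \<open>f\<close>. With \<open>F\<close> replaced by \<open>E\<close> all stages are Taylor flows
    of one autonomous equation, so the coefficients add up to those of the flow over 7/24 + 3/4 -
    1/24 = 1 unit of time, namely -2/3 for \<open>A\<close> and -1/3 for \<open>QQ\<close>.\<close>
  let ?y = "\<lambda>i. (- 2 * (3/4) * (7/24)^2) *\<^sub>R (F i (v0 i) (h i) - A i)
       + (- (3/4) * (7/24)^2) *\<^sub>R (F i (e i) (e i) - QQ i)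
       + (- ((3/4)^2 * (7/24))) *\<^sub>R (F i (e i) (f i) - QQ i)
       + (- 2 * (3/4)^2 * (7/24)) *\<^sub>R (F i (v0 i) (F i (v0 i) (e i)) - A i)
       + (- ((3/4)^3 / 3)) *\<^sub>R (F i (f i) (f i) - QQ i)
       + (- 2 / 3 * (3/4)^3) *\<^sub>R (F i (v0 i) (F i (v0 i) (f i)) - A i)
       + (2 * (1/24) * (2 * (7/24) * (3/4))) *\<^sub>R (E i (v0 i) (F i (v0 i) (e i)) - A i)
       + (2 * (1/24) * (3/4)^2) *\<^sub>R (E i (v0 i) (F i (v0 i) (f i)) - A i)
       + (- 2 * (1/24)^2 * (3/4)) *\<^sub>R (E i (v0 i) (E i (v0 i) (f i)) - A i)
       + ((1/24) * (2 * (7/24) * (3/4)) - (1/24)^2 * (3/4)) *\<^sub>R (E i (e i) (f i) - QQ i)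
       + ((1/24) * (3/4)^2) *\<^sub>R (E i (f i) (f i) - QQ i)"
  have Z: "K 1 (\<lambda>i. w3 i + (2 / 3) *\<^sub>R A i + (1 / 3) *\<^sub>R QQ i)"
  proof (rule big_O_cong)
    show "K 1 ?y"
      by (intro big_O_add K_const k1 k2 k3 k4 k5 k6 k7 k8 k9 k10 k11)
    fix i assume i: "i \<in> I"
    have fe': "E i (f i) (e i) = E i (e i) (f i)" "F i (f i) (e i) = F i (e i) (f i)" by (simp_all add: symE symF)
    show "w3 i + (2 / 3) *\<^sub>R A i + (1 / 3) *\<^sub>R QQ i = ?y i"
      unfolding w3_def u3_def u2_def u1_def q3_def q2_def q1_def linE[OF i] linF[OF i] fe' A_def[symmetric] QQ_def[symmetric] h_def[symmetric]
      by (rule l2_eqI) (simp add: field_simps power2_eq_square power3_eq_cube)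
  qed
  \<comment> \<open>The remaining order conditions. Linear terms: 3/4 times 2/3 is 1/2 and 3/4 times
    (2/3)^2 / 2 is 1/6. Quadratic terms: the outer \<open>F\<close> has total weight 3/4 (7/12 +
    3/4) = 1, and the inner \<open>f\<close> has weight (3/4)^2 = 9/16 under \<open>F\<close> and
    -1/16 under \<open>E\<close>, whence 9/16 on the difference and 1/2 on the rest.\<close>
  let ?y = "\<lambda>i. (twisted_step (ep i) (tm i) (v0 i) - W i)
       + ((- 3 / 4 * tm i ^ 1) *\<^sub>R (f i - e i - (2 / 3 * tm i) *\<^sub>R b i - ((2 / 3 * tm i)\<^sup>2 / 2) *\<^sub>R d i)
       + (1 * tm i ^ 2) *\<^sub>R ((F i (v0 i) (e i) - h i - (2 / 3 * tm i) *\<^sub>R c i)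
            + (9 / 16) *\<^sub>R (F i (v0 i) (f i - e i) - E i (v0 i) (f i - e i))
            + (1 / 2) *\<^sub>R E i (v0 i) (f i - e i - (2 / 3 * tm i) *\<^sub>R b i))
       + (1 * tm i ^ 3) *\<^sub>R (w3 i + (2 / 3) *\<^sub>R A i + (1 / 3) *\<^sub>R QQ i))"
  show ?thesis
  proof (rule big_O_cong)
    show "K 4 ?y"
      by (intro big_O_add 5 K_scale[OF X] K_scale[where n = 2] K_const Y1 Y2 Y3 K_scale[OF Z]) auto
    fix i assume i: "i \<in> I"
    have TTi: "taylor_poly v0 i = v0 i + tm i *\<^sub>R (- e i) + (tm i)\<^sup>2 *\<^sub>R (- (1 / 2) *\<^sub>R b i + h i)
     + tm i ^ 3 *\<^sub>R (- (1 / 6) *\<^sub>R d i + (2 / 3) *\<^sub>R c i + (1 / 3) *\<^sub>R E i (v0 i) (b i) - (2 / 3) *\<^sub>R A i - (1 / 3) *\<^sub>R QQ i)"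
      by (simp add: taylor_poly_def Let_def e_def b_def h_def d_def c_def A_def QQ_def E_def)
    show "twisted_step (ep i) (tm i) (v0 i) - taylor_poly v0 i = ?y i"
      unfolding TTi W_def w1_def w2_def u1_def u2_def q1_def q2_def linE[OF i] linF[OF i] h_def[symmetric]
      by (rule l2_eqI) (simp add: field_simps power2_eq_square power3_eq_cube)
  qed
qed

end

section \<open>Expansion of the exact solution\<close>

text \<open>Proved by applying the scalar mean value theorem to the pairing of \<open>x u\<close> with the end value \<open>x t\<close>.\<close>
lemma Hs_le_mean_value:
  assumes t: "0 \<le> t" and M: "0 \<le> M" and y: "\<And>u. u \<in> {0..t} \<Longrightarrow> Hs_le \<rho> M (y u)" and x0: "x 0 = 0"
    and x: "\<And>u k. u \<in> {0..t} \<Longrightarrow> ((\<lambda>u. coord (x u) k) has_vector_derivative coord (y u) k) (at u within {0..t})"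
  shows "Hs_le \<rho> (M * t) (x t)"
  unfolding Hs_le_def
proof (rule wl2_leI)
  fix F :: "int set" assume F: "finite F"
  define N where "N = L2_set (\<lambda>k. weight k powr \<rho> * norm (coord (x t) k)) F"
  define g where "g u = (\<Sum>k\<in>F. (weight k powr \<rho>)\<^sup>2 * Re (coord (x u) k * cnj (coord (x t) k)))" for u
  define g' where "g' u = (\<Sum>k\<in>F. (weight k powr \<rho>)\<^sup>2 * Re (coord (y u) k * cnj (coord (x t) k)))" for u
  have N0: "0 \<le> N" by (simp add: N_def)
  have der: "(g has_derivative (\<lambda>h. g' u * h)) (at u within {0..t})" if u: "0 \<le> u" "u \<le> t" for u
  proof -
    have c: "((\<lambda>u. (weight k powr \<rho>)\<^sup>2 * Re (coord (x u) k * cnj (coord (x t) k))) has_real_derivative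
        (weight k powr \<rho>)\<^sup>2 * Re (coord (y u) k * cnj (coord (x t) k))) (at u within {0..t})" for k
    proof -
      have "((\<lambda>u. coord (x u) k * cnj (coord (x t) k)) has_vector_derivative coord (y u) k * cnj (coord (x t) k)) (at u within {0..t})"
        using has_vector_derivative_mult_left[OF x[of u k]] u by simp
      from bounded_linear.has_vector_derivative[OF bounded_linear_Re this]
      have "((\<lambda>u. Re (coord (x u) k * cnj (coord (x t) k))) has_real_derivative Re (coord (y u) k * cnj (coord (x t) k))) (at u within {0..t})"
        by (simp add: has_real_derivative_iff_has_vector_derivative)
      then show ?thesis by (rule DERIV_cmult)
    qed
    have "(g has_real_derivative g' u) (at u within {0..t})"
      unfolding g_def g'_def by (rule DERIV_sum) (rule c)
    then show ?thesis by (simp add: has_field_derivative_def)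
  qed
  obtain u where u: "u \<in> {0..t}" "g t - g 0 = g' u * (t - 0)"
    using mvt_very_simple[OF t, of g "\<lambda>u h. g' u * h"] der by auto
  have "g' u \<le> (\<Sum>k\<in>F. \<bar>weight k powr \<rho> * norm (coord (y u) k)\<bar> * \<bar>weight k powr \<rho> * norm (coord (x t) k)\<bar>)"
    unfolding g'_def
  proof (rule sum_mono)
    fix k
    have "Re (coord (y u) k * cnj (coord (x t) k)) \<le> norm (coord (y u) k) * norm (coord (x t) k)"
      using complex_Re_le_cmod[of "coord (y u) k * cnj (coord (x t) k)"] by (simp add: norm_mult)
    then have "(weight k powr \<rho>)\<^sup>2 * Re (coord (y u) k * cnj (coord (x t) k)) \<le> (weight k powr \<rho>)\<^sup>2 * (norm (coord (y u) k) * norm (coord (x t) k))"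
      by (intro mult_left_mono) auto
    then show "(weight k powr \<rho>)\<^sup>2 * Re (coord (y u) k * cnj (coord (x t) k)) \<le> \<bar>weight k powr \<rho> * norm (coord (y u) k)\<bar> * \<bar>weight k powr \<rho> * norm (coord (x t) k)\<bar>"
      by (simp add: power2_eq_square mult_ac abs_mult)
  qed
  also have "\<dots> \<le> L2_set (\<lambda>k. weight k powr \<rho> * norm (coord (y u) k)) F * N"
    unfolding N_def by (rule L2_set_mult_ineq)
  also have "\<dots> \<le> M * N" using wl2_leD[OF y[OF u(1), unfolded Hs_le_def] F] N0 by (intro mult_right_mono)
  finally have "g' u \<le> M * N" .
  moreover have "g 0 = 0" by (simp add: g_def x0)
  moreover have "g t = N\<^sup>2"
    unfolding N_def L2_set_def g_def
    by (simp add: sum_nonneg power_mult_distrib flip: complex_norm_square)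
  ultimately have "N\<^sup>2 \<le> M * N * t" using u(2) t by (simp add: mult_right_mono)
  then have "N \<le> M * t" using N0 M t by (cases "N = 0") (auto simp: power2_eq_square mult_ac)
  then show "L2_set (\<lambda>k. weight k powr \<rho> * norm (coord (x t) k)) F \<le> M * t" by (simp add: N_def)
qed

context bbm
begin

text \<open>An index set for Landau bounds: \<epsilon>, a twisted solution and its final time. The
  equation is imposed coordinate by coordinate, so no calculus for functions with values in H^s is
  needed.\<close>

definition traj :: "real \<Rightarrow> (real \<times> (real \<Rightarrow> l2) \<times> real) set" where
  "traj M = {(\<epsilon>, v, t). 0 < \<epsilon> \<and> \<epsilon> \<le> 1 \<and> 0 \<le> t \<and> t \<le> 1 \<and> (\<forall>u\<in>{0..t}. Hs_le s M (v u)) \<and>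
     (\<forall>u\<in>{0..t}. \<forall>k. ((\<lambda>u. coord (v u) k) has_vector_derivative - coord (B \<epsilon> u (v u) (v u)) k) (at u within {0..t}))}"

lemma traj_shorten: assumes "(\<epsilon>, v, t) \<in> traj M" "0 \<le> u" "u \<le> t" shows "(\<epsilon>, v, u) \<in> traj M"
  using assms unfolding traj_def
  by (auto intro: has_vector_derivative_within_subset[of _ _ _ "{0..t}"])

text \<open>Integration in time raises the order by one. Since a shortened trajectory is again an
  index, the assumed bound on the derivative at final times holds at all intermediate times. The
  weight \<open>w\<close> is 1 or \<open>eps_gain\<close>, which serves both scales of
  estimates.\<close>

lemma traj_mean_value:
  assumes Y: "big_O (traj M) \<rho> (\<lambda>i. w (fst i) * snd (snd i) ^ n) Y"
    and w: "\<And>\<epsilon>. 0 \<le> w \<epsilon>"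
    and X0: "\<And>\<epsilon> v. X (\<epsilon>, v, 0) = 0"
    and X: "\<And>\<epsilon> v t u k. (\<epsilon>, v, t) \<in> traj M \<Longrightarrow> u \<in> {0..t} \<Longrightarrow>
      ((\<lambda>u. coord (X (\<epsilon>, v, u)) k) has_vector_derivative coord (Y (\<epsilon>, v, u)) k) (at u within {0..t})"
  shows "big_O (traj M) \<rho> (\<lambda>i. w (fst i) * snd (snd i) ^ Suc n) X"
proof -
  obtain C where C: "0 \<le> C" "\<And>i. i \<in> traj M \<Longrightarrow> Hs_le \<rho> (C * (w (fst i) * snd (snd i) ^ n)) (Y i)"
    using Y by (rule big_OE) blast
  show ?thesis
  proof (rule big_OI[OF C(1)])
    fix i assume i: "i \<in> traj M"
    obtain \<epsilon> v t where i_eq: "i = (\<epsilon>, v, t)" by (cases i) auto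
    have t: "0 \<le> t" using i by (auto simp: i_eq traj_def)
    have "Hs_le \<rho> ((C * (w \<epsilon> * t ^ n)) * t) (X (\<epsilon>, v, t))"
    proof (rule Hs_le_mean_value[where y = "\<lambda>u. Y (\<epsilon>, v, u)" and x = "\<lambda>u. X (\<epsilon>, v, u)"])
      fix u assume u: "u \<in> {0..t}"
      have "(\<epsilon>, v, u) \<in> traj M" using traj_shorten i u by (auto simp: i_eq)
      from C(2)[OF this] have "Hs_le \<rho> (C * (w \<epsilon> * u ^ n)) (Y (\<epsilon>, v, u))" by simp
      then show "Hs_le \<rho> (C * (w \<epsilon> * t ^ n)) (Y (\<epsilon>, v, u))"
        by (rule Hs_le_mono) (use u C(1) w in \<open>auto intro!: mult_left_mono power_mono\<close>)
    qed (use t C(1) w X0 X i in \<open>auto simp: i_eq\<close>)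
    then show "Hs_le \<rho> (C * (w (fst i) * snd (snd i) ^ Suc n)) (X i)" by (simp add: i_eq mult_ac)
  qed
qed

lemma traj_bbm_family: "bbm_family P lam \<sigma> r (traj M) fst (\<lambda>i. snd (snd i))"
  by unfold_locales (auto simp: traj_def)

lemma coord_poly_derivative:
  assumes "((\<lambda>u. coord (v u) k) has_vector_derivative D) (at u within S)"
  shows "((\<lambda>u. coord (v u - (a + u *\<^sub>R b + u\<^sup>2 *\<^sub>R c + u ^ 3 *\<^sub>R d)) k) has_vector_derivative
     D - (coord b k + of_real (2 * u) * coord c k + of_real (3 * u\<^sup>2) * coord d k)) (at u within S)"
proof -
  have p: "((\<lambda>u. of_real (f u) * z) has_vector_derivative of_real f' * z) (at u within S)"
    if "(f has_real_derivative f') (at u within S)" for f f' and z :: complex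
    using has_vector_derivative_mult_left[OF has_vector_derivative_of_real[OF that], of z] .
  have "((\<lambda>u. coord (v u) k - (coord a k + of_real u * coord b k + of_real (u\<^sup>2) * coord c k + of_real (u ^ 3) * coord d k)) has_vector_derivative
     D - (0 + of_real 1 * coord b k + of_real (2 * u) * coord c k + of_real (3 * u\<^sup>2) * coord d k)) (at u within S)"
    by (intro has_vector_derivative_diff has_vector_derivative_add assms p has_vector_derivative_const)
      (auto intro!: derivative_eq_intros)
  then show ?thesis by simp
qed

text \<open>A bootstrap: the expansion of one order is inserted into - B_t(v, v) and integrated to
  give the next. Each of the first three rounds after the trivial bound works one order higher, with
  regularities s, s - lam, s - 2 lam; the fourth is done in the \<open>K\<close> scale.\<close>

lemma exact_expansion: "big_O (traj M) r (\<lambda>i. eps_gain (fst i) * snd (snd i) ^ 4)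
   (\<lambda>i. fst (snd i) (snd (snd i)) - bbm_family.taylor_poly P fst (\<lambda>i. snd (snd i)) (\<lambda>i. fst (snd i) 0) i)"
proof -
  interpret bbm_family P lam \<sigma> r "traj M" fst "\<lambda>i. snd (snd i)" by (rule traj_bbm_family)
  define v v0 where "v = (\<lambda>i :: real \<times> (real \<Rightarrow> l2) \<times> real. fst (snd i) (snd (snd i)))"
    and "v0 = (\<lambda>i :: real \<times> (real \<Rightarrow> l2) \<times> real. fst (snd i) 0)"
  define t where "t = (\<lambda>i :: real \<times> (real \<Rightarrow> l2) \<times> real. snd (snd i))"
  define E G where "E i = B (fst i) 0" and "G i = B (fst i) (t i)" for i :: "real \<times> (real \<Rightarrow> l2) \<times> real"
  have s0: "0 \<le> s" "0 \<le> s - real lam" "0 \<le> s - 2 * real lam" using s_bounds r0 by auto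
  have ti: "snd (snd i) = t i" for i by (simp add: t_def)
  have phase: "\<bar>t i\<bar> \<le> snd (snd i)" if "i \<in> traj M" for i using tm[OF that] by (simp add: t_def)
  have linE: "E i (x + y) z = E i x z + E i y z" "E i z (x + y) = E i z x + E i z y"
    "E i (x - y) z = E i x z - E i y z" "E i z (x - y) = E i z x - E i z y"
    "E i (c *\<^sub>R x) z = c *\<^sub>R E i x z" "E i z (c *\<^sub>R x) = c *\<^sub>R E i z x"
    "E i (- x) z = - E i x z" "E i z (- x) = - E i z x"
    if "i \<in> traj M" for i x y z c
    unfolding E_def using ep[OF that] by (auto simp: B_linear)
  have linG: "G i (x + y) z = G i x z + G i y z" "G i z (x + y) = G i z x + G i z y"
    "G i (x - y) z = G i x z - G i y z" "G i z (x - y) = G i z x - G i z y"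
    "G i (c *\<^sub>R x) z = c *\<^sub>R G i x z" "G i z (c *\<^sub>R x) = c *\<^sub>R G i z x"
    "G i (- x) z = - G i x z" "G i z (- x) = - G i z x"
    if "i \<in> traj M" for i x y z c
    unfolding G_def using ep[OF that] by (auto simp: B_linear)
  have symE: "E i x y = E i y x" and symG: "G i x y = G i y x" for i x y
    unfolding E_def G_def by (rule B_sym)+
  have M0: "Hs_le s \<bar>M\<bar> (v i)" "Hs_le s \<bar>M\<bar> (v0 i)" if "i \<in> traj M" for i
    using that by (auto simp: traj_def v_def v0_def intro: Hs_le_mono[of s M])
  have Tv: "T 0 s v" and Tv0: "T 0 s v0" using M0 by (auto intro!: big_OI[of "\<bar>M\<bar>"])
  define e b c d h where "e i = E i (v0 i) (v0 i)" and "b i = D1 (fst i) (v0 i) (v0 i)" and "c i = D1 (fst i) (v0 i) (e i)"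
    and "d i = D2 (fst i) (v0 i) (v0 i)" and "h i = E i (v0 i) (e i)" for i
  have Te: "T 0 s e" unfolding e_def E_def by (intro T_B[OF Tv0 Tv0] s0) auto
  have Th: "T 0 s h" unfolding h_def E_def by (intro T_B[OF Tv0 Te] s0) auto
  have Tb: "T 0 (s - real lam) b" unfolding b_def by (rule T_D1[where a = 0 and b = 0]) (simp_all only: diff_add_cancel Tv0 s0)
  define v2 where "v2 i = - (1 / 2) *\<^sub>R b i + h i" for i
  define v3 where "v3 i = - (1 / 6) *\<^sub>R d i + (2 / 3) *\<^sub>R c i + (1 / 3) *\<^sub>R E i (v0 i) (b i) - (2 / 3) *\<^sub>R E i (v0 i) (h i) - (1 / 3) *\<^sub>R E i (e i) (e i)" for i
  have TTi: "taylor_poly v0 i = v0 i + t i *\<^sub>R (- e i) + (t i)\<^sup>2 *\<^sub>R v2 i + t i ^ 3 *\<^sub>R v3 i" for i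
    by (simp add: taylor_poly_def Let_def e_def b_def h_def d_def c_def v2_def v3_def E_def t_def)
  \<comment> \<open>The coefficients depend on the initial value only, which is what the conditions
    on \<open>z1\<close>, \<open>z2\<close>, \<open>z3\<close> express, so the polynomial is
    differentiated in its explicit powers of time.\<close>
  have mv: "big_O (traj M) \<rho> (\<lambda>i. w (fst i) * snd (snd i) ^ Suc n) (\<lambda>i. v i - (v0 i + t i *\<^sub>R z1 i + (t i)\<^sup>2 *\<^sub>R z2 i + t i ^ 3 *\<^sub>R z3 i))"
    if Y: "big_O (traj M) \<rho> (\<lambda>i. w (fst i) * snd (snd i) ^ n) (\<lambda>i. - G i (v i) (v i) - (z1 i + (2 * t i) *\<^sub>R z2 i + (3 * (t i)\<^sup>2) *\<^sub>R z3 i))"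
      and w: "\<And>\<epsilon>. 0 \<le> w \<epsilon>" and z: "\<And>\<epsilon> v u. z1 (\<epsilon>, v, u) = z1 (\<epsilon>, v, 0)" "\<And>\<epsilon> v u. z2 (\<epsilon>, v, u) = z2 (\<epsilon>, v, 0)" "\<And>\<epsilon> v u. z3 (\<epsilon>, v, u) = z3 (\<epsilon>, v, 0)"
    for \<rho> w n z1 z2 z3
  proof (rule traj_mean_value[OF Y w])
    fix \<epsilon> f show "v (\<epsilon>, f, 0) - (v0 (\<epsilon>, f, 0) + t (\<epsilon>, f, 0) *\<^sub>R z1 (\<epsilon>, f, 0) + (t (\<epsilon>, f, 0))\<^sup>2 *\<^sub>R z2 (\<epsilon>, f, 0) + t (\<epsilon>, f, 0) ^ 3 *\<^sub>R z3 (\<epsilon>, f, 0)) = 0"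
      by (simp add: v_def v0_def t_def)
  next
    fix \<epsilon> f a u k assume i: "(\<epsilon>, f, a) \<in> traj M" and u: "u \<in> {0..a}"
    then have der: "((\<lambda>u. coord (f u) k) has_vector_derivative - coord (B \<epsilon> u (f u) (f u)) k) (at u within {0..a})"
      by (auto simp: traj_def)
    define \<zeta>1 \<zeta>2 \<zeta>3 where "\<zeta>1 = z1 (\<epsilon>, f, 0)" and "\<zeta>2 = z2 (\<epsilon>, f, 0)" and "\<zeta>3 = z3 (\<epsilon>, f, 0)"
    have zf: "z1 (\<epsilon>, f, u) = \<zeta>1" "z2 (\<epsilon>, f, u) = \<zeta>2" "z3 (\<epsilon>, f, u) = \<zeta>3" for u
      unfolding \<zeta>1_def \<zeta>2_def \<zeta>3_def by (rule z)+
    from coord_poly_derivative[OF der, of "f 0" \<zeta>1 \<zeta>2 \<zeta>3]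
    show "((\<lambda>u. coord (v (\<epsilon>, f, u) - (v0 (\<epsilon>, f, u) + t (\<epsilon>, f, u) *\<^sub>R z1 (\<epsilon>, f, u) + (t (\<epsilon>, f, u))\<^sup>2 *\<^sub>R z2 (\<epsilon>, f, u) + t (\<epsilon>, f, u) ^ 3 *\<^sub>R z3 (\<epsilon>, f, u))) k)
      has_vector_derivative coord (- G (\<epsilon>, f, u) (v (\<epsilon>, f, u)) (v (\<epsilon>, f, u)) - (z1 (\<epsilon>, f, u) + (2 * t (\<epsilon>, f, u)) *\<^sub>R z2 (\<epsilon>, f, u) + (3 * (t (\<epsilon>, f, u))\<^sup>2) *\<^sub>R z3 (\<epsilon>, f, u))) k) (at u within {0..a})"
      by (simp add: v_def v0_def t_def G_def zf)
  qed
  have mvT: "T (Suc n) \<rho> (\<lambda>i. v i - (v0 i + t i *\<^sub>R z1 i + (t i)\<^sup>2 *\<^sub>R z2 i + t i ^ 3 *\<^sub>R z3 i))"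
    if "T n \<rho> (\<lambda>i. - G i (v i) (v i) - (z1 i + (2 * t i) *\<^sub>R z2 i + (3 * (t i)\<^sup>2) *\<^sub>R z3 i))"
      and "\<And>\<epsilon> v u. z1 (\<epsilon>, v, u) = z1 (\<epsilon>, v, 0)" "\<And>\<epsilon> v u. z2 (\<epsilon>, v, u) = z2 (\<epsilon>, v, 0)" "\<And>\<epsilon> v u. z3 (\<epsilon>, v, u) = z3 (\<epsilon>, v, 0)"
    for n \<rho> z1 z2 z3
    using mv[of \<rho> "\<lambda>_. 1" n z1 z2 z3] that by simp
  have ce: "e (\<epsilon>, f, u) = e (\<epsilon>, f, 0)" "v2 (\<epsilon>, f, u) = v2 (\<epsilon>, f, 0)" "v3 (\<epsilon>, f, u) = v3 (\<epsilon>, f, 0)" for \<epsilon> f u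
    by (simp_all add: e_def v2_def v3_def b_def h_def c_def d_def v0_def E_def)
  have ce': "- e (\<epsilon>, f, u) = - e (\<epsilon>, f, 0)" for \<epsilon> f u using ce(1)[of \<epsilon> f u] by simp
  have w1: "T 1 s (\<lambda>i. v i - v0 i)"
  proof -
    have Y: "T 0 s (\<lambda>i. - G i (v i) (v i))" unfolding G_def by (intro big_O_minus T_B[OF Tv Tv] s0) auto
    show ?thesis using mvT[where n = 0 and \<rho> = s and ?z1.0 = "\<lambda>_. 0" and ?z2.0 = "\<lambda>_. 0" and ?z3.0 = "\<lambda>_. 0"] Y by simp
  qed
  have Tl: "T n \<rho> x \<Longrightarrow> T n (\<rho> - real lam) x" "T n \<rho> x \<Longrightarrow> T n (\<rho> - 2 * real lam) x" for n \<rho> x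
    by (erule T_lower; simp)+
  have Tv0': "T 0 (s - real lam + real lam) v0" and Tv0'': "T 0 (s - 2 * real lam + 2 * real lam) v0"
    by (simp_all only: diff_add_cancel Tv0)
  have w2: "T 2 (s - real lam) (\<lambda>i. v i - v0 i + t i *\<^sub>R e i)"
  proof -
    have Y: "T 1 (s - real lam) (\<lambda>i. - ((G i (v0 i) (v0 i) - e i) + G i (v i - v0 i) (v i) + G i (v0 i) (v i - v0 i)))"
      unfolding G_def e_def E_def
      by (intro big_O_minus big_O_add T_B1[OF Tv0' Tv0'] T_B[OF Tl(1)[OF w1] Tl(1)[OF Tv]] T_B[OF Tl(1)[OF Tv0] Tl(1)[OF w1]] s0 phase) auto
    have "T 1 (s - real lam) (\<lambda>i. - G i (v i) (v i) - (- e i + (2 * t i) *\<^sub>R 0 + (3 * (t i)\<^sup>2) *\<^sub>R 0))"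
      by (rule big_O_cong[OF Y]) (simp add: linG)
    from mvT[OF this ce' refl refl] show ?thesis by (simp add: numeral_2_eq_2 algebra_simps)
  qed
  have Tw1: "T 1 (s - real lam) (\<lambda>i. v i - v0 i)" by (rule Tl[OF w1])
  have w3: "T 3 (s - 2 * real lam) (\<lambda>i. v i - v0 i + t i *\<^sub>R e i - (t i)\<^sup>2 *\<^sub>R v2 i)"
  proof -
    \<comment> \<open>With \<delta> = v - v0, the form at v is G(v0, v0) + 2 G(v0, \<delta>) +
      G(\<delta>, \<delta>). The middle term is corrected by the first-order part - t e of \<delta>,
      and the term t G(v0, e) thus released is compared with t h.\<close>
    let ?y = "\<lambda>i. - ((G i (v0 i) (v0 i) - e i - t i *\<^sub>R b i)
       + 2 *\<^sub>R G i (v0 i) (v i - v0 i + t i *\<^sub>R e i) - (2 * snd (snd i) ^ 1) *\<^sub>R (G i (v0 i) (e i) - h i)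
       + G i (v i - v0 i) (v i - v0 i))"
    have Y: "T 2 (s - 2 * real lam) ?y"
      unfolding G_def e_def E_def b_def h_def
    proof (rule big_O_minus, rule big_O_add, rule big_O_diff, rule big_O_add)
      show "T 2 (s - 2 * real lam) (\<lambda>i. B (fst i) (t i) (v0 i) (v0 i) - B (fst i) 0 (v0 i) (v0 i) - t i *\<^sub>R D1 (fst i) (v0 i) (v0 i))"
        by (intro T_B2[OF Tv0'' Tv0''] s0 phase) auto
      have "T 2 (s - 2 * real lam) (\<lambda>i. v i - v0 i + t i *\<^sub>R e i)" by (rule T_lower[OF w2]) auto
      from T_B[OF Tl(2)[OF Tv0] this s0(3), where l = 2 and \<theta> = t]
      show "T 2 (s - 2 * real lam) (\<lambda>i. 2 *\<^sub>R B (fst i) (t i) (v0 i) (v i - v0 i + t i *\<^sub>R B (fst i) 0 (v0 i) (v0 i)))"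
        by (intro T_const) (auto simp: e_def E_def)
      have "T 1 (s - 2 * real lam) (\<lambda>i. B (fst i) (t i) (v0 i) (e i) - B (fst i) 0 (v0 i) (e i))"
      proof (rule T_B1[where a = 0 and b = 0])
        show "T 0 (s - 2 * real lam + real lam) v0" by (rule T_lower[OF Tv0]) auto
        show "T 0 (s - 2 * real lam + real lam) e" by (rule T_lower[OF Te]) auto
      qed (use s0 phase in auto)
      from T_scale[OF this, where c = 2 and m = 1 and l = 2] show "T 2 (s - 2 * real lam) (\<lambda>i. (2 * snd (snd i) ^ 1) *\<^sub>R (B (fst i) (t i) (v0 i) (B (fst i) 0 (v0 i) (v0 i)) - B (fst i) 0 (v0 i) (B (fst i) 0 (v0 i) (v0 i))))"
        by (simp add: e_def E_def)
      show "T 2 (s - 2 * real lam) (\<lambda>i. B (fst i) (t i) (v i - v0 i) (v i - v0 i))"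
        by (intro T_B[OF Tl(2)[OF w1] Tl(2)[OF w1]] s0) auto
    qed
    have "T 2 (s - 2 * real lam) (\<lambda>i. - G i (v i) (v i) - (- e i + (2 * t i) *\<^sub>R v2 i + (3 * (t i)\<^sup>2) *\<^sub>R 0))"
    proof (rule big_O_cong[OF Y])
      fix i assume i: "i \<in> traj M"
      have sy: "G i (v i) (v0 i) = G i (v0 i) (v i)" by (rule symG)
      show "- G i (v i) (v i) - (- e i + (2 * t i) *\<^sub>R v2 i + (3 * (t i)\<^sup>2) *\<^sub>R 0) = ?y i"
        unfolding v2_def linG[OF i] sy by (rule l2_eqI) (simp add: algebra_simps ti)
    qed
    from mvT[OF this ce' ce(2) refl] show ?thesis by (simp add: numeral_3_eq_3 numeral_2_eq_2 algebra_simps)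
  qed
  have w4: "K 4 (\<lambda>i. v i - (v0 i + t i *\<^sub>R (- e i) + (t i)\<^sup>2 *\<^sub>R v2 i + t i ^ 3 *\<^sub>R v3 i))"
  proof -
    \<comment> \<open>\<open>b\<close> contains one phase and is controlled only up to
      \<open>s - lam\<close>, the regularity demanded of the arguments in the first-order remainder
      estimate.\<close>
    have Tv2: "T 0 (s - real lam) v2" unfolding v2_def
      using T_const[OF Tb, of "- (1 / 2)"] Tl(1)[OF Th] by (rule big_O_add)
    have Tw2: "T 2 (s - 2 * real lam) (\<lambda>i. v i - v0 i + t i *\<^sub>R e i)" by (rule T_lower[OF w2]) auto
    \<comment> \<open>The same decomposition one order further: \<delta> is corrected to second
      order inside G(v0, \<delta>), and G(\<delta>, \<delta>) is G(\<delta> + t e, \<delta>) - t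
      G(e, \<delta> + t e) + t^2 G(e, e).\<close>
    let ?y = "\<lambda>i. - ((G i (v0 i) (v0 i) - e i - t i *\<^sub>R b i - ((t i)\<^sup>2 / 2) *\<^sub>R d i)
       + 2 *\<^sub>R G i (v0 i) (v i - v0 i + t i *\<^sub>R e i - (t i)\<^sup>2 *\<^sub>R v2 i)
       - (2 * snd (snd i) ^ 1) *\<^sub>R (G i (v0 i) (e i) - h i - t i *\<^sub>R c i)
       + (2 * snd (snd i) ^ 2) *\<^sub>R (G i (v0 i) (v2 i) - E i (v0 i) (v2 i))
       + G i (v i - v0 i + t i *\<^sub>R e i) (v i - v0 i)
       - (1 * snd (snd i) ^ 1) *\<^sub>R G i (e i) (v i - v0 i + t i *\<^sub>R e i)
       + (1 * snd (snd i) ^ 2) *\<^sub>R (G i (e i) (e i) - E i (e i) (e i)))"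
    have Y: "K 3 ?y"
    proof (rule big_O_minus, rule big_O_add, rule big_O_diff, rule big_O_add, rule big_O_add, rule big_O_diff, rule big_O_add)
      show "K 3 (\<lambda>i. G i (v0 i) (v0 i) - e i - t i *\<^sub>R b i - ((t i)\<^sup>2 / 2) *\<^sub>R d i)"
        unfolding G_def e_def E_def b_def d_def by (intro K_B3 Tv0 phase)
      show "K 3 (\<lambda>i. 2 *\<^sub>R G i (v0 i) (v i - v0 i + t i *\<^sub>R e i - (t i)\<^sup>2 *\<^sub>R v2 i))"
        unfolding G_def by (intro K_const K_B[OF Tl(2)[OF Tv0] w3]) auto
      have "K 2 (\<lambda>i. G i (v0 i) (e i) - h i - t i *\<^sub>R c i)"
        unfolding G_def h_def E_def c_def by (intro K_B2[OF Tv0 Te] phase) auto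
      then show "K 3 (\<lambda>i. (2 * snd (snd i) ^ 1) *\<^sub>R (G i (v0 i) (e i) - h i - t i *\<^sub>R c i))"
        by (rule K_scale) auto
      have "K 1 (\<lambda>i. G i (v0 i) (v2 i) - E i (v0 i) (v2 i))"
        unfolding G_def E_def by (intro K_B1[OF Tl(1)[OF Tv0] Tv2] phase) auto
      then show "K 3 (\<lambda>i. (2 * snd (snd i) ^ 2) *\<^sub>R (G i (v0 i) (v2 i) - E i (v0 i) (v2 i)))"
        by (rule K_scale) auto
      show "K 3 (\<lambda>i. G i (v i - v0 i + t i *\<^sub>R e i) (v i - v0 i))"
        unfolding G_def by (intro K_B[OF Tw2 Tl(2)[OF w1]]) auto
      have "K 2 (\<lambda>i. G i (e i) (v i - v0 i + t i *\<^sub>R e i))"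
        unfolding G_def by (intro K_B[OF Tl(2)[OF Te] Tw2]) auto
      then show "K 3 (\<lambda>i. (1 * snd (snd i) ^ 1) *\<^sub>R G i (e i) (v i - v0 i + t i *\<^sub>R e i))"
        by (rule K_scale) auto
      have "K 1 (\<lambda>i. G i (e i) (e i) - E i (e i) (e i))"
        unfolding G_def E_def by (intro K_B1[OF Tl(1)[OF Te] Tl(1)[OF Te]] phase) auto
      then show "K 3 (\<lambda>i. (1 * snd (snd i) ^ 2) *\<^sub>R (G i (e i) (e i) - E i (e i) (e i)))"
        by (rule K_scale) auto
    qed
    have "K 3 (\<lambda>i. - G i (v i) (v i) - (- e i + (2 * t i) *\<^sub>R v2 i + (3 * (t i)\<^sup>2) *\<^sub>R v3 i))"
    proof (rule big_O_cong[OF Y])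
      fix i assume i: "i \<in> traj M"
      have sy: "G i (v i) (v0 i) = G i (v0 i) (v i)" "G i (e i) (v0 i) = G i (v0 i) (e i)" "G i (v i) (e i) = G i (e i) (v i)"
        "G i (v0 i) (e i) = G i (e i) (v0 i)" by (rule symG)+
      have EV: "E i (v0 i) (v2 i) = - (1 / 2) *\<^sub>R E i (v0 i) (b i) + E i (v0 i) (h i)" unfolding v2_def linE[OF i] by simp
      show "- G i (v i) (v i) - (- e i + (2 * t i) *\<^sub>R v2 i + (3 * (t i)\<^sup>2) *\<^sub>R v3 i) = ?y i"
        unfolding EV v3_def linG[OF i] sy(1,2,3)
        by (rule l2_eqI) (simp add: field_simps power2_eq_square v2_def ti)
    qed
    from mv[OF this eps_gain_nonneg ce' ce(2,3)] show ?thesis by (simp add: numeral_eq_Suc)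
  qed
  show ?thesis using w4 by (simp only: TTi[symmetric]) (simp add: v_def v0_def)
qed

section \<open>Local error and stability with explicit quantifiers\<close>

lemma local_error:
  "\<exists>C\<ge>0. \<forall>\<epsilon> v t. (\<epsilon>, v, t) \<in> traj M \<longrightarrow> Hs_le r (C * (eps_gain \<epsilon> * t ^ 4)) (twisted_step \<epsilon> t (v 0) - v t)"
proof -
  interpret bbm_family P lam \<sigma> r "traj M" fst "\<lambda>i. snd (snd i)" by (rule traj_bbm_family)
  have "T 0 s (\<lambda>i. fst (snd i) 0)"
    by (intro big_OI[of "\<bar>M\<bar>"]) (auto simp: traj_def intro: Hs_le_mono[of s M])
  from big_O_diff[OF twisted_step_expansion[OF this] exact_expansion]
  have "K 4 (\<lambda>i. twisted_step (fst i) (snd (snd i)) (fst (snd i) 0) - fst (snd i) (snd (snd i)))"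
    by (simp add: algebra_simps)
  then obtain C where "0 \<le> C" "\<And>i. i \<in> traj M \<Longrightarrow> Hs_le r (C * (eps_gain (fst i) * snd (snd i) ^ 4)) (twisted_step (fst i) (snd (snd i)) (fst (snd i) 0) - fst (snd i) (snd (snd i)))"
    by (rule big_OE) blast
  then show ?thesis by (intro exI[of _ C]) force
qed

text \<open>The distance bound \<open>d\<close> is made part of the index, so the constant obtained
  is the same at every scale of the difference; the radius \<open>R\<close> alone determines
  it.\<close>

lemma stability:
  "\<exists>C\<ge>0. \<forall>\<epsilon> t x y d. 0 < \<epsilon> \<and> \<epsilon> \<le> 1 \<and> 0 \<le> t \<and> t \<le> 1 \<and> Hs_le r R x \<and> Hs_le r R y \<and> Hs_le r d (x - y)
     \<longrightarrow> Hs_le r ((1 + C * t) * d) (twisted_step \<epsilon> t x - twisted_step \<epsilon> t y)"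
proof -
  define I :: "(real \<times> real \<times> l2 \<times> l2 \<times> real) set" where "I = {(\<epsilon>, t, x, y, d). 0 < \<epsilon> \<and> \<epsilon> \<le> 1 \<and> 0 \<le> t \<and> t \<le> 1 \<and> Hs_le r R x \<and> Hs_le r R y \<and> Hs_le r d (x - y)}"
  interpret bbm_family P lam \<sigma> r I fst "\<lambda>i. fst (snd i)"
    by unfold_locales (auto simp: I_def)
  have "big_O I r (\<lambda>i. 1) (\<lambda>i. fst (snd (snd i)))" "big_O I r (\<lambda>i. 1) (\<lambda>i. fst (snd (snd (snd i))))"
    by (intro big_OI[of "\<bar>R\<bar>"]; auto simp: I_def intro: Hs_le_mono[of r R])+
  moreover have "big_O I r (\<lambda>i. snd (snd (snd (snd i)))) (\<lambda>i. fst (snd (snd i)) - fst (snd (snd (snd i))))"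
    by (intro big_OI[of 1]) (auto simp: I_def)
  ultimately have "big_O I r (\<lambda>i. fst (snd i) * snd (snd (snd (snd i)))) (\<lambda>i. twisted_step (fst i) (fst (snd i)) (fst (snd (snd i))) - twisted_step (fst i) (fst (snd i)) (fst (snd (snd (snd i))))
       - (fst (snd (snd i)) - fst (snd (snd (snd i)))))"
    by (rule twisted_step_lip) (auto simp: I_def Hs_le_nonneg)
  then obtain C where C: "0 \<le> C" "\<And>i. i \<in> I \<Longrightarrow> Hs_le r (C * (fst (snd i) * snd (snd (snd (snd i))))) (twisted_step (fst i) (fst (snd i)) (fst (snd (snd i))) - twisted_step (fst i) (fst (snd i)) (fst (snd (snd (snd i))))
       - (fst (snd (snd i)) - fst (snd (snd (snd i)))))"
    by (rule big_OE) blast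
  show ?thesis
  proof (intro exI[of _ C] conjI allI impI C(1))
    fix \<epsilon> t d :: real and x y assume A: "0 < \<epsilon> \<and> \<epsilon> \<le> 1 \<and> 0 \<le> t \<and> t \<le> 1 \<and> Hs_le r R x \<and> Hs_le r R y \<and> Hs_le r d (x - y)"
    then have "Hs_le r (C * (t * d)) (twisted_step \<epsilon> t x - twisted_step \<epsilon> t y - (x - y))"
      using C(2)[of "(\<epsilon>, t, x, y, d)"] by (simp add: I_def)
    from Hs_le_add[OF this, of d "x - y"] A show "Hs_le r ((1 + C * t) * d) (twisted_step \<epsilon> t x - twisted_step \<epsilon> t y)"
      by (simp add: algebra_simps)
  qed
qed

end

section \<open>From functions to coefficients and the global error\<close>

lemma fourier_mult_scale: "fourier_mult m (\<lambda>y. c * f y) x = c * fourier_mult m f x"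
proof -
  have "fourier_coeff (\<lambda>y. c * f y) k = c * fourier_coeff f k" for k
    by (simp add: fourier_coeff_torus mult.assoc)
  then have "fourier_mult m (\<lambda>y. c * f y) x = (\<Sum>\<^sub>\<infinity>k. c * (m k * fourier_coeff f k * cis (of_int k * x)))"
    by (simp add: fourier_mult_def mult_ac)
  also have "\<dots> = c * fourier_mult m f x"
    unfolding fourier_mult_def by (rule infsum_cmult_right')
  finally show ?thesis .
qed

text \<open>Each power of \<epsilon> is absorbed into one application of the operator, so that the
  flow is built from the single bilinear map that becomes \<open>B\<close> at time 0.\<close>

lemma num_flow1_eq:
  fixes \<epsilon> t :: real
  defines "A \<equiv> \<lambda>f x. of_real \<epsilon> * L_eps \<epsilon> f x"
  shows "num_flow1 \<epsilon> t w x = w x - of_real t * A (\<lambda>y. w y * w y) x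
     + of_real (t\<^sup>2) * A (\<lambda>y. w y * A (\<lambda>y. w y * w y) y) x
     - of_real (t ^ 3 / 3) * A (\<lambda>y. A (\<lambda>y. w y * w y) y * A (\<lambda>y. w y * w y) y) x
     - of_real (2 / 3 * t ^ 3) * A (\<lambda>y. w y * A (\<lambda>y. w y * A (\<lambda>y. w y * w y) y) y) x"
proof -
  have L: "L_eps \<epsilon> (\<lambda>y. of_real \<epsilon> * f y) = (\<lambda>x. of_real \<epsilon> * L_eps \<epsilon> f x)" for f
    unfolding L_eps_def using fourier_mult_scale by blast
  define W where "W = L_eps \<epsilon> (\<lambda>y. w y * w y)"
  define V where "V = L_eps \<epsilon> (\<lambda>y. w y * W y)"
  have 1: "A (\<lambda>y. w y * w y) = (\<lambda>x. of_real \<epsilon> * W x)" by (simp add: A_def W_def)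
  have 2: "A (\<lambda>y. w y * (of_real \<epsilon> * W y)) = (\<lambda>x. of_real \<epsilon> * (of_real \<epsilon> * V x))"
    using L[of "\<lambda>y. w y * W y"] by (simp add: A_def V_def mult.left_commute)
  have 3: "A (\<lambda>y. w y * (of_real \<epsilon> * (of_real \<epsilon> * V y))) x = of_real \<epsilon> * (of_real \<epsilon> * (of_real \<epsilon> * L_eps \<epsilon> (\<lambda>y. w y * V y) x))"
    using L[of "\<lambda>y. of_real \<epsilon> * (w y * V y)"] L[of "\<lambda>y. w y * V y"] by (simp add: A_def mult.left_commute)
  have 4: "A (\<lambda>y. of_real \<epsilon> * W y * (of_real \<epsilon> * W y)) x = of_real \<epsilon> * (of_real \<epsilon> * (of_real \<epsilon> * L_eps \<epsilon> (\<lambda>y. W y * W y) x))"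
    using L[of "\<lambda>y. of_real \<epsilon> * (W y * W y)"] L[of "\<lambda>y. W y * W y"] by (simp add: A_def mult.left_commute mult.assoc)
  define X Y where "X = L_eps \<epsilon> (\<lambda>y. W y * W y) x" and "Y = L_eps \<epsilon> (\<lambda>y. w y * V y) x"
  have "num_flow1 \<epsilon> t w x = w x - of_real (t * \<epsilon>) * W x + of_real (t\<^sup>2 * \<epsilon>\<^sup>2) * V x
    - of_real (t ^ 3 / 3 * \<epsilon> ^ 3) * X - of_real (2 / 3 * t ^ 3 * \<epsilon> ^ 3) * Y"
    unfolding num_flow1_def Let_def X_def Y_def V_def W_def power2_eq_square[of "_ :: complex"] ..
  then show ?thesis
    unfolding 1 2 3 4 X_def[symmetric] Y_def[symmetric] by (simp add: power2_eq_square power3_eq_cube mult_ac)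
qed

section \<open>The scheme on functions and the scheme on coefficients\<close>

context bbm
begin

lemma s_ge: "1 \<le> s" "real lam + 1 \<le> s" "r \<le> s"
  using lam1' r0 sig1 by (auto simp: s_def)

text \<open>The group that twists the solution, inverse in time to \<open>flow2\<close>. Since the
  symbol is imaginary, it preserves every bound \<open>Hs_le\<close>.\<close>

definition G where "G \<epsilon> t x = Abs_l2 (\<lambda>k. exp (of_real t * L_symbol P \<epsilon> k) * coord x k)"

lemma norm_exp_L_symbol [simp]: "norm (exp (of_real t * L_symbol P \<epsilon> k)) = 1"
  by simp

lemma coord_G: "coord (G \<epsilon> t x) k = exp (of_real t * L_symbol P \<epsilon> k) * coord x k"
proof -
  obtain M where "wl2_le 0 M (coord x)" using Hs_le_exists[of x] by (auto simp: Hs_le_def)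
  then have "wl2_le 0 M (\<lambda>k. exp (of_real t * L_symbol P \<epsilon> k) * coord x k)"
    by (rule wl2_le_dominated) (simp add: norm_mult)
  from coord_Abs[OF this] show ?thesis by (simp add: G_def)
qed

lemma Hs_le_G: "Hs_le \<rho> M x \<Longrightarrow> Hs_le \<rho> M (G \<epsilon> t x)"
  unfolding Hs_le_def by (erule wl2_le_dominated) (simp add: coord_G norm_mult)

lemma G_linear: "G \<epsilon> t (x + y) = G \<epsilon> t x + G \<epsilon> t y" "G \<epsilon> t (x - y) = G \<epsilon> t x - G \<epsilon> t y"
  "G \<epsilon> t (c *\<^sub>R x) = c *\<^sub>R G \<epsilon> t x"
  by (rule l2_eqI; simp add: coord_G algebra_simps)+

lemma G_G: "G \<epsilon> t (G \<epsilon> u x) = G \<epsilon> (t + u) x" and G_0 [simp]: "G \<epsilon> 0 x = x"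
  by (rule l2_eqI; simp add: coord_G exp_add distrib_right)+

lemma coord_B:
  assumes e: "0 < \<epsilon>"
  shows "coord (B \<epsilon> t x y) k = (\<Sum>\<^sub>\<infinity>j. phase_kernel P 0 \<epsilon> t k j * coord x j * coord y (k - j))"
proof -
  obtain M N where "Hs_le 0 M x" "Hs_le 0 N y" using Hs_le_exists by meson
  from admissible_Bil(3)[OF adm0[OF e] this] show ?thesis by (simp add: B_def kernel_sum_def)
qed

lemma G_B: assumes e: "0 < \<epsilon>" shows "G \<epsilon> t (B \<epsilon> \<theta> x y) = B \<epsilon> (\<theta> + t) (G \<epsilon> t x) (G \<epsilon> t y)"
proof (rule l2_eqI)
  fix k
  have "exp (of_real t * L_symbol P \<epsilon> k) * (phase_kernel P 0 \<epsilon> \<theta> k j * coord x j * coord y (k - j))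
      = phase_kernel P 0 \<epsilon> (\<theta> + t) k j * coord (G \<epsilon> t x) j * coord (G \<epsilon> t y) (k - j)" for j
  proof -
    have "exp (of_real (\<theta> + t) * phase P \<epsilon> k j) * exp (of_real t * L_symbol P \<epsilon> j) * exp (of_real t * L_symbol P \<epsilon> (k - j))
      = exp (of_real t * L_symbol P \<epsilon> k) * exp (of_real \<theta> * phase P \<epsilon> k j)"
      by (simp add: phase_def algebra_simps flip: exp_add)
    then show ?thesis unfolding phase_kernel_def coord_G by (simp add: mult_ac)
  qed
  then show "coord (G \<epsilon> t (B \<epsilon> \<theta> x y)) k = coord (B \<epsilon> (\<theta> + t) (G \<epsilon> t x) (G \<epsilon> t y)) k"
    unfolding coord_B[OF e] coord_G[of _ _ "B \<epsilon> \<theta> x y"] by (simp flip: infsum_cmult_right')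
qed

lemma G_Phi: "0 < \<epsilon> \<Longrightarrow> G \<epsilon> t (Phi \<epsilon> \<theta> \<tau> w) = Phi \<epsilon> (\<theta> + t) \<tau> (G \<epsilon> t w)"
  by (simp add: Phi_def G_linear G_B)

definition Step where
  "Step \<epsilon> \<tau> x = G \<epsilon> (- \<tau>) (Phi \<epsilon> 0 (- 1 / 24 * \<tau>) (G \<epsilon> (2 / 3 * \<tau>)
     (Phi \<epsilon> 0 (3 / 4 * \<tau>) (G \<epsilon> (- (2 / 3 * \<tau>)) (Phi \<epsilon> 0 (7 / 24 * \<tau>) x)))))"

lemma Step_eq: "0 < \<epsilon> \<Longrightarrow> Step \<epsilon> \<tau> x = G \<epsilon> (- \<tau>) (twisted_step \<epsilon> \<tau> x)"
  by (simp add: Step_def twisted_step_def G_Phi G_G)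

definition represents_Hs where "represents_Hs f x \<longleftrightarrow> represents f (coord x) \<and> (\<exists>M. Hs_le s M x)"

lemma represents_Hs_represents: "represents_Hs f x \<Longrightarrow> represents f (coord x)" by (simp add: represents_Hs_def)

lemma represents_Hs_add: "represents_Hs f x \<Longrightarrow> represents_Hs g y \<Longrightarrow> represents_Hs (\<lambda>z. f z + g z) (x + y)"
  unfolding represents_Hs_def coord_fun using represents_add Hs_le_add by blast
lemma represents_Hs_scale: "represents_Hs f x \<Longrightarrow> represents_Hs (\<lambda>z. of_real c * f z) (c *\<^sub>R x)"
  unfolding represents_Hs_def coord_fun using represents_scale Hs_le_scaleR by blast
lemma represents_Hs_diff: "represents_Hs f x \<Longrightarrow> represents_Hs g y \<Longrightarrow> represents_Hs (\<lambda>z. f z - g z) (x - y)"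
  using represents_Hs_add[of f x "\<lambda>z. of_real (-1) * g z" "(-1) *\<^sub>R y"] represents_Hs_scale[of g y "-1"] by simp

lemma represents_Hs_flow2: assumes "represents_Hs f x" shows "represents_Hs (flow2 P \<epsilon> t f) (G \<epsilon> (- t) x)"
proof -
  have a: "coord x abs_summable_on UNIV" using assms by (simp add: represents_Hs_def represents_def)
  have c: "coord (G \<epsilon> (- t) x) = (\<lambda>k. exp (of_real (- t) * L_symbol P \<epsilon> k) * coord x k)"
    by (simp add: fun_eq_iff coord_G)
  have "represents (flow2 P \<epsilon> t f) (coord (G \<epsilon> (- t) x))"
    unfolding flow2_def exp_L_def c using a
    by (intro represents_fourier_mult[OF represents_Hs_represents[OF assms]]) (simp add: norm_mult)
  then show ?thesis using assms by (auto simp: represents_Hs_def intro: Hs_le_G)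
qed

lemma Hs_le_B: "0 < \<epsilon> \<Longrightarrow> 0 \<le> \<rho> \<Longrightarrow> Hs_le \<rho> M x \<Longrightarrow> Hs_le \<rho> N y \<Longrightarrow> Hs_le \<rho> (4 * (M * N)) (B \<epsilon> t x y)"
  using Hs_le_phase_kernel_T[of \<epsilon> \<rho> 0 M x N y t] by (simp add: B_def)

lemma coord_B0: assumes e: "0 < \<epsilon>" shows "coord (B \<epsilon> 0 x y) k = eL_symbol \<epsilon> k * conv (coord x) (coord y) k"
  unfolding coord_B[OF e] conv_def by (simp add: phase_kernel_def mult.assoc infsum_cmult_right')

lemma represents_Hs_B:
  assumes e: "0 < \<epsilon>" and f: "represents_Hs f x" and g: "represents_Hs g y"
  shows "represents_Hs (\<lambda>z. of_real \<epsilon> * L_eps \<epsilon> (\<lambda>y. f y * g y) z) (B \<epsilon> 0 x y)"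
proof -
  define m where "m k = \<i> * of_int k / (1 + of_real \<epsilon> * (of_int k)\<^sup>2)" for k :: int
  have eL_symbol: "eL_symbol \<epsilon> k = of_real \<epsilon> * m k" for k by (simp add: eL_symbol_def m_def)
  have c: "conv (coord x) (coord y) abs_summable_on UNIV"
    using f g by (intro conv_abs_summable) (auto simp: represents_Hs_def represents_def)
  \<comment> \<open>A bound that degenerates as \<epsilon> tends to 0 is enough here: only
    summability is at stake, while sizes are controlled by \<open>Hs_le_B\<close>.\<close>
  have mb: "norm (m k) \<le> 2 / \<epsilon>" for k
  proof -
    have "\<epsilon> * norm (m k) \<le> 2 * weight k powr -1" using eL_symbol_bound[OF e, of k] e by (simp add: eL_symbol norm_mult)
    also have "\<dots> \<le> 2 * 1" by (intro mult_left_mono) (auto simp: powr_minus_divide weight_def)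
    finally show ?thesis using e by (simp add: field_simps)
  qed
  have "(\<lambda>k. m k * conv (coord x) (coord y) k) abs_summable_on UNIV"
  proof (rule Infinite_Sum.abs_summable_on_comparison_test[OF abs_summable_scale[OF c, of "of_real (2 / \<epsilon>)"]])
    fix k show "norm (m k * conv (coord x) (coord y) k) \<le> norm (of_real (2 / \<epsilon>) * conv (coord x) (coord y) k)"
      unfolding norm_mult norm_of_real using mb[of k] e by (intro mult_right_mono) auto
  qed
  from represents_scale[OF represents_fourier_mult[OF represents_mult[OF represents_Hs_represents[OF f] represents_Hs_represents[OF g]] this], of "of_real \<epsilon>"]
  have "represents (\<lambda>z. of_real \<epsilon> * L_eps \<epsilon> (\<lambda>y. f y * g y) z) (coord (B \<epsilon> 0 x y))"
    unfolding L_eps_def m_def[abs_def, symmetric] by (simp add: coord_B0[OF e, THEN ext] eL_symbol mult.assoc)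
  then show ?thesis using f g Hs_le_B[OF e, of s _ x _ y 0] s_ge by (force simp: represents_Hs_def)
qed

lemma represents_Hs_num_flow1:
  assumes e: "0 < \<epsilon>" and w: "represents_Hs w x" shows "represents_Hs (num_flow1 \<epsilon> t w) (Phi \<epsilon> 0 t x)"
  unfolding Phi_def num_flow1_eq[abs_def]
  by (intro represents_Hs_add represents_Hs_diff represents_Hs_scale represents_Hs_B[OF e] w)

lemma represents_Hs_splitting_step:
  assumes e: "0 < \<epsilon>" and w: "represents_Hs f x" shows "represents_Hs (splitting_step P \<epsilon> \<tau> f) (Step \<epsilon> \<tau> x)"
proof -
  have m: "- 2 / 3 * \<tau> = - (2 / 3 * \<tau>)" by simp
  have "represents_Hs (flow2 P \<epsilon> (- 2 / 3 * \<tau>) g) (G \<epsilon> (2 / 3 * \<tau>) y)" if "represents_Hs g y" for g y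
    using represents_Hs_flow2[OF that, of \<epsilon> "- 2 / 3 * \<tau>"] by simp
  then show ?thesis
    unfolding splitting_step_def Step_def o_apply
    using e w by (simp only: represents_Hs_flow2 represents_Hs_num_flow1)
qed

lemma represents_Hs_splitting_iterate:
  "0 < \<epsilon> \<Longrightarrow> represents_Hs f x \<Longrightarrow> represents_Hs ((splitting_step P \<epsilon> \<tau> ^^ n) f) ((Step \<epsilon> \<tau> ^^ n) x)"
  by (induction n) (auto intro: represents_Hs_splitting_step)

lemma fourier_series_l1_bound:
  assumes "\<And>F. finite F \<Longrightarrow> (\<Sum>k\<in>F. norm (a k)) \<le> C"
  shows "a abs_summable_on UNIV" "norm (fourier_series a x) \<le> C"
proof -
  show "a abs_summable_on UNIV" by (rule norm_infsum_le_finite_sums(1)[OF assms])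
  show "norm (fourier_series a x) \<le> C"
    unfolding fourier_series_def by (rule norm_infsum_le_finite_sums(2)) (use assms in \<open>simp add: norm_mult\<close>)
qed

section \<open>The coefficient equation\<close>

definition coeff_solution :: "real \<Rightarrow> real \<Rightarrow> real \<Rightarrow> (real \<Rightarrow> l2) \<Rightarrow> bool" where
  "coeff_solution \<epsilon> T M U \<longleftrightarrow> 0 < \<epsilon> \<and> \<epsilon> \<le> 1 \<and> (\<forall>t\<in>{0..T}. Hs_le s M (U t)) \<and>
     (\<forall>t\<in>{0..T}. \<forall>k. ((\<lambda>t. coord (U t) k) has_vector_derivative - L_symbol P \<epsilon> k * coord (U t) k - coord (B \<epsilon> 0 (U t) (U t)) k) (at t within {0..T}))"

definition cubic_error :: "real \<Rightarrow> real \<Rightarrow> real \<Rightarrow> (real \<Rightarrow> l2) \<Rightarrow> bool" where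
  "cubic_error \<epsilon> T K U \<longleftrightarrow> (\<exists>\<tau>0>0. \<forall>\<tau> n. 0 < \<tau> \<and> \<tau> \<le> \<tau>0 \<and> real n * \<tau> \<le> T \<longrightarrow> Hs_le r (eps_gain \<epsilon> * \<tau> ^ 3 * K) (U (real n * \<tau>) - (Step \<epsilon> \<tau> ^^ n) (U 0)))"

text \<open>Because \<open>lam + 1 \<le> s\<close>, the coefficients of the linear term are
  absolutely summable with a bound uniform in time, as are those of the nonlinear one. The pointwise
  right-hand side is therefore bounded, which is what differentiation of Fourier coefficients asks
  for.\<close>

lemma coefficient_ode:
  assumes e: "0 < \<epsilon>" and sol: "bbm_solution P \<epsilon> T u"
    and represents_Hs: "\<And>t. t \<in> {0..T} \<Longrightarrow> represents (u t) (coord (U t))" and Hs_le: "\<And>t. t \<in> {0..T} \<Longrightarrow> Hs_le s M (U t)"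
    and t: "t \<in> {0..T}"
  shows "((\<lambda>t. coord (U t) k) has_vector_derivative - L_symbol P \<epsilon> k * coord (U t) k - coord (B \<epsilon> 0 (U t) (U t)) k) (at t within {0..T})"
proof -
  obtain C where C: "0 \<le> C" "\<And>\<epsilon> k. 0 < \<epsilon> \<Longrightarrow> norm (L_symbol P \<epsilon> k) \<le> C * weight k powr real lam"
    using L_symbol_bound by blast
  define R where "R t x = - L_eps_lam P \<epsilon> (u t) x - of_real \<epsilon> * L_eps \<epsilon> (\<lambda>y. (u t y)\<^sup>2) x" for t x
  define \<alpha> where "\<alpha> t k = L_symbol P \<epsilon> k * coord (U t) k" for t k
  define \<beta> where "\<beta> t = coord (B \<epsilon> 0 (U t) (U t))" for t
  have a: "(\<Sum>k\<in>F. norm (\<alpha> t k)) \<le> C * (2 * M)" if t: "t \<in> {0..T}" and F: "finite F" for t F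
  proof -
    have "(\<Sum>k\<in>F. norm (\<alpha> t k)) \<le> (\<Sum>k\<in>F. C * (weight k powr real lam * norm (coord (U t) k)))"
      unfolding \<alpha>_def norm_mult mult.assoc[symmetric] using C(2)[OF e] by (intro sum_mono mult_right_mono) auto
    also have "\<dots> = C * (\<Sum>k\<in>F. weight k powr real lam * norm (coord (U t) k))" by (simp add: sum_distrib_left)
    also have "\<dots> \<le> C * (2 * M)"
      using wl2_le_imp_l1[OF Hs_le_mono[OF Hs_le[OF t] s_ge(2) order_refl, unfolded Hs_le_def] F] C(1) by (intro mult_left_mono)
    finally show ?thesis .
  qed
  have b: "(\<Sum>k\<in>F. norm (\<beta> t k)) \<le> 2 * (4 * (M * M))" if t: "t \<in> {0..T}" and F: "finite F" for t F
  proof -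
    have "Hs_le 1 (4 * (M * M)) (B \<epsilon> 0 (U t) (U t))"
      using Hs_le_mono[OF Hs_le[OF t] s_ge(1) order_refl] by (intro Hs_le_B e) auto
    then have "wl2_le (0 + 1) (4 * (M * M)) (\<beta> t)" by (simp add: Hs_le_def \<beta>_def)
    from wl2_le_imp_l1[OF this F] show ?thesis by simp
  qed
  have rpU: "represents_Hs (u t) (U t)" if "t \<in> {0..T}" for t using represents_Hs[OF that] Hs_le[OF that] by (auto simp: represents_Hs_def)
  have Leps: "of_real \<epsilon> * L_eps \<epsilon> (\<lambda>y. (u t y)\<^sup>2) x = fourier_series (\<beta> t) x" if t: "t \<in> {0..T}" for t x
  proof -
    have "fourier_coeff (\<lambda>y. u t y * u t y) = conv (coord (U t)) (coord (U t))"
      by (rule represents_coeff[OF represents_mult[OF represents_Hs[OF t] represents_Hs[OF t]]])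
    then show ?thesis
      unfolding L_eps_def fourier_mult_def fourier_series_def \<beta>_def power2_eq_square[of "u t _"]
      by (simp add: coord_B0[OF e] eL_symbol_def mult.assoc flip: infsum_cmult_right')
  qed
  have LR: "R t x = - fourier_series (\<alpha> t) x - fourier_series (\<beta> t) x" if t: "t \<in> {0..T}" for t x
    unfolding R_def Leps[OF t] L_eps_lam_def fourier_mult_def represents_coeff[OF represents_Hs[OF t]] by (simp add: fourier_series_def \<alpha>_def)
  note FA = fourier_series_l1_bound[OF a] and FB = fourier_series_l1_bound[OF b]
  have repR: "represents (R t) (\<lambda>k. - \<alpha> t k - \<beta> t k)" if t: "t \<in> {0..T}" for t
    unfolding LR[OF t, THEN ext] using represents_diff[OF represents_scale[OF represents_fourier_series[OF FA(1)[OF t]], of "-1"] represents_fourier_series[OF FB(1)[OF t]]] by simp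
  have "((\<lambda>t. fourier_coeff (u t) k) has_vector_derivative fourier_coeff (R t) k) (at t within {0..T})"
  proof (rule fourier_coeff_derivative[where C = "C * (2 * M) + 2 * (4 * (M * M))"])
    show "((\<lambda>s. u s x) has_vector_derivative R t x) (at t within {0..T})" if "t \<in> {0..T}" for t x
      using sol that unfolding bbm_solution_def R_def by blast
    show "norm (R t x) \<le> C * (2 * M) + 2 * (4 * (M * M))" if t: "t \<in> {0..T}" for t x
    proof -
      have "norm (- fourier_series (\<alpha> t) x - fourier_series (\<beta> t) x) \<le> norm (fourier_series (\<alpha> t) x) + norm (fourier_series (\<beta> t) x)"
        using norm_triangle_ineq4[of "- fourier_series (\<alpha> t) x"] by simp
      then show ?thesis unfolding LR[OF t] using FA(2)[OF t, of x] FB(2)[OF t, of x] by linarith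
    qed
    show "R t \<in> borel_measurable torus" if "t \<in> {0..T}" for t
      using repR[OF that] by (intro measurable_torus) (simp add: represents_def)
    show "integrable torus (u t)" if t: "t \<in> {0..T}" for t
      using represents_sobolev(1)[OF represents_Hs[OF t] Hs_le[OF t, unfolded Hs_le_def]] by (rule sobolev_integrable)
  qed (use t in auto)
  then have "((\<lambda>t. fourier_coeff (u t) k) has_vector_derivative - \<alpha> t k - \<beta> t k) (at t within {0..T})"
    by (simp add: represents_coeff[OF repR[OF t]])
  then show ?thesis
    by (rule has_vector_derivative_transform[OF t, rotated 1, THEN has_vector_derivative_eq_rhs])
      (auto simp: represents_coeff[OF represents_Hs] \<alpha>_def \<beta>_def)
qed

text \<open>The product rule cancels the linear term against the derivative of the twist, and
  conjugation turns the form at time 0 into the form at time t. The trajectory starts at the time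
  \<open>a\<close> of the current step.\<close>

lemma exact_traj:
  assumes sol: "coeff_solution \<epsilon> T M U"
    and a: "0 \<le> a" "a + \<tau> \<le> T" and \<tau>: "0 \<le> \<tau>" "\<tau> \<le> 1"
  shows "(\<epsilon>, \<lambda>t. G \<epsilon> t (U (a + t)), \<tau>) \<in> traj M"
proof -
  have e: "0 < \<epsilon>" "\<epsilon> \<le> 1" and Hs_le: "\<And>t. t \<in> {0..T} \<Longrightarrow> Hs_le s M (U t)"
    and ode: "\<And>t k. t \<in> {0..T} \<Longrightarrow> ((\<lambda>t. coord (U t) k) has_vector_derivative - L_symbol P \<epsilon> k * coord (U t) k - coord (B \<epsilon> 0 (U t) (U t)) k) (at t within {0..T})"
    using sol unfolding coeff_solution_def by blast+
  show ?thesis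
  unfolding traj_def mem_Collect_eq prod.case
proof (intro conjI ballI allI e \<tau>)
  fix t assume t: "t \<in> {0..\<tau>}"
  then have aT: "a + t \<in> {0..T}" using a by auto
  show "Hs_le s M (G \<epsilon> t (U (a + t)))" by (rule Hs_le_G[OF Hs_le[OF aT]])
  fix k
  have "((\<lambda>t. coord (U t) k) \<circ> (\<lambda>t. a + t) has_vector_derivative 1 *\<^sub>R (- L_symbol P \<epsilon> k * coord (U (a + t)) k - coord (B \<epsilon> 0 (U (a + t)) (U (a + t))) k)) (at t within {0..\<tau>})"
  proof (rule vector_diff_chain_within)
    show "((\<lambda>t. a + t) has_vector_derivative 1) (at t within {0..\<tau>})" by (auto intro!: derivative_eq_intros)
    show "((\<lambda>t. coord (U t) k) has_vector_derivative - L_symbol P \<epsilon> k * coord (U (a + t)) k - coord (B \<epsilon> 0 (U (a + t)) (U (a + t))) k) (at (a + t) within (\<lambda>t. a + t) ` {0..\<tau>})"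
      by (rule has_vector_derivative_within_subset[OF ode[OF aT]]) (use a in auto)
  qed
  then have 1: "((\<lambda>t. coord (U (a + t)) k) has_vector_derivative (- L_symbol P \<epsilon> k * coord (U (a + t)) k - coord (B \<epsilon> 0 (U (a + t)) (U (a + t))) k)) (at t within {0..\<tau>})"
    by (simp add: o_def)
  have "((\<lambda>t. exp (t *\<^sub>R L_symbol P \<epsilon> k)) has_vector_derivative exp (t *\<^sub>R L_symbol P \<epsilon> k) * L_symbol P \<epsilon> k) (at t within {0..\<tau>})"
    by (rule exp_scaleR_has_vector_derivative_right)
  from has_vector_derivative_mult[OF this 1]
  show "((\<lambda>u. coord (G \<epsilon> u (U (a + u))) k) has_vector_derivative - coord (B \<epsilon> t (G \<epsilon> t (U (a + t))) (G \<epsilon> t (U (a + t)))) k) (at t within {0..\<tau>})"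
    using G_B[OF e(1), of t 0 "U (a + t)" "U (a + t)"]
    by (simp add: coord_G scaleR_conv_of_real algebra_simps flip: G_B[OF e(1), of t 0 "U (a + t)" "U (a + t)", simplified])
qed
qed

lemma sum_power_le_exp:
  assumes "0 \<le> c" shows "(\<Sum>j<n. (1 + c) ^ j) \<le> real n * exp (real n * c)"
proof -
  have "(1 + c) ^ j \<le> exp (real n * c)" if "j < n" for j
  proof -
    have "(1 + c) ^ j \<le> (1 + c) ^ n" using that assms by (intro power_increasing) auto
    also have "\<dots> \<le> exp c ^ n" using assms exp_ge_add_one_self[of c] by (intro power_mono) auto
    also have "\<dots> = exp (real n * c)" by (simp add: exp_of_nat_mult)
    finally show ?thesis .
  qed
  then show ?thesis using sum_bounded_above[of "{..<n}" "\<lambda>j. (1 + c) ^ j" "exp (real n * c)"] by simp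
qed

text \<open>Local errors propagated by the stability bound (Lady Windermere's fan). Stability holds
  on a ball only, so the induction must also keep the numerical solution in the ball of radius
  \<open>M + 1\<close>, and it does so through the error bound itself.\<close>

lemma global_error:
  assumes T: "0 < T"
  shows "\<exists>K>0. \<forall>\<epsilon> U. coeff_solution \<epsilon> T M U \<longrightarrow> cubic_error \<epsilon> T K U"
proof -
  obtain C where C: "0 \<le> C" "\<And>\<epsilon> v t. (\<epsilon>, v, t) \<in> traj M \<Longrightarrow> Hs_le r (C * (eps_gain \<epsilon> * t ^ 4)) (twisted_step \<epsilon> t (v 0) - v t)"
    using local_error by blast
  obtain D where D: "0 \<le> D" "\<And>\<epsilon> t x y d. 0 < \<epsilon> \<and> \<epsilon> \<le> 1 \<and> 0 \<le> t \<and> t \<le> 1 \<and> Hs_le r (M + 1) x \<and> Hs_le r (M + 1) y \<and> Hs_le r d (x - y)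
     \<Longrightarrow> Hs_le r ((1 + D * t) * d) (twisted_step \<epsilon> t x - twisted_step \<epsilon> t y)"
    using stability[of "M + 1"] by blast
  \<comment> \<open>The added 1 gives \<open>K \<ge> 1\<close>, so that the step bound
    \<open>1 / K\<close> is positive and at most 1.\<close>
  define K where "K = C * T * exp (D * T) + 1"
  have K: "1 \<le> K" using C(1) T by (simp add: K_def)
  show ?thesis
  proof (rule exI[of _ K], intro conjI allI impI)
    show "0 < K" using K by simp
    fix \<epsilon> U assume sol: "coeff_solution \<epsilon> T M U"
    then have e: "0 < \<epsilon>" "\<epsilon> \<le> 1" and hbU: "\<And>t. t \<in> {0..T} \<Longrightarrow> Hs_le s M (U t)"
      unfolding coeff_solution_def by blast+
    have kp1: "eps_gain \<epsilon> \<le> 1" by (rule eps_gain_le1[OF e])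
    show "cubic_error \<epsilon> T K U"
      unfolding cubic_error_def
    \<comment> \<open>For \<tau> \<le> \<open>1 / K\<close> the error bound
      \<open>eps_gain \<epsilon> * \<tau> ^ 3 * K\<close> is at most 1, the distance between the
      radii \<open>M\<close> and \<open>M + 1\<close>.\<close>
    proof (intro exI[of _ "1 / K"] conjI allI impI)
      show "0 < 1 / K" using K by simp
      fix \<tau> :: real and n :: nat assume "0 < \<tau> \<and> \<tau> \<le> 1 / K \<and> real n * \<tau> \<le> T"
      then have \<tau>: "0 < \<tau>" "\<tau> \<le> 1 / K" and n: "real n * \<tau> \<le> T" by auto
      have "1 / K \<le> 1" using K by simp
      then have \<tau>1: "\<tau> \<le> 1" using \<tau> by linarith
      \<comment> \<open>The solution, starting from 0, of the recursion in which each step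
        multiplies by \<open>1 + D * \<tau>\<close> and adds the local error. At most T / \<tau>
        steps turn the local order 4 into the global order 3.\<close>
      define E where "E n = C * (eps_gain \<epsilon> * \<tau> ^ 4) * (\<Sum>j<n. (1 + D * \<tau>) ^ j)" for n
      have E_le: "E n \<le> eps_gain \<epsilon> * \<tau> ^ 3 * K" if n: "real n * \<tau> \<le> T" for n
      proof -
        have "\<tau> * (\<Sum>j<n. (1 + D * \<tau>) ^ j) \<le> \<tau> * (real n * exp (real n * (D * \<tau>)))"
          using \<tau> D by (intro mult_left_mono sum_power_le_exp) auto
        also have "\<dots> = (real n * \<tau>) * exp (D * (real n * \<tau>))" by (simp add: mult_ac)
        also have "\<dots> \<le> T * exp (D * T)" using n D(1) T \<tau> by (intro mult_mono) (auto intro: mult_left_mono)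
        finally have "C * eps_gain \<epsilon> * \<tau> ^ 3 * (\<tau> * (\<Sum>j<n. (1 + D * \<tau>) ^ j)) \<le> C * eps_gain \<epsilon> * \<tau> ^ 3 * (T * exp (D * T))"
          using C(1) \<tau> by (intro mult_left_mono) auto
        also have "\<dots> = eps_gain \<epsilon> * \<tau> ^ 3 * (C * T * exp (D * T))" by (simp add: mult_ac)
        also have "\<dots> \<le> eps_gain \<epsilon> * \<tau> ^ 3 * K" using \<tau> by (intro mult_left_mono) (auto simp: K_def)
        finally show ?thesis by (simp add: E_def power_numeral_reduce mult_ac)
      qed
      have K\<tau>: "eps_gain \<epsilon> * \<tau> ^ 3 * K \<le> 1"
      proof -
        have "\<tau> ^ 3 \<le> \<tau> ^ 1" using \<tau> \<tau>1 by (intro power_decreasing) auto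
        then have "\<tau> ^ 3 * K \<le> \<tau> * K" using K by (intro mult_right_mono) auto
        also have "\<dots> \<le> 1" using \<tau>(2) K by (simp add: field_simps)
        finally have "\<tau> ^ 3 * K \<le> 1" .
        then have "eps_gain \<epsilon> * (\<tau> ^ 3 * K) \<le> 1 * 1" using kp1 \<tau> K by (intro mult_mono) auto
        then show ?thesis by (simp add: mult.assoc)
      qed
      have "Hs_le r (E n) ((Step \<epsilon> \<tau> ^^ n) (U 0) - U (real n * \<tau>))" if "real n * \<tau> \<le> T" for n
        using that
      proof (induction n)
        case 0
        then show ?case by (simp add: E_def Hs_le_zero)
      next
        case (Suc n)
        define X where "X = (Step \<epsilon> \<tau> ^^ n) (U 0)"
        define a where "a = real n * \<tau>"
        have aT: "a + \<tau> \<le> T" using Suc.prems by (simp add: a_def algebra_simps)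
        have a: "0 \<le> a" "a \<le> T" using \<tau> aT by (auto simp: a_def)
        have IH: "Hs_le r (E n) (X - U a)" using Suc.IH a by (simp add: X_def a_def)
        have Ua: "Hs_le r M (U a)" using hbU[of a] a s_ge(3) by (auto intro: Hs_le_mono)
        \<comment> \<open>Here the induction hypothesis closes the ball condition: the iterate is
          within distance 1 of the exact solution, hence within the domain of the stability
          constant.\<close>
        have "E n \<le> 1" using order_trans[OF E_le K\<tau>] a by (simp add: a_def)
        then have X: "Hs_le r (M + 1) X" using Hs_le_mono[OF Hs_le_add[OF IH Ua] order_refl, of "M + 1"] by simp
        have "Hs_le r (M + 1) (U a)" by (rule Hs_le_mono[OF Ua]) auto
        then have st: "Hs_le r ((1 + D * \<tau>) * E n) (twisted_step \<epsilon> \<tau> X - twisted_step \<epsilon> \<tau> (U a))" using D(2) e \<tau> \<tau>1 X IH by simp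
        have "(\<epsilon>, \<lambda>t. G \<epsilon> t (U (a + t)), \<tau>) \<in> traj M"
          by (rule exact_traj[OF sol a(1) aT]) (use \<tau> \<tau>1 in auto)
        from C(2)[OF this] have lo: "Hs_le r (C * (eps_gain \<epsilon> * \<tau> ^ 4)) (twisted_step \<epsilon> \<tau> (U a) - G \<epsilon> \<tau> (U (a + \<tau>)))" by simp
        \<comment> \<open>Both estimates were made in twisted form; undoing the twist costs nothing,
          since the linear group preserves the bounds.\<close>
        from Hs_le_G[OF Hs_le_add[OF st lo], of \<epsilon> "- \<tau>"]
        have "Hs_le r ((1 + D * \<tau>) * E n + C * (eps_gain \<epsilon> * \<tau> ^ 4)) (Step \<epsilon> \<tau> X - U (a + \<tau>))"
          by (simp add: Step_eq[OF e(1)] G_linear G_G)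
        moreover have "(1 + D * \<tau>) * E n + C * (eps_gain \<epsilon> * \<tau> ^ 4) = E (Suc n)"
          unfolding E_def sum.lessThan_Suc_shift by (simp add: sum_distrib_left algebra_simps)
        ultimately show ?case by (simp add: X_def a_def algebra_simps)
      qed
      from Hs_le_minus[OF this[OF n]] E_le[OF n] show "Hs_le r (eps_gain \<epsilon> * \<tau> ^ 3 * K) (U (real n * \<tau>) - (Step \<epsilon> \<tau> ^^ n) (U 0))"
        by (auto intro: Hs_le_mono)
    qed
  qed
qed

end

theorem theorem8:
  fixes P :: "complex poly" and lam :: nat and \<sigma> r T :: real
  assumes "degree P = lam" and "lam \<ge> 1"
    and "\<And>x::real. Re (poly P (\<i> * of_real x)) = 0"
    and "0 \<le> \<sigma>" and "\<sigma> \<le> 1" and "r \<ge> 0"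
    and "r + 1 + 3 * real lam - 2 * \<sigma> > 1 / 2"
    and "T > 0"
  shows "\<exists>K :: real \<Rightarrow> real. (\<forall>M. K M > 0) \<and>
    (\<forall>(\<epsilon>::real) (u :: real \<Rightarrow> real \<Rightarrow> complex).
       0 < \<epsilon> \<and> \<epsilon> \<le> 1 \<and>
       continuous_into_sobolev T (r + 1 + 3 * real lam - 2 * \<sigma>) u \<and>
       bbm_solution P \<epsilon> T u \<longrightarrow>
       (\<exists>\<tau>\<^sub>0>0. \<forall>(\<tau>::real) (n::nat). 0 < \<tau> \<and> \<tau> \<le> \<tau>\<^sub>0 \<and> real n * \<tau> \<le> T \<longrightarrow>
          (\<lambda>x. u (real n * \<tau>) x - (splitting_step P \<epsilon> \<tau> ^^ n) (u 0) x) \<in> sobolev r \<and>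
          sobolev_norm r (\<lambda>x. u (real n * \<tau>) x - (splitting_step P \<epsilon> \<tau> ^^ n) (u 0) x)
            \<le> \<epsilon> powr (1 - \<sigma>) * \<tau> ^ 3 *
              K (SUP t\<in>{0..T}. sobolev_norm (r + 1 + 3 * real lam - 2 * \<sigma>) (u t))))"
proof -
  interpret bbm P lam \<sigma> r by standard (use assms in auto)
  \<comment> \<open>The constant is selected for each \<open>M\<close> before \<epsilon> and the
    solution are fixed, so it is a function of the supremum of the solution norm and uniform in
    \<epsilon>.\<close>
  have "\<forall>M. \<exists>K>0. \<forall>\<epsilon> U. coeff_solution \<epsilon> T M U \<longrightarrow> cubic_error \<epsilon> T K U"
    using global_error[OF assms(8)] by blast
  then obtain K where K: "\<And>M. 0 < K M"
    and err: "\<And>M \<epsilon> U. coeff_solution \<epsilon> T M U \<Longrightarrow> cubic_error \<epsilon> T (K M) U"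
    by metis
  show ?thesis
    unfolding s_def[symmetric] eps_gain_def[symmetric]
  proof (intro exI[of _ K] conjI allI impI K)
    fix \<epsilon> u assume A: "0 < \<epsilon> \<and> \<epsilon> \<le> 1 \<and> continuous_into_sobolev T s u \<and> bbm_solution P \<epsilon> T u"
    define M where "M = (SUP t\<in>{0..T}. sobolev_norm s (u t))"
    define U where "U t = Abs_l2 (fourier_coeff (u t))" for t
    have us: "u t \<in> sobolev s" if "t \<in> {0..T}" for t using A that by (auto simp: continuous_into_sobolev_def)
    have hbdM: "wl2_le s M (fourier_coeff (u t))" if t: "t \<in> {0..T}" for t
    proof (rule wl2_le_mono[OF sobolev_wl2_le[OF us[OF t]] order_refl])
      show "sobolev_norm s (u t) \<le> M"
        unfolding M_def by (rule cSUP_upper[OF t continuous_into_sobolev_bdd]) (use A in auto)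
    qed
    have cU: "coord (U t) = fourier_coeff (u t)" if "t \<in> {0..T}" for t
      unfolding U_def by (rule coord_Abs[OF hbdM[OF that]]) (use s_ge(1) in simp)
    have hbU: "Hs_le s M (U t)" if "t \<in> {0..T}" for t using hbdM[OF that] cU[OF that] by (simp add: Hs_le_def)
    have repU: "represents (u t) (coord (U t))" if "t \<in> {0..T}" for t
      unfolding cU[OF that] by (rule sobolev_represents[OF us[OF that] s_ge(1)])
    have "coeff_solution \<epsilon> T M U"
      unfolding coeff_solution_def using A hbU coefficient_ode[where u = u and U = U and M = M, OF _ _ repU hbU] by auto
    from err[OF this, unfolded cubic_error_def] obtain \<tau>0 where \<tau>0: "0 < \<tau>0"
      "\<And>\<tau> n. 0 < \<tau> \<and> \<tau> \<le> \<tau>0 \<and> real n * \<tau> \<le> T \<Longrightarrow> Hs_le r (eps_gain \<epsilon> * \<tau> ^ 3 * K M) (U (real n * \<tau>) - (Step \<epsilon> \<tau> ^^ n) (U 0))"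
      by blast
    show "\<exists>\<tau>\<^sub>0>0. \<forall>\<tau> n. 0 < \<tau> \<and> \<tau> \<le> \<tau>\<^sub>0 \<and> real n * \<tau> \<le> T \<longrightarrow>
          (\<lambda>x. u (real n * \<tau>) x - (splitting_step P \<epsilon> \<tau> ^^ n) (u 0) x) \<in> sobolev r \<and>
          sobolev_norm r (\<lambda>x. u (real n * \<tau>) x - (splitting_step P \<epsilon> \<tau> ^^ n) (u 0) x) \<le> eps_gain \<epsilon> * \<tau> ^ 3 * K (SUP t\<in>{0..T}. sobolev_norm s (u t))"
    proof (intro exI[of _ \<tau>0] conjI[OF \<tau>0(1)] allI impI)
      fix \<tau> :: real and n :: nat assume h: "0 < \<tau> \<and> \<tau> \<le> \<tau>0 \<and> real n * \<tau> \<le> T"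
      then have nT: "real n * \<tau> \<in> {0..T}" by simp
      have rpU: "represents_Hs (u t) (U t)" if "t \<in> {0..T}" for t using repU[OF that] hbU[OF that] by (auto simp: represents_Hs_def)
      have "represents_Hs ((splitting_step P \<epsilon> \<tau> ^^ n) (u 0)) ((Step \<epsilon> \<tau> ^^ n) (U 0))"
        using A assms(8) by (intro represents_Hs_splitting_iterate rpU) auto
      from represents_Hs_represents[OF represents_Hs_diff[OF rpU[OF nT] this]]
      have "represents (\<lambda>x. u (real n * \<tau>) x - (splitting_step P \<epsilon> \<tau> ^^ n) (u 0) x) (coord (U (real n * \<tau>) - (Step \<epsilon> \<tau> ^^ n) (U 0)))" .
      from represents_sobolev[OF this \<tau>0(2)[OF h, unfolded Hs_le_def]]
      show "(\<lambda>x. u (real n * \<tau>) x - (splitting_step P \<epsilon> \<tau> ^^ n) (u 0) x) \<in> sobolev r \<and>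
          sobolev_norm r (\<lambda>x. u (real n * \<tau>) x - (splitting_step P \<epsilon> \<tau> ^^ n) (u 0) x) \<le> eps_gain \<epsilon> * \<tau> ^ 3 * K (SUP t\<in>{0..T}. sobolev_norm s (u t))"
        by (simp add: M_def)
    qed
  qed
qed

end
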